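(* Let $S_1,S_2$ be finite inverse semigroups, $[S_1,S_2;U]$ an amalgam of inverse semigroups, and let $e\in E(S_1*_US_2)$. Suppose that $e$ is not $\mathcal{D}^{S_1*_US_2}$-related to any idempotent of $S_1$ or $S_2$. Then $H_e^{S_1*_US_2}$ is a homomorphic image of some subgroup of the maximal subgroup $H_g^{S_k}$ of $S_k$, for some $k\in\{1,2\}$ and some $g\in E(S_k)$.
   Context: An amalgam $[S_1,S_2;U]$ of inverse semigroups consists of inverse semigroups $S_1,S_2$ and an inverse semigroup $U$ embedded in both. $S_1*_US_2$ denotes the amalgamated free product in the category of inverse semigroups; $S_1$ and $S_2$ embed in it, with intersection $U$, and are identified with their images. $E(S)$ is the set of idempotents of $S$; $\mathcal{D}^S$ is Green's $\mathcal{D}$-relation in $S$; $H_e^S$ is the $\mathcal{H}$-class of the idempotent $e$ in $S$, i.e. the maximal subgroup of $S$ with identity $e$. *)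

theory Defs
  imports "HOL-Algebra.Group"
begin

record 'a sgrp = "'a partial_object" +
  sg_mult :: "['a, 'a] \<Rightarrow> 'a" (infixl "\<cdot>\<index>" 70)

locale sgrp =
  fixes S (structure)
  assumes nonempty: "carrier S \<noteq> {}"
    and closed [simp, intro]: "\<lbrakk>a \<in> carrier S; b \<in> carrier S\<rbrakk> \<Longrightarrow> a \<cdot> b \<in> carrier S"
    and assoc: "\<lbrakk>a \<in> carrier S; b \<in> carrier S; c \<in> carrier S\<rbrakk> \<Longrightarrow> (a \<cdot> b) \<cdot> c = a \<cdot> (b \<cdot> c)"

definition is_inverse :: "('a, 'm) sgrp_scheme \<Rightarrow> 'a \<Rightarrow> 'a \<Rightarrow> bool" where
  "is_inverse S a b \<longleftrightarrow> a \<cdot>\<^bsub>S\<^esub> b \<cdot>\<^bsub>S\<^esub> a = a \<and> b \<cdot>\<^bsub>S\<^esub> a \<cdot>\<^bsub>S\<^esub> b = b"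

locale inverse_sgrp = sgrp +
  assumes ex1_inverse: "a \<in> carrier S \<Longrightarrow> \<exists>!b. b \<in> carrier S \<and> is_inverse S a b"

definition sg_inv :: "('a, 'm) sgrp_scheme \<Rightarrow> 'a \<Rightarrow> 'a" where
  "sg_inv S a = (THE b. b \<in> carrier S \<and> is_inverse S a b)"

definition idempotents :: "('a, 'm) sgrp_scheme \<Rightarrow> 'a set" where
  "idempotents S = {e \<in> carrier S. e \<cdot>\<^bsub>S\<^esub> e = e}"

definition sg_hom :: "('a, 'm) sgrp_scheme \<Rightarrow> ('b, 'n) sgrp_scheme \<Rightarrow> ('a \<Rightarrow> 'b) set" where
  "sg_hom S T = {f \<in> carrier S \<rightarrow> carrier T.
     \<forall>a\<in>carrier S. \<forall>b\<in>carrier S. f (a \<cdot>\<^bsub>S\<^esub> b) = f a \<cdot>\<^bsub>T\<^esub> f b}"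

definition green_L :: "('a, 'm) sgrp_scheme \<Rightarrow> ('a \<times> 'a) set" where
  "green_L S = {(a, b) \<in> carrier S \<times> carrier S.
     insert a ((\<lambda>x. x \<cdot>\<^bsub>S\<^esub> a) ` carrier S) = insert b ((\<lambda>x. x \<cdot>\<^bsub>S\<^esub> b) ` carrier S)}"

definition green_R :: "('a, 'm) sgrp_scheme \<Rightarrow> ('a \<times> 'a) set" where
  "green_R S = {(a, b) \<in> carrier S \<times> carrier S.
     insert a ((\<lambda>x. a \<cdot>\<^bsub>S\<^esub> x) ` carrier S) = insert b ((\<lambda>x. b \<cdot>\<^bsub>S\<^esub> x) ` carrier S)}"

definition green_H :: "('a, 'm) sgrp_scheme \<Rightarrow> ('a \<times> 'a) set" where
  "green_H S = green_L S \<inter> green_R S"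

definition green_D :: "('a, 'm) sgrp_scheme \<Rightarrow> ('a \<times> 'a) set" where
  "green_D S = green_L S O green_R S"

definition max_subgroup :: "('a, 'm) sgrp_scheme \<Rightarrow> 'a \<Rightarrow> 'a monoid" where
  "max_subgroup S e = \<lparr>carrier = green_H S `` {e}, mult = sg_mult S, one = e\<rparr>"

locale inverse_amalgam =
  S1: inverse_sgrp S1 + S2: inverse_sgrp S2 + U: inverse_sgrp U
  for S1 :: "('a, 'm) sgrp_scheme" and S2 :: "('b, 'n) sgrp_scheme"
    and U :: "('u, 'k) sgrp_scheme" +
  fixes \<omega>1 :: "'u \<Rightarrow> 'a" and \<omega>2 :: "'u \<Rightarrow> 'b"
  assumes hom1: "\<omega>1 \<in> sg_hom U S1" and inj1: "inj_on \<omega>1 (carrier U)"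
    and hom2: "\<omega>2 \<in> sg_hom U S2" and inj2: "inj_on \<omega>2 (carrier U)"

text \<open>The product is given by the inverse-semigroup presentation
  Inv(S1 + S2 | multiplication tables of S1 and S2, \<open>\<omega>1 u = \<omega>2 u\<close>). No formal inverse letters are
  added: the inverse of a letter is its inverse in the factor it comes from.
  That this is the pushout in the category of inverse semigroups, with targets on an arbitrary
  type, is proved in \<open>inverse_sgrp_afp\<close>, \<open>afp_cocone\<close> and \<open>afp_universal\<close>.\<close>

definition afp_words :: "('a, 'm) sgrp_scheme \<Rightarrow> ('b, 'n) sgrp_scheme \<Rightarrow> ('a + 'b) list set" where
  "afp_words S1 S2 = {w. w \<noteq> [] \<and> set w \<subseteq> carrier S1 <+> carrier S2}"

definition word_inv ::
  "('a, 'm) sgrp_scheme \<Rightarrow> ('b, 'n) sgrp_scheme \<Rightarrow> ('a + 'b) list \<Rightarrow> ('a + 'b) list" where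
  "word_inv S1 S2 w = rev (map (map_sum (sg_inv S1) (sg_inv S2)) w)"

inductive afp_cong ::
  "('a, 'm) sgrp_scheme \<Rightarrow> ('b, 'n) sgrp_scheme \<Rightarrow> ('u, 'k) sgrp_scheme \<Rightarrow> ('u \<Rightarrow> 'a) \<Rightarrow> ('u \<Rightarrow> 'b) \<Rightarrow>
   ('a + 'b) list \<Rightarrow> ('a + 'b) list \<Rightarrow> bool"
  for S1 S2 U \<omega>1 \<omega>2 where
  cong_refl: "w \<in> afp_words S1 S2 \<Longrightarrow> afp_cong S1 S2 U \<omega>1 \<omega>2 w w"
| cong_sym: "afp_cong S1 S2 U \<omega>1 \<omega>2 v w \<Longrightarrow> afp_cong S1 S2 U \<omega>1 \<omega>2 w v"
| cong_trans: "\<lbrakk>afp_cong S1 S2 U \<omega>1 \<omega>2 u v; afp_cong S1 S2 U \<omega>1 \<omega>2 v w\<rbrakk>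
    \<Longrightarrow> afp_cong S1 S2 U \<omega>1 \<omega>2 u w"
| cong_append: "\<lbrakk>afp_cong S1 S2 U \<omega>1 \<omega>2 u v; afp_cong S1 S2 U \<omega>1 \<omega>2 x y\<rbrakk>
    \<Longrightarrow> afp_cong S1 S2 U \<omega>1 \<omega>2 (u @ x) (v @ y)"
| cong_mult1: "\<lbrakk>a \<in> carrier S1; b \<in> carrier S1\<rbrakk>
    \<Longrightarrow> afp_cong S1 S2 U \<omega>1 \<omega>2 [Inl a, Inl b] [Inl (a \<cdot>\<^bsub>S1\<^esub> b)]"
| cong_mult2: "\<lbrakk>a \<in> carrier S2; b \<in> carrier S2\<rbrakk>
    \<Longrightarrow> afp_cong S1 S2 U \<omega>1 \<omega>2 [Inr a, Inr b] [Inr (a \<cdot>\<^bsub>S2\<^esub> b)]"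
| cong_amalg: "u \<in> carrier U \<Longrightarrow> afp_cong S1 S2 U \<omega>1 \<omega>2 [Inl (\<omega>1 u)] [Inr (\<omega>2 u)]"
| cong_regular: "w \<in> afp_words S1 S2
    \<Longrightarrow> afp_cong S1 S2 U \<omega>1 \<omega>2 (w @ word_inv S1 S2 w @ w) w"
| cong_commute: "\<lbrakk>v \<in> afp_words S1 S2; w \<in> afp_words S1 S2\<rbrakk>
    \<Longrightarrow> afp_cong S1 S2 U \<omega>1 \<omega>2
          (v @ word_inv S1 S2 v @ w @ word_inv S1 S2 w)
          (w @ word_inv S1 S2 w @ v @ word_inv S1 S2 v)"

definition afp_class ::
  "('a, 'm) sgrp_scheme \<Rightarrow> ('b, 'n) sgrp_scheme \<Rightarrow> ('u, 'k) sgrp_scheme \<Rightarrow> ('u \<Rightarrow> 'a) \<Rightarrow> ('u \<Rightarrow> 'b) \<Rightarrow>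
   ('a + 'b) list \<Rightarrow> ('a + 'b) list set" where
  "afp_class S1 S2 U \<omega>1 \<omega>2 w = {v. afp_cong S1 S2 U \<omega>1 \<omega>2 w v}"

definition amalg_free_product ::
  "('a, 'm) sgrp_scheme \<Rightarrow> ('b, 'n) sgrp_scheme \<Rightarrow> ('u, 'k) sgrp_scheme \<Rightarrow> ('u \<Rightarrow> 'a) \<Rightarrow> ('u \<Rightarrow> 'b) \<Rightarrow>
   ('a + 'b) list set sgrp" where
  "amalg_free_product S1 S2 U \<omega>1 \<omega>2 =
     \<lparr>carrier = afp_class S1 S2 U \<omega>1 \<omega>2 ` afp_words S1 S2,
      sg_mult = (\<lambda>A B. \<Union>v\<in>A. \<Union>w\<in>B. afp_class S1 S2 U \<omega>1 \<omega>2 (v @ w))\<rparr>"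

definition afp_in1 ::
  "('a, 'm) sgrp_scheme \<Rightarrow> ('b, 'n) sgrp_scheme \<Rightarrow> ('u, 'k) sgrp_scheme \<Rightarrow> ('u \<Rightarrow> 'a) \<Rightarrow> ('u \<Rightarrow> 'b) \<Rightarrow>
   'a \<Rightarrow> ('a + 'b) list set" where
  "afp_in1 S1 S2 U \<omega>1 \<omega>2 a = afp_class S1 S2 U \<omega>1 \<omega>2 [Inl a]"

definition afp_in2 ::
  "('a, 'm) sgrp_scheme \<Rightarrow> ('b, 'n) sgrp_scheme \<Rightarrow> ('u, 'k) sgrp_scheme \<Rightarrow> ('u \<Rightarrow> 'a) \<Rightarrow> ('u \<Rightarrow> 'b) \<Rightarrow>
   'b \<Rightarrow> ('a + 'b) list set" where
  "afp_in2 S1 S2 U \<omega>1 \<omega>2 b = afp_class S1 S2 U \<omega>1 \<omega>2 [Inr b]"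

context sgrp
begin

lemma idemD: "e \<in> idempotents S \<Longrightarrow> e \<in> carrier S \<and> e \<cdot> e = e"
  by (simp add: idempotents_def)

lemma green_H_idem_iff:
  assumes e: "e \<in> idempotents S"
  shows "(e, a) \<in> green_H S \<longleftrightarrow> a \<in> carrier S \<and> e \<cdot> a = a \<and> a \<cdot> e = a
    \<and> (\<exists>x\<in>carrier S. x \<cdot> a = e) \<and> (\<exists>y\<in>carrier S. a \<cdot> y = e)" (is "?L \<longleftrightarrow> ?R")
proof
  have eS: "e \<in> carrier S" and ee: "e \<cdot> e = e" using idemD[OF e] by auto
  {
    assume L: ?L
    then have aS: "a \<in> carrier S"
      and l: "insert e ((\<lambda>x. x \<cdot> e) ` carrier S) = insert a ((\<lambda>x. x \<cdot> a) ` carrier S)"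
      and r: "insert e ((\<lambda>x. e \<cdot> x) ` carrier S) = insert a ((\<lambda>x. a \<cdot> x) ` carrier S)"
      by (auto simp: green_H_def green_L_def green_R_def)
    from l have "a = e \<or> (\<exists>x\<in>carrier S. a = x \<cdot> e)" by blast
    then have 1: "a \<cdot> e = a" using eS ee by (auto simp: assoc)
    from r have "a = e \<or> (\<exists>x\<in>carrier S. a = e \<cdot> x)" by blast
    then have 2: "e \<cdot> a = a" using eS ee by (auto simp: assoc[symmetric])
    from l have "e = a \<or> (\<exists>x\<in>carrier S. e = x \<cdot> a)" by blast
    then have 3: "\<exists>x\<in>carrier S. x \<cdot> a = e" using eS ee by auto
    from r have "e = a \<or> (\<exists>x\<in>carrier S. e = a \<cdot> x)" by blast
    then have 4: "\<exists>x\<in>carrier S. a \<cdot> x = e" using eS ee by auto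
    from aS 1 2 3 4 show ?R by auto
  }
  {
    assume R: ?R
    then obtain x y where aS: "a \<in> carrier S" and ea: "e \<cdot> a = a" and ae: "a \<cdot> e = a"
      and x: "x \<in> carrier S" "x \<cdot> a = e" and y: "y \<in> carrier S" "a \<cdot> y = e" by auto
    have "z \<cdot> e = (z \<cdot> x) \<cdot> a" if "z \<in> carrier S" for z
      using that x aS by (simp add: assoc)
    moreover have "z \<cdot> a = (z \<cdot> a) \<cdot> e" if "z \<in> carrier S" for z
      using that eS ae aS by (simp add: assoc)
    ultimately have l: "insert e ((\<lambda>x. x \<cdot> e) ` carrier S) = insert a ((\<lambda>x. x \<cdot> a) ` carrier S)"
      using aS eS ae x ee by (auto simp: image_iff) (metis closed)+
    have "e \<cdot> z = a \<cdot> (y \<cdot> z)" if "z \<in> carrier S" for z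
      using that y aS by (simp add: assoc[symmetric])
    moreover have "a \<cdot> z = e \<cdot> (a \<cdot> z)" if "z \<in> carrier S" for z
      using that eS ea aS by (simp add: assoc[symmetric])
    ultimately have r: "insert e ((\<lambda>x. e \<cdot> x) ` carrier S) = insert a ((\<lambda>x. a \<cdot> x) ` carrier S)"
      using aS eS ea y ee by (auto simp: image_iff) (metis closed)+
    show ?L using l r aS eS by (auto simp: green_H_def green_L_def green_R_def)
  }
qed

lemma group_max_subgroup:
  assumes e: "e \<in> idempotents S"
  shows "group (max_subgroup S e)"
proof -
  have eS: "e \<in> carrier S" and ee: "e \<cdot> e = e" using idemD[OF e] by auto
  note H = green_H_idem_iff[OF e]
  show ?thesis
  proof (rule groupI)
    fix a b assume "a \<in> carrier (max_subgroup S e)" "b \<in> carrier (max_subgroup S e)"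
    then obtain x y x' y' where *: "a \<in> carrier S" "b \<in> carrier S" "e \<cdot> a = a" "a \<cdot> e = a"
      "e \<cdot> b = b" "b \<cdot> e = b" "x \<in> carrier S" "x \<cdot> a = e" "y \<in> carrier S" "a \<cdot> y = e"
      "x' \<in> carrier S" "x' \<cdot> b = e" "y' \<in> carrier S" "b \<cdot> y' = e"
      by (auto simp: max_subgroup_def H)
    have "(x' \<cdot> x) \<cdot> (a \<cdot> b) = x' \<cdot> ((x \<cdot> a) \<cdot> b)"
      using *(1,2,7,11) by (simp add: assoc)
    then have 1: "(x' \<cdot> x) \<cdot> (a \<cdot> b) = e" using * by simp
    have "(a \<cdot> b) \<cdot> (y' \<cdot> y) = a \<cdot> ((b \<cdot> y') \<cdot> y)"
      using *(1,2,9,13) by (simp add: assoc)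
    also have "\<dots> = (a \<cdot> e) \<cdot> y" using *(1,9,14) eS by (simp add: assoc)
    finally have 2: "(a \<cdot> b) \<cdot> (y' \<cdot> y) = e" using * by simp
    have 3: "e \<cdot> (a \<cdot> b) = a \<cdot> b" using * eS by (simp add: assoc[symmetric])
    have 4: "(a \<cdot> b) \<cdot> e = a \<cdot> b" using * eS by (simp add: assoc)
    show "a \<otimes>\<^bsub>max_subgroup S e\<^esub> b \<in> carrier (max_subgroup S e)"
      using 1 2 3 4 * by (auto simp: max_subgroup_def H)
  next
    show "\<one>\<^bsub>max_subgroup S e\<^esub> \<in> carrier (max_subgroup S e)"
      using eS ee by (auto simp: max_subgroup_def H)
  next
    fix a b c
    assume "a \<in> carrier (max_subgroup S e)" "b \<in> carrier (max_subgroup S e)"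
      "c \<in> carrier (max_subgroup S e)"
    then show "a \<otimes>\<^bsub>max_subgroup S e\<^esub> b \<otimes>\<^bsub>max_subgroup S e\<^esub> c
      = a \<otimes>\<^bsub>max_subgroup S e\<^esub> (b \<otimes>\<^bsub>max_subgroup S e\<^esub> c)"
      by (auto simp: max_subgroup_def H assoc)
  next
    fix a assume "a \<in> carrier (max_subgroup S e)"
    then show "\<one>\<^bsub>max_subgroup S e\<^esub> \<otimes>\<^bsub>max_subgroup S e\<^esub> a = a"
      by (auto simp: max_subgroup_def H)
  next
    fix a assume "a \<in> carrier (max_subgroup S e)"
    then obtain x y where *: "a \<in> carrier S" "e \<cdot> a = a" "a \<cdot> e = a"
      "x \<in> carrier S" "x \<cdot> a = e" "y \<in> carrier S" "a \<cdot> y = e"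
      by (auto simp: max_subgroup_def H)
    let ?b = "e \<cdot> x \<cdot> e"
    have bS: "?b \<in> carrier S" using * eS by simp
    have 1: "?b \<cdot> a = e" using * eS ee by (simp add: assoc)
    have "a \<cdot> ?b = a \<cdot> x \<cdot> e" using * eS by (simp add: assoc[symmetric])
    also have "\<dots> = a \<cdot> x \<cdot> (a \<cdot> y)" using * by simp
    also have "\<dots> = a \<cdot> ((x \<cdot> a) \<cdot> y)" using *(1,4,6) by (simp add: assoc)
    also have "\<dots> = (a \<cdot> e) \<cdot> y" using *(1,5,6) eS by (simp add: assoc)
    finally have 2: "a \<cdot> ?b = e" using * by simp
    have 3: "e \<cdot> ?b = ?b" using * eS ee by (simp add: assoc[symmetric])
    have 4: "?b \<cdot> e = ?b" using * eS ee by (simp add: assoc)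
    have "?b \<in> carrier (max_subgroup S e)"
      using bS 1 2 3 4 * by (auto simp: max_subgroup_def H)
    then show "\<exists>b\<in>carrier (max_subgroup S e). b \<otimes>\<^bsub>max_subgroup S e\<^esub> a = \<one>\<^bsub>max_subgroup S e\<^esub>"
      using 1 by (auto simp: max_subgroup_def)
  qed
qed

end

context inverse_sgrp
begin

lemma sg_inv_props:
  assumes "a \<in> carrier S"
  shows "sg_inv S a \<in> carrier S" "a \<cdot> sg_inv S a \<cdot> a = a" "sg_inv S a \<cdot> a \<cdot> sg_inv S a = sg_inv S a"
  using theI'[OF ex1_inverse[OF assms]] by (auto simp: sg_inv_def is_inverse_def)

lemma sg_inv_closed [simp, intro]: "a \<in> carrier S \<Longrightarrow> sg_inv S a \<in> carrier S"
  by (rule sg_inv_props)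

lemma sg_inv_eq:
  assumes "a \<in> carrier S" "b \<in> carrier S" "a \<cdot> b \<cdot> a = a" "b \<cdot> a \<cdot> b = b"
  shows "sg_inv S a = b"
  using assms unfolding sg_inv_def is_inverse_def
  by (intro the1_equality ex1_inverse[unfolded is_inverse_def]) auto

lemma sg_inv_inv [simp]: "a \<in> carrier S \<Longrightarrow> sg_inv S (sg_inv S a) = a"
  by (rule sg_inv_eq) (auto intro: sg_inv_props)

lemma idem_mult:
  assumes e: "e \<in> idempotents S" and f: "f \<in> idempotents S"
  shows "e \<cdot> f \<in> idempotents S"
proof -
  note [simp] = assoc
  have E: "e \<in> carrier S" "e \<cdot> e = e" and F: "f \<in> carrier S" "f \<cdot> f = f"
    using idemD e f by auto
  define x where "x = sg_inv S (e \<cdot> f)"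
  have xS: "x \<in> carrier S" using E F by (simp add: x_def)
  have x1: "(e \<cdot> f) \<cdot> x \<cdot> (e \<cdot> f) = e \<cdot> f" and x2: "x \<cdot> (e \<cdot> f) \<cdot> x = x"
    using sg_inv_props[of "e \<cdot> f"] E F unfolding x_def by blast+
  have E2: "e \<cdot> (e \<cdot> z) = e \<cdot> z" if "z \<in> carrier S" for z
    using E that by (metis assoc)
  have F2: "f \<cdot> (f \<cdot> z) = f \<cdot> z" if "z \<in> carrier S" for z
    using F that by (metis assoc)
  have x2': "x \<cdot> (e \<cdot> (f \<cdot> (x \<cdot> z))) = x \<cdot> z" if "z \<in> carrier S" for z
  proof -
    have "x \<cdot> (e \<cdot> (f \<cdot> (x \<cdot> z))) = (x \<cdot> (e \<cdot> f) \<cdot> x) \<cdot> z" using E F xS that by simp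
    then show ?thesis using x2 by simp
  qed
  have "x = f \<cdot> x \<cdot> e"
    unfolding x_def
  proof (rule sg_inv_eq, unfold x_def[symmetric])
    show "e \<cdot> f \<cdot> (f \<cdot> x \<cdot> e) \<cdot> (e \<cdot> f) = e \<cdot> f"
      using x1 E F xS by (simp add: E2 F2)
    show "f \<cdot> x \<cdot> e \<cdot> (e \<cdot> f) \<cdot> (f \<cdot> x \<cdot> e) = f \<cdot> x \<cdot> e"
      using E F xS by (simp add: E2 F2 x2')
  qed (use E F xS in auto)
  then have xx: "x \<cdot> x = x"
  proof -
    have "x \<cdot> x = (f \<cdot> x \<cdot> e) \<cdot> (f \<cdot> x \<cdot> e)" using \<open>x = f \<cdot> x \<cdot> e\<close> by simp
    also have "\<dots> = f \<cdot> x \<cdot> e" using E F xS by (simp add: x2')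
    finally show ?thesis using \<open>x = f \<cdot> x \<cdot> e\<close> by simp
  qed
  have "sg_inv S x = x" using xS xx by (intro sg_inv_eq) auto
  moreover have "sg_inv S x = e \<cdot> f" unfolding x_def using E F by (intro sg_inv_inv) auto
  ultimately show ?thesis using xx xS by (simp add: idempotents_def)
qed

lemma idem_commute:
  assumes e: "e \<in> idempotents S" and f: "f \<in> idempotents S"
  shows "e \<cdot> f = f \<cdot> e"
proof -
  have E: "e \<in> carrier S" "e \<cdot> e = e" and F: "f \<in> carrier S" "f \<cdot> f = f"
    using idemD e f by auto
  have E2: "e \<cdot> (e \<cdot> z) = e \<cdot> z" if "z \<in> carrier S" for z
    using E that by (metis assoc)
  have F2: "f \<cdot> (f \<cdot> z) = f \<cdot> z" if "z \<in> carrier S" for z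
    using F that by (metis assoc)
  have ef: "(e \<cdot> f) \<cdot> (e \<cdot> f) = e \<cdot> f" and fe: "(f \<cdot> e) \<cdot> (f \<cdot> e) = f \<cdot> e"
    using idem_mult[OF e f] idem_mult[OF f e] idemD by blast+
  have "sg_inv S (e \<cdot> f) = e \<cdot> f"
    using E F ef by (intro sg_inv_eq) auto
  moreover have "sg_inv S (e \<cdot> f) = f \<cdot> e"
    using E F ef fe by (intro sg_inv_eq) (auto simp: assoc E2 F2)
  ultimately show ?thesis by simp
qed

lemma idem_left: "a \<in> carrier S \<Longrightarrow> a \<cdot> sg_inv S a \<in> idempotents S"
  using sg_inv_props[of a] by (simp add: idempotents_def assoc[symmetric])

lemma idem_right: "a \<in> carrier S \<Longrightarrow> sg_inv S a \<cdot> a \<in> idempotents S"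
  using sg_inv_props[of a] by (simp add: idempotents_def assoc[symmetric])

lemma sg_inv_mult:
  assumes a: "a \<in> carrier S" and b: "b \<in> carrier S"
  shows "sg_inv S (a \<cdot> b) = sg_inv S b \<cdot> sg_inv S a"
proof (rule sg_inv_eq)
  let ?a = "sg_inv S a" and ?b = "sg_inv S b"
  have c: "(b \<cdot> ?b) \<cdot> (?a \<cdot> a) = (?a \<cdot> a) \<cdot> (b \<cdot> ?b)"
    using a b by (intro idem_commute idem_left idem_right)
  have "a \<cdot> b \<cdot> (?b \<cdot> ?a) \<cdot> (a \<cdot> b) = a \<cdot> ((b \<cdot> ?b) \<cdot> (?a \<cdot> a)) \<cdot> b"
    using a b by (simp add: assoc)
  also have "\<dots> = (a \<cdot> ?a \<cdot> a) \<cdot> (b \<cdot> ?b \<cdot> b)"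
    unfolding c using a b by (simp add: assoc)
  finally show "a \<cdot> b \<cdot> (?b \<cdot> ?a) \<cdot> (a \<cdot> b) = a \<cdot> b"
    using a b by (simp add: sg_inv_props)
  have "?b \<cdot> ?a \<cdot> (a \<cdot> b) \<cdot> (?b \<cdot> ?a) = ?b \<cdot> ((?a \<cdot> a) \<cdot> (b \<cdot> ?b)) \<cdot> ?a"
    using a b by (simp add: assoc)
  also have "\<dots> = (?b \<cdot> b \<cdot> ?b) \<cdot> (?a \<cdot> a \<cdot> ?a)"
    unfolding c[symmetric] using a b by (simp add: assoc)
  finally show "?b \<cdot> ?a \<cdot> (a \<cdot> b) \<cdot> (?b \<cdot> ?a) = ?b \<cdot> ?a"
    using a b by (simp add: sg_inv_props)
qed (use a b in auto)

end

lemma sg_homD: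
  assumes "f \<in> sg_hom S T"
  shows "a \<in> carrier S \<Longrightarrow> f a \<in> carrier T"
    and "\<lbrakk>a \<in> carrier S; b \<in> carrier S\<rbrakk> \<Longrightarrow> f (a \<cdot>\<^bsub>S\<^esub> b) = f a \<cdot>\<^bsub>T\<^esub> f b"
  using assms by (auto simp: sg_hom_def)

lemma sg_hom_inv:
  assumes S: "inverse_sgrp S" and T: "inverse_sgrp T"
    and f: "f \<in> sg_hom S T" and a: "a \<in> carrier S"
  shows "f (sg_inv S a) = sg_inv T (f a)"
proof -
  interpret S: inverse_sgrp S by fact
  interpret T: inverse_sgrp T by fact
  note h = sg_homD[OF f]
  let ?b = "sg_inv S a"
  have "f a \<cdot>\<^bsub>T\<^esub> f ?b \<cdot>\<^bsub>T\<^esub> f a = f (a \<cdot>\<^bsub>S\<^esub> ?b \<cdot>\<^bsub>S\<^esub> a)"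
    and "f ?b \<cdot>\<^bsub>T\<^esub> f a \<cdot>\<^bsub>T\<^esub> f ?b = f (?b \<cdot>\<^bsub>S\<^esub> a \<cdot>\<^bsub>S\<^esub> ?b)"
    using a by (simp_all add: h)
  then show ?thesis
    using a h(1) by (intro T.sg_inv_eq[symmetric]) (auto simp: S.sg_inv_props)
qed

lemma inverse_sgrpI:
  assumes S: "sgrp S"
    and reg: "\<And>a. a \<in> carrier S \<Longrightarrow> \<exists>b\<in>carrier S. is_inverse S a b"
    and com: "\<And>e f. \<lbrakk>e \<in> idempotents S; f \<in> idempotents S\<rbrakk> \<Longrightarrow> e \<cdot>\<^bsub>S\<^esub> f = f \<cdot>\<^bsub>S\<^esub> e"
  shows "inverse_sgrp S"
proof -
  interpret S: sgrp S by fact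
  have "b = c" if A: "a \<in> carrier S" "b \<in> carrier S" "c \<in> carrier S"
    and "is_inverse S a b" "is_inverse S a c" for a b c
  proof -
    note i = that(4,5)[unfolded is_inverse_def]
    have 1: "a \<cdot>\<^bsub>S\<^esub> b \<in> idempotents S" "b \<cdot>\<^bsub>S\<^esub> a \<in> idempotents S"
      "a \<cdot>\<^bsub>S\<^esub> c \<in> idempotents S" "c \<cdot>\<^bsub>S\<^esub> a \<in> idempotents S"
      using i A by (simp_all add: idempotents_def S.assoc[symmetric])
    have "b = b \<cdot>\<^bsub>S\<^esub> (a \<cdot>\<^bsub>S\<^esub> c \<cdot>\<^bsub>S\<^esub> a) \<cdot>\<^bsub>S\<^esub> b" using i by simp
    also have "\<dots> = b \<cdot>\<^bsub>S\<^esub> ((a \<cdot>\<^bsub>S\<^esub> c) \<cdot>\<^bsub>S\<^esub> (a \<cdot>\<^bsub>S\<^esub> b))" using A by (simp add: S.assoc)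
    also have "\<dots> = b \<cdot>\<^bsub>S\<^esub> ((a \<cdot>\<^bsub>S\<^esub> b) \<cdot>\<^bsub>S\<^esub> (a \<cdot>\<^bsub>S\<^esub> c))" using com[OF 1(3) 1(1)] by simp
    also have "\<dots> = (b \<cdot>\<^bsub>S\<^esub> a \<cdot>\<^bsub>S\<^esub> b) \<cdot>\<^bsub>S\<^esub> a \<cdot>\<^bsub>S\<^esub> c" using A by (simp add: S.assoc)
    finally have b: "b = b \<cdot>\<^bsub>S\<^esub> a \<cdot>\<^bsub>S\<^esub> c" using i by simp
    have "c = c \<cdot>\<^bsub>S\<^esub> (a \<cdot>\<^bsub>S\<^esub> b \<cdot>\<^bsub>S\<^esub> a) \<cdot>\<^bsub>S\<^esub> c" using i by simp
    also have "\<dots> = ((c \<cdot>\<^bsub>S\<^esub> a) \<cdot>\<^bsub>S\<^esub> (b \<cdot>\<^bsub>S\<^esub> a)) \<cdot>\<^bsub>S\<^esub> c" using A by (simp add: S.assoc)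
    also have "\<dots> = ((b \<cdot>\<^bsub>S\<^esub> a) \<cdot>\<^bsub>S\<^esub> (c \<cdot>\<^bsub>S\<^esub> a)) \<cdot>\<^bsub>S\<^esub> c" using com[OF 1(4) 1(2)] by simp
    also have "\<dots> = b \<cdot>\<^bsub>S\<^esub> a \<cdot>\<^bsub>S\<^esub> (c \<cdot>\<^bsub>S\<^esub> a \<cdot>\<^bsub>S\<^esub> c)" using A by (simp add: S.assoc)
    finally have "c = b \<cdot>\<^bsub>S\<^esub> a \<cdot>\<^bsub>S\<^esub> c" using i by simp
    with b show ?thesis by simp
  qed
  then show ?thesis
    using reg by unfold_locales blast
qed

context inverse_amalgam
begin

abbreviation W where "W \<equiv> afp_words S1 S2"
abbreviation wi where "wi \<equiv> word_inv S1 S2"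
abbreviation C (infix "\<approx>" 50) where "C \<equiv> afp_cong S1 S2 U \<omega>1 \<omega>2"
abbreviation cl where "cl \<equiv> afp_class S1 S2 U \<omega>1 \<omega>2"
abbreviation P where "P \<equiv> amalg_free_product S1 S2 U \<omega>1 \<omega>2"

lemma W_append [simp, intro]: "\<lbrakk>v \<in> W; w \<in> W\<rbrakk> \<Longrightarrow> v @ w \<in> W"
  by (auto simp: afp_words_def)

lemma wi_W [simp, intro]: "w \<in> W \<Longrightarrow> wi w \<in> W"
  by (auto simp: afp_words_def word_inv_def Plus_def)

lemma wi_append: "wi (v @ w) = wi w @ wi v"
  by (simp add: word_inv_def)

lemma wi_wi: "w \<in> W \<Longrightarrow> wi (wi w) = w"
  by (force simp: afp_words_def word_inv_def rev_map Plus_def intro!: map_idI)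

lemma cong_W: "v \<approx> w \<Longrightarrow> v \<in> W \<and> w \<in> W"
proof (induction rule: afp_cong.induct)
  case (cong_amalg u)
  then show ?case using sg_homD(1)[OF hom1] sg_homD(1)[OF hom2] by (auto simp: afp_words_def)
qed (auto simp: afp_words_def word_inv_def Plus_def)

lemma cong_wi: "v \<approx> w \<Longrightarrow> wi v \<approx> wi w"
proof (induction rule: afp_cong.induct)
  case (cong_mult1 a b)
  then show ?case
    using afp_cong.cong_mult1[of "sg_inv S1 b" S1 "sg_inv S1 a"]
    by (simp add: word_inv_def S1.sg_inv_mult)
next
  case (cong_mult2 a b)
  then show ?case
    using afp_cong.cong_mult2[of "sg_inv S2 b" S2 "sg_inv S2 a"]
    by (simp add: word_inv_def S2.sg_inv_mult)
next
  case (cong_amalg u)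
  then show ?case
    using afp_cong.cong_amalg[of "sg_inv U u" U S1 S2 \<omega>1 \<omega>2]
      sg_hom_inv[OF U.inverse_sgrp_axioms S1.inverse_sgrp_axioms hom1]
      sg_hom_inv[OF U.inverse_sgrp_axioms S2.inverse_sgrp_axioms hom2]
    by (simp add: word_inv_def)
next
  case (cong_regular w)
  then show ?case
    using afp_cong.cong_regular[of "wi w" S1 S2 U \<omega>1 \<omega>2] by (simp add: wi_append)
next
  case (cong_commute v w)
  then show ?case
    using afp_cong.cong_commute[of w S1 S2 v U \<omega>1 \<omega>2] by (simp add: wi_append wi_wi)
qed (auto simp: wi_append intro: afp_cong.intros)

lemma cl_eq_iff: "v \<in> W \<Longrightarrow> cl v = cl w \<longleftrightarrow> v \<approx> w"
  unfolding afp_class_def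
  by (auto intro: cong_refl cong_sym cong_trans)

lemma P_carrier: "carrier P = cl ` W"
  by (simp add: amalg_free_product_def)

lemma P_mult: "\<lbrakk>v \<in> W; w \<in> W\<rbrakk> \<Longrightarrow> cl v \<cdot>\<^bsub>P\<^esub> cl w = cl (v @ w)"
  unfolding amalg_free_product_def afp_class_def
  by (auto intro: cong_append cong_trans cong_refl)

lemma cong_idem_wi:
  assumes w: "w \<in> W" and id: "w @ w \<approx> w"
  shows "w \<approx> w @ wi w"
proof -
  let ?u = "wi w"
  note R = cong_refl and T = cong_trans and A = cong_append and Y = cong_sym
  have u: "?u \<in> W" using w by simp
  have uu: "?u @ ?u \<approx> ?u" using cong_wi[OF id] by (simp add: wi_append)
  have wuw: "w @ ?u @ w \<approx> w" using w by (rule cong_regular)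
  have uwu: "?u @ w @ ?u \<approx> ?u" using cong_regular[OF u] w by (simp add: wi_wi)
  have com: "w @ ?u @ ?u @ w \<approx> ?u @ w @ w @ ?u"
    using cong_commute[OF w u, of U \<omega>1 \<omega>2] w by (simp add: wi_wi)
  have "w @ (?u @ ?u) @ w \<approx> w @ ?u @ w" using uu w u by (intro A R)
  then have 1: "w @ ?u @ ?u @ w \<approx> w" using T[OF _ wuw] by simp
  have "?u @ (w @ w) @ ?u \<approx> ?u @ w @ ?u" using id w u by (intro A R)
  then have 2: "?u @ w @ w @ ?u \<approx> ?u" using T[OF _ uwu] by simp
  have wu: "w \<approx> ?u" using T[OF T[OF Y[OF 1] com] 2] .
  have "w \<approx> w @ w" using id Y by blast
  moreover have "w @ w \<approx> w @ ?u" using wu w by (intro A R)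
  ultimately show ?thesis using T by blast
qed

theorem inverse_sgrp_afp: "inverse_sgrp P"
proof (rule inverse_sgrpI)
  show "sgrp P"
  proof
    obtain a where "a \<in> carrier S1" using S1.nonempty by blast
    then have "[Inl a] \<in> W" by (auto simp: afp_words_def)
    then show "carrier P \<noteq> {}" by (auto simp: P_carrier)
  qed (auto simp: P_carrier P_mult)
next
  fix a assume "a \<in> carrier P"
  then obtain w where w: "w \<in> W" "a = cl w" by (auto simp: P_carrier)
  then have "is_inverse P a (cl (wi w))"
    using cong_regular[OF w(1), of U \<omega>1 \<omega>2] cong_regular[OF wi_W[OF w(1)], of U \<omega>1 \<omega>2]
    by (simp add: is_inverse_def P_mult cl_eq_iff wi_wi)
  then show "\<exists>b\<in>carrier P. is_inverse P a b" using w by (auto simp: P_carrier)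
next
  fix e f assume "e \<in> idempotents P" "f \<in> idempotents P"
  then obtain v w where v: "v \<in> W" "e = cl v" "e \<cdot>\<^bsub>P\<^esub> e = e" and w: "w \<in> W" "f = cl w" "f \<cdot>\<^bsub>P\<^esub> f = f"
    by (auto simp: idempotents_def P_carrier)
  then have "v @ v \<approx> v" "w @ w \<approx> w" by (simp_all add: P_mult cl_eq_iff)
  note v' = cong_idem_wi[OF v(1) this(1)] and w' = cong_idem_wi[OF w(1) this(2)]
  have "v @ w \<approx> (v @ wi v) @ (w @ wi w)" "w @ v \<approx> (w @ wi w) @ (v @ wi v)"
    using v' w' by (auto intro!: cong_append simp del: append_assoc)
  then have "v @ w \<approx> w @ v"
    using cong_commute[OF v(1) w(1), of U \<omega>1 \<omega>2] by (simp, blast intro: cong_trans cong_sym)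
  then show "e \<cdot>\<^bsub>P\<^esub> f = f \<cdot>\<^bsub>P\<^esub> e" using v w by (simp add: P_mult cl_eq_iff)
qed

theorem afp_cocone:
  "afp_in1 S1 S2 U \<omega>1 \<omega>2 \<in> sg_hom S1 P"
  "afp_in2 S1 S2 U \<omega>1 \<omega>2 \<in> sg_hom S2 P"
  "u \<in> carrier U \<Longrightarrow> afp_in1 S1 S2 U \<omega>1 \<omega>2 (\<omega>1 u) = afp_in2 S1 S2 U \<omega>1 \<omega>2 (\<omega>2 u)"
proof -
  have l: "[Inl a] \<in> W" if "a \<in> carrier S1" for a using that by (auto simp: afp_words_def)
  have r: "[Inr a] \<in> W" if "a \<in> carrier S2" for a using that by (auto simp: afp_words_def)
  show "afp_in1 S1 S2 U \<omega>1 \<omega>2 \<in> sg_hom S1 P"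
    by (auto simp: sg_hom_def afp_in1_def P_carrier P_mult l cl_eq_iff intro: cong_mult1 cong_sym)
  show "afp_in2 S1 S2 U \<omega>1 \<omega>2 \<in> sg_hom S2 P"
    by (auto simp: sg_hom_def afp_in2_def P_carrier P_mult r cl_eq_iff intro: cong_mult2 cong_sym)
  show "u \<in> carrier U \<Longrightarrow> afp_in1 S1 S2 U \<omega>1 \<omega>2 (\<omega>1 u) = afp_in2 S1 S2 U \<omega>1 \<omega>2 (\<omega>2 u)"
    using sg_homD(1)[OF hom1] by (simp add: afp_in1_def afp_in2_def l cl_eq_iff cong_amalg)
qed

end

fun word_eval :: "('t, 'l) sgrp_scheme \<Rightarrow> ('c \<Rightarrow> 't) \<Rightarrow> 'c list \<Rightarrow> 't" where
  "word_eval T h [] = undefined"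
| "word_eval T h [x] = h x"
| "word_eval T h (x # y # xs) = h x \<cdot>\<^bsub>T\<^esub> word_eval T h (y # xs)"

lemma word_eval_Cons: "xs \<noteq> [] \<Longrightarrow> word_eval T h (x # xs) = h x \<cdot>\<^bsub>T\<^esub> word_eval T h xs"
  by (cases xs) auto

theorem (in inverse_amalgam) afp_universal:
  fixes T :: "('t, 'l) sgrp_scheme"
  assumes T: "inverse_sgrp T"
    and f1: "f1 \<in> sg_hom S1 T" and f2: "f2 \<in> sg_hom S2 T"
    and agree: "\<And>u. u \<in> carrier U \<Longrightarrow> f1 (\<omega>1 u) = f2 (\<omega>2 u)"
  shows "\<exists>f\<in>sg_hom P T. (\<forall>a\<in>carrier S1. f (afp_in1 S1 S2 U \<omega>1 \<omega>2 a) = f1 a)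
      \<and> (\<forall>b\<in>carrier S2. f (afp_in2 S1 S2 U \<omega>1 \<omega>2 b) = f2 b)
      \<and> (\<forall>g\<in>sg_hom P T. (\<forall>a\<in>carrier S1. g (afp_in1 S1 S2 U \<omega>1 \<omega>2 a) = f1 a)
            \<and> (\<forall>b\<in>carrier S2. g (afp_in2 S1 S2 U \<omega>1 \<omega>2 b) = f2 b)
          \<longrightarrow> (\<forall>p\<in>carrier P. g p = f p))"
proof -
  interpret T: inverse_sgrp T by fact
  define h where "h = case_sum f1 f2"
  let ?E = "word_eval T h"
  have h: "h x \<in> carrier T" if "x \<in> carrier S1 <+> carrier S2" for x
    using that sg_homD(1)[OF f1] sg_homD(1)[OF f2] by (auto simp: h_def)
  have hi: "h (map_sum (sg_inv S1) (sg_inv S2) x) = sg_inv T (h x)"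
    if "x \<in> carrier S1 <+> carrier S2" for x
    using that sg_hom_inv[OF S1.inverse_sgrp_axioms T f1] sg_hom_inv[OF S2.inverse_sgrp_axioms T f2]
    by (auto simp: h_def)
  have WI: "Q w" if "w \<in> W" and "\<And>x. x \<in> carrier S1 <+> carrier S2 \<Longrightarrow> Q [x]"
    and "\<And>x w. \<lbrakk>x \<in> carrier S1 <+> carrier S2; w \<in> W; Q w\<rbrakk> \<Longrightarrow> Q (x # w)" for Q w
    using that
  proof (induction w)
    case (Cons x w)
    then show ?case by (cases "w = []") (auto simp: afp_words_def)
  qed (simp add: afp_words_def)
  have E: "?E w \<in> carrier T" if "w \<in> W" for w
    using that by (rule WI) (auto simp: h word_eval_Cons afp_words_def)
  have EA: "?E (v @ w) = ?E v \<cdot>\<^bsub>T\<^esub> ?E w" if "v \<in> W" "w \<in> W" for v w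
  proof (rule WI[OF that(1)])
    fix x assume "x \<in> carrier S1 <+> carrier S2"
    then show "?E ([x] @ w) = ?E [x] \<cdot>\<^bsub>T\<^esub> ?E w"
      using that by (auto simp: word_eval_Cons afp_words_def)
  next
    fix x v assume "x \<in> carrier S1 <+> carrier S2" and "v \<in> W" and
      "?E (v @ w) = ?E v \<cdot>\<^bsub>T\<^esub> ?E w"
    moreover from this have "v \<noteq> []" by (simp add: afp_words_def)
    ultimately show "?E ((x # v) @ w) = ?E (x # v) \<cdot>\<^bsub>T\<^esub> ?E w"
      using that by (simp add: word_eval_Cons T.assoc h E)
  qed
  have EI: "?E (wi w) = sg_inv T (?E w)" if "w \<in> W" for w
    using that
  proof (rule WI)
    fix x assume "x \<in> carrier S1 <+> carrier S2"
    then show "?E (wi [x]) = sg_inv T (?E [x])"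
      by (simp add: word_inv_def hi)
  next
    fix x v assume *: "x \<in> carrier S1 <+> carrier S2" "v \<in> W" "?E (wi v) = sg_inv T (?E v)"
    have 1: "[x] \<in> W" using *(1) by (auto simp: afp_words_def)
    have "?E (wi (x # v)) = ?E (wi v @ wi [x])" by (simp add: word_inv_def)
    also have "\<dots> = ?E (wi v) \<cdot>\<^bsub>T\<^esub> ?E (wi [x])" using * 1 by (intro EA wi_W)
    also have "\<dots> = sg_inv T (?E v) \<cdot>\<^bsub>T\<^esub> sg_inv T (h x)"
      using * by (simp add: word_inv_def hi)
    also have "\<dots> = sg_inv T (h x \<cdot>\<^bsub>T\<^esub> ?E v)" using * by (simp add: T.sg_inv_mult h E)
    also have "h x \<cdot>\<^bsub>T\<^esub> ?E v = ?E (x # v)" using EA[OF 1 *(2)] by simp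
    finally show "?E (wi (x # v)) = sg_inv T (?E (x # v))" .
  qed
  have EC: "?E v = ?E w" if "v \<approx> w" for v w
    using that
  proof (induction rule: afp_cong.induct)
    case (cong_append u v x y)
    then show ?case using cong_W[OF cong_append(1)] cong_W[OF cong_append(2)] by (simp add: EA)
  next
    case (cong_mult1 a b)
    then show ?case by (simp add: h_def sg_homD[OF f1])
  next
    case (cong_mult2 a b)
    then show ?case by (simp add: h_def sg_homD[OF f2])
  next
    case (cong_amalg u)
    then show ?case by (simp add: h_def agree)
  next
    case (cong_regular w)
    then show ?case using T.sg_inv_props[OF E[OF cong_regular]]
      by (simp add: EA EI E T.assoc)
  next
    case (cong_commute v w)
    then show ?case
      using T.idem_commute[OF T.idem_left[OF E] T.idem_left[OF E], of v w]
      by (simp add: EA EI E T.assoc)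
  qed auto
  define f where "f = (\<lambda>A. ?E (SOME w. w \<in> A))"
  have f: "f (cl w) = ?E w" if "w \<in> W" for w
  proof -
    have "w \<in> cl w" using that by (simp add: afp_class_def cong_refl)
    then have "(SOME w'. w' \<in> cl w) \<in> cl w" by (rule someI)
    then show ?thesis using EC by (simp add: f_def afp_class_def)
  qed
  have l: "[Inl a] \<in> W" if "a \<in> carrier S1" for a using that by (auto simp: afp_words_def)
  have r: "[Inr a] \<in> W" if "a \<in> carrier S2" for a using that by (auto simp: afp_words_def)
  have "f \<in> sg_hom P T"
    by (auto simp: sg_hom_def P_carrier P_mult f E EA)
  moreover have "f (afp_in1 S1 S2 U \<omega>1 \<omega>2 a) = f1 a" if "a \<in> carrier S1" for a
    using that by (simp add: afp_in1_def f l h_def)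
  moreover have "f (afp_in2 S1 S2 U \<omega>1 \<omega>2 b) = f2 b" if "b \<in> carrier S2" for b
    using that by (simp add: afp_in2_def f r h_def)
  moreover have "g p = f p" if g: "g \<in> sg_hom P T"
    and g1: "\<forall>a\<in>carrier S1. g (afp_in1 S1 S2 U \<omega>1 \<omega>2 a) = f1 a"
    and g2: "\<forall>b\<in>carrier S2. g (afp_in2 S1 S2 U \<omega>1 \<omega>2 b) = f2 b"
    and p: "p \<in> carrier P" for g p
  proof -
    have b: "g (cl [x]) = h x" if "x \<in> carrier S1 <+> carrier S2" for x
      using that g1 g2 by (auto simp: h_def afp_in1_def afp_in2_def)
    have "g (cl w) = ?E w" if "w \<in> W" for w
      using that
    proof (rule WI)
      fix x v assume *: "x \<in> carrier S1 <+> carrier S2" "v \<in> W" "g (cl v) = ?E v"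
      have 1: "[x] \<in> W" using *(1) by (auto simp: afp_words_def)
      have "g (cl ([x] @ v)) = g (cl [x]) \<cdot>\<^bsub>T\<^esub> g (cl v)"
        using P_mult[OF 1 *(2)] sg_homD(2)[OF g, of "cl [x]" "cl v"] 1 *(2) by (simp add: P_carrier)
      also have "\<dots> = ?E ([x] @ v)" using EA[OF 1 *(2)] b[OF *(1)] *(3) by simp
      finally show "g (cl (x # v)) = ?E (x # v)" by simp
    qed (simp add: b)
    then show ?thesis using p by (auto simp: P_carrier f)
  qed
  ultimately show ?thesis by blast
qed

end

theory Submission
  imports Defs
begin

text \<open>Let \<open>S\<close> be the amalgamated product and \<open>R\<close> the \<open>\<R>\<close>-class of \<open>e\<close>, on which both factors act
  on the right by partial bijections and \<open>H\<^sub>e\<close> acts on the left. The orbits of the two factors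
  (lobes) are the vertices, and the orbits of \<open>U\<close> the edges, of a bipartite graph on which \<open>H\<^sub>e\<close>
  acts. If \<open>H\<^sub>e\<close> fixes the lobe of a point \<open>r\<close> under the \<open>k\<close>-th factor, and \<open>g\<close> is the least
  idempotent of that factor fixing \<open>r\<close>, then those \<open>t\<close> in \<open>H\<^sub>g\<close> with \<open>r t \<in> H\<^sub>e r\<close> form a subgroup,
  which is mapped onto \<open>H\<^sub>e\<close> by \<open>t \<mapsto> r t r\<inverse>\<close>.

  To find a fixed lobe, we use one device repeatedly: given a representation of \<open>S\<close> by partial
  bijections and an involution \<open>\<theta>\<close> commuting with \<open>U\<close>, conjugating only the action of the second
  factor by \<open>\<theta>\<close> gives another representation, by the universal property. Applied to two copies of
  \<open>R\<close>, interchanged along one edge, it shows that every edge separates the graph, so the graph is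
  a tree. Applied to \<open>R\<close> together with an orbit generated by \<open>U\<close>, interchanged along one edge, it
  shows that \<open>e\<close> is \<open>\<D>\<close>-related to an idempotent of \<open>U\<close> as soon as the set of lobes met by a word
  for \<open>e\<close> is disjoint from one of its \<open>H\<^sub>e\<close>-translates. Otherwise \<open>H\<^sub>e\<close> is finite, and a finite group
  acting on a bipartite tree without exchanging colours fixes a vertex.\<close>

subsection \<open>Fixed vertices of bipartite trees\<close>

text \<open>A pair \<open>(k, p)\<close> stands for the lobe of colour \<open>k\<close> through \<open>p\<close>, and every point \<open>p\<close> for an
  edge between the two lobes through it, shared with the other points of its \<open>E\<close>-class.\<close>

locale lobe_tree =
  fixes R :: "'p set" and L :: "bool \<Rightarrow> 'p rel" and E :: "'p rel"
  assumes equiv_L: "equiv R (L k)" and equiv_E: "equiv R E" and E_sub_L: "E \<subseteq> L k"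
    and connected: "\<lbrakk>p \<in> R; q \<in> R\<rbrakk> \<Longrightarrow> (p, q) \<in> (L True \<union> L False)\<^sup>*"
    and cut_exists: "Q \<in> R // E \<Longrightarrow> \<exists>\<sigma> :: bool \<times> 'p \<Rightarrow> bool.
      (\<forall>k p q. (p, q) \<in> L k \<longrightarrow> \<sigma> (k, p) = \<sigma> (k, q)) \<and> (\<forall>p\<in>R. \<sigma> (True, p) \<noteq> \<sigma> (False, p) \<longleftrightarrow> p \<in> Q)"
begin

section \<open>Cuts at an edge and the edges separating two lobes\<close>

definition is_cut :: "'p set \<Rightarrow> (bool \<times> 'p \<Rightarrow> bool) \<Rightarrow> bool" where
  "is_cut Q \<sigma> \<longleftrightarrow> (\<forall>k p q. (p, q) \<in> L k \<longrightarrow> \<sigma> (k, p) = \<sigma> (k, q)) \<and>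
     (\<forall>p\<in>R. \<sigma> (True, p) \<noteq> \<sigma> (False, p) \<longleftrightarrow> p \<in> Q)"

definition side :: "'p set \<Rightarrow> bool \<times> 'p \<Rightarrow> bool" where
  "side Q = (SOME \<sigma>. is_cut Q \<sigma>)"

text \<open>In a tree these are the edges of the path from \<open>v\<close> to \<open>m\<close>, so
  their number serves as the distance between two lobes.\<close>

definition separators :: "bool \<times> 'p \<Rightarrow> bool \<times> 'p \<Rightarrow> 'p set set" where
  "separators v m = {Q \<in> R // E. side Q v \<noteq> side Q m}"

lemma is_cut_side: "Q \<in> R // E \<Longrightarrow> is_cut Q (side Q)"
  unfolding side_def by (rule someI_ex[of "is_cut Q"], drule cut_exists) (simp only: is_cut_def)

lemma side_L: "\<lbrakk>Q \<in> R // E; (p, q) \<in> L k\<rbrakk> \<Longrightarrow> side Q (k, p) = side Q (k, q)"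
  using is_cut_side[of Q] by (auto simp: is_cut_def)

lemma side_cross: "\<lbrakk>Q \<in> R // E; p \<in> R\<rbrakk> \<Longrightarrow> side Q (\<not> k, p) = (side Q (k, p) \<noteq> (p \<in> Q))"
  using is_cut_side[of Q] by (cases k) (auto simp: is_cut_def)

lemma L_R: "(p, q) \<in> L k \<Longrightarrow> p \<in> R \<and> q \<in> R"
  using equiv_L[of k] by (auto simp: equiv_def refl_on_def)

lemma L_refl: "p \<in> R \<Longrightarrow> (p, p) \<in> L k"
  using equiv_L[of k] by (auto simp: equiv_def refl_on_def)

lemma edge_in: "p \<in> R \<Longrightarrow> E `` {p} \<in> R // E"
  by (rule quotientI)

lemma in_edge: "p \<in> R \<Longrightarrow> p \<in> E `` {p}"
  using equiv_E by (rule equiv_class_self)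

lemma edge_eq: "\<lbrakk>Q \<in> R // E; p \<in> Q\<rbrakk> \<Longrightarrow> Q = E `` {p} \<and> p \<in> R"
  using equiv_E Image_singleton_iff equiv_class_eq_iff quotientE by metis

lemma edge_sub: "\<lbrakk>q \<in> E `` {p}\<rbrakk> \<Longrightarrow> (p, q) \<in> L k"
  using E_sub_L by auto

text \<open>Induction along the bipartite graph: \<open>move\<close> only changes the point that
  represents a lobe, while \<open>cross\<close> passes to the other lobe through the same point. A
  step of \<open>connected\<close> in the other colour is made after crossing.\<close>

lemma connected_induct:
  assumes v: "P (k, p)" and p: "p \<in> R" and q: "q \<in> R"
    and move: "\<And>k p q. \<lbrakk>P (k, p); (p, q) \<in> L k\<rbrakk> \<Longrightarrow> P (k, q)"
    and cross: "\<And>k p. \<lbrakk>p \<in> R; P (k, p)\<rbrakk> \<Longrightarrow> P (\<not> k, p)"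
  shows "P (j, q)"
proof -
  have all: "P (i, p')" if "P (k', p')" "p' \<in> R" for i k' p'
    using that cross[of p' k'] by (cases "i = k'") auto
  have "P (k, q)" using connected[OF p q]
  proof (induction rule: rtrancl_induct)
    case base then show ?case by (rule v)
  next
    case (step y z)
    then obtain i where "(y, z) \<in> L i" by blast
    with step show ?case using all move L_R by metis
  qed
  then show ?thesis using all q by blast
qed

text \<open>By connectivity the truth value of \<open>\<sigma> v = side Q v\<close> is the same for
  all lobes \<open>v\<close>. So a cut at \<open>Q\<close> is unique up to exchanging its sides, and
  the choice made in \<open>side\<close> does not matter.\<close>

lemma side_unique:
  assumes Q: "Q \<in> R // E" and \<sigma>: "is_cut Q \<sigma>" and p: "p \<in> R" and q: "q \<in> R"
  shows "\<sigma> (k, p) \<noteq> \<sigma> (j, q) \<longleftrightarrow> side Q (k, p) \<noteq> side Q (j, q)"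
proof -
  have \<sigma>c: "\<sigma> (\<not> k, p) = (\<sigma> (k, p) \<noteq> (p \<in> Q))" if "p \<in> R" for k p
    using \<sigma> that by (cases k) (auto simp: is_cut_def)
  have "(\<sigma> (j, q) = side Q (j, q)) = (\<sigma> (k, p) = side Q (k, p))"
    by (rule connected_induct[where P = "\<lambda>v. (\<sigma> v = side Q v) = (\<sigma> (k, p) = side Q (k, p))", OF _ p q])
      (use \<sigma> Q in \<open>auto simp: \<sigma>c side_cross side_L is_cut_def\<close>)
  then show ?thesis by blast
qed

lemma separators_L: "(p, q) \<in> L k \<Longrightarrow> separators (k, p) m = separators (k, q) m"
  by (auto simp: separators_def side_L)

lemma separators_sym: "separators v m = separators m v"
  by (auto simp: separators_def)

text \<open>Crossing at \<open>p\<close> changes the side with respect to the edge of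
  \<open>p\<close> and to no other edge.\<close>

lemma separators_cross:
  assumes "p \<in> R"
  shows "separators (\<not> k, p) m = (if E `` {p} \<in> separators (k, p) m
    then separators (k, p) m - {E `` {p}} else insert (E `` {p}) (separators (k, p) m))"
proof -
  have "p \<in> Q \<longleftrightarrow> Q = E `` {p}" if "Q \<in> R // E" for Q
    using that assms edge_eq in_edge by blast
  then show ?thesis
    using assms edge_in[OF assms] in_edge[OF assms] by (auto simp: separators_def side_cross)
qed

text \<open>The induction starts at the target lobe, which nothing separates from itself, and each
  crossing adds or removes a single edge.\<close>

lemma finite_separators: "\<lbrakk>p \<in> R; q \<in> R\<rbrakk> \<Longrightarrow> finite (separators (k, p) (j, q))"
  by (rule connected_induct[where P = "\<lambda>v. finite (separators v (j, q))" and k = j and p = q])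
    (auto simp: separators_cross separators_L, simp add: separators_def)

text \<open>Otherwise the lobes that differ from \<open>(k, p)\<close> and are separated from it by
  none of its edges would be closed under adjacency. As \<open>(j, q)\<close> is one of them,
  \<open>(k, p)\<close> would differ from itself.\<close>

lemma first_separator:
  assumes p: "p \<in> R" and q: "q \<in> R" and ne: "\<not> (j = k \<and> (p, q) \<in> L k)"
  shows "\<exists>r. (p, r) \<in> L k \<and> E `` {r} \<in> separators (k, p) (j, q)"
proof (rule ccontr)
  assume no: "\<not> ?thesis"
  define P where "P = (\<lambda>(i, s). \<not> (i = k \<and> (p, s) \<in> L k) \<and>
    (\<forall>r. (p, r) \<in> L k \<longrightarrow> E `` {r} \<notin> separators (k, p) (i, s)))"
  have "P (k, p)"
  proof (rule connected_induct[where P = P, OF _ q p])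
    show "P (j, q)" using ne no by (auto simp: P_def)
  next
    fix i s t assume P: "P (i, s)" and st: "(s, t) \<in> L i"
    have pst: "(p, t) \<in> L i \<longleftrightarrow> (p, s) \<in> L i"
      using st equiv_L[of i] by (meson equivE symD transD)
    have "separators (k, p) (i, s) = separators (k, p) (i, t)"
      using separators_L[OF st, of "(k, p)"] separators_sym by metis
    then show "P (i, t)" using P pst unfolding P_def by (cases "i = k") simp_all
  next
    fix i s assume s: "s \<in> R" and P: "P (i, s)"
    \<comment> \<open>If \<open>s\<close> lay on an edge of \<open>(k, p)\<close>, then
      \<open>(i, s)\<close> would be the other end of that edge and hence be separated by
      it.\<close>
    have *: "s \<notin> E `` {r}" if r: "(p, r) \<in> L k" for r
    proof
      assume sr: "s \<in> E `` {r}"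
      then have ps: "(p, s) \<in> L k" using edge_sub[OF sr, of k] r equiv_L[of k]
        by (meson equivE transD)
      have Er: "E `` {r} \<in> R // E" using r L_R edge_in by blast
      from P ps have "i = (\<not> k)" by (auto simp: P_def)
      then have "E `` {r} \<in> separators (k, p) (i, s)"
        using side_cross[OF Er s, of k] sr Er side_L[OF Er ps] by (auto simp: separators_def)
      then show False using P r by (auto simp: P_def)
    qed
    have "(p, s) \<notin> L k" using *[of s] in_edge[OF s] by blast
    moreover have "E `` {r} \<notin> separators (k, p) (\<not> i, s)" if r: "(p, r) \<in> L k" for r
    proof -
      have Er: "E `` {r} \<in> R // E" using r L_R edge_in by blast
      show ?thesis using P r *[OF r] side_cross[OF Er s, of i] Er
        by (auto simp: separators_def P_def)
    qed
    ultimately show "P (\<not> i, s)" by (auto simp: P_def)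
  qed
  then show False using L_refl[OF p] by (auto simp: P_def)
qed

text \<open>Two different edges cut the tree into three pieces, not four: no lobe lies both beyond
  \<open>Q\<close> as seen from \<open>Q'\<close> and beyond \<open>Q'\<close> as seen from
  \<open>Q\<close>. The hypotheses would place a lobe in each of the four intersections of
  sides.\<close>

lemma sides_nested:
  assumes Q: "Q \<in> R // E" "Q' \<in> R // E" "Q \<noteq> Q'"
    and v: "snd v \<in> R" "snd w \<in> R" "snd x \<in> R" "snd y \<in> R"
    and s: "side Q v = side Q w" "side Q x = side Q y" "side Q v \<noteq> side Q x"
      "side Q' v = side Q' x" "side Q' w = side Q' y" "side Q' v \<noteq> side Q' w"
  shows False
proof -
  obtain q where q0: "q \<in> R" "Q = E `` {q}" using Q(1) by (rule quotientE)
  obtain q' where q1: "q' \<in> R" "Q' = E `` {q'}" using Q(2) by (rule quotientE)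
  have q: "q \<in> Q" "q' \<in> Q'" "q \<in> R" "q' \<in> R" using q0 q1 in_edge by simp_all
  \<comment> \<open>\<open>a\<close> is the side of \<open>Q\<close> containing the edge
    \<open>Q'\<close>, and \<open>b\<close> is the side of \<open>Q'\<close> containing
    \<open>Q\<close>.\<close>
  define a where "a = side Q (True, q')"
  define b where "b = side Q' (True, q)"
  have disj: "s \<in> Q \<Longrightarrow> s \<notin> Q'" for s
    using Q(3) edge_eq[OF Q(1)] edge_eq[OF Q(2)] by blast
  have a: "side Q (k, s) = a" if "s \<in> Q'" for k s
  proof -
    have "(q', s) \<in> L True" "s \<in> R" using E_sub_L[of True] that edge_eq[OF Q(2), of s] unfolding q1(2) by blast+
    moreover have "s \<notin> Q" using disj that by blast
    ultimately show ?thesis using side_L[OF Q(1)] side_cross[OF Q(1), of s True] unfolding a_def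
      by (cases k) auto
  qed
  have b: "side Q' (k, s) = b" if "s \<in> Q" for k s
  proof -
    have "(q, s) \<in> L True" "s \<in> R" using E_sub_L[of True] that edge_eq[OF Q(1), of s] unfolding q0(2) by blast+
    moreover have "s \<notin> Q'" using disj that by blast
    ultimately show ?thesis using side_L[OF Q(2)] side_cross[OF Q(2), of s True] unfolding b_def
      by (cases k) auto
  qed
  have P: "\<not> (side Q (j, t) \<noteq> a \<and> side Q' (j, t) \<noteq> b)" if "t \<in> R" for j t
    by (rule connected_induct[where P = "\<lambda>z. \<not> (side Q z \<noteq> a \<and> side Q' z \<noteq> b)" and k = True and p = q, OF _ q(3) that])
      (use Q(1,2) a b q(1) in \<open>auto simp: side_L side_cross dest: disj\<close>)
  show False using P[of "snd v" "fst v"] P[of "snd w" "fst w"] P[of "snd x" "fst x"] P[of "snd y" "fst y"] s v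
    by auto
qed

text \<open>The vertex is a centre of \<open>M\<close>: moving from a centre towards another centre which is not
  adjacent to it would decrease the eccentricity, and adjacent lobes have different colours.\<close>

lemma fixed_lobe:
  assumes M: "finite M" "M \<noteq> {}" "M \<subseteq> R"
  obtains k v where "v \<in> R" and
    "\<And>h. \<lbrakk>bij_betw h R R; \<And>k p q. (p, q) \<in> L k \<Longrightarrow> (h p, h q) \<in> L k;
       \<And>p q. \<lbrakk>p \<in> R; q \<in> R\<rbrakk> \<Longrightarrow> (h p, h q) \<in> E \<longleftrightarrow> (p, q) \<in> E; h ` M = M\<rbrakk> \<Longrightarrow> (v, h v) \<in> L k"
proof -
  \<comment> \<open>A point \<open>m\<close> of \<open>M\<close> is represented by its lobe of
    colour \<open>True\<close>; this is compatible with \<open>h\<close>, which preserves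
    colours.\<close>
  define d where "d = (\<lambda>v m. card (separators v (True, m)))"
  define ecc where "ecc = (\<lambda>v. Max (d v ` M))"
  have ecc: "d v m \<le> ecc v" if "m \<in> M" for v m
    using that M by (simp add: ecc_def)
  have ecc_less: "(\<And>m. m \<in> M \<Longrightarrow> d v m < n) \<Longrightarrow> ecc v < n" for v n
    using M by (simp add: ecc_def)
  obtain z where z: "z \<in> M" using M by blast
  then have "(True, z) \<in> UNIV \<times> R" using M by auto
  then obtain c where c: "c \<in> UNIV \<times> R" "\<And>c'. c' \<in> UNIV \<times> R \<Longrightarrow> ecc c \<le> ecc c'"
    using exists_least_iff[of "\<lambda>n. \<exists>c\<in>UNIV \<times> R. ecc c = n"] by (metis not_le)
  obtain k v where kv: "c = (k, v)" "v \<in> R" using c by auto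
  show thesis
  proof
    show "v \<in> R" by fact
    fix h assume h: "bij_betw h R R" "\<And>k p q. (p, q) \<in> L k \<Longrightarrow> (h p, h q) \<in> L k"
      "\<And>p q. \<lbrakk>p \<in> R; q \<in> R\<rbrakk> \<Longrightarrow> (h p, h q) \<in> E \<longleftrightarrow> (p, q) \<in> E" "h ` M = M"
    have hR: "h p \<in> R" if "p \<in> R" for p using h(1) that by (auto simp: bij_betw_def)
    \<comment> \<open>Pulling a cut at \<open>Q\<close> back along \<open>h\<close> gives a cut at
      the preimage of \<open>Q\<close>. So every edge separating the images is the image of an edge
      separating the original lobes.\<close>
    have dh: "d (k, h v) (h m) \<le> d (k, v) m" if m: "m \<in> M" for m
    proof -
      have mR: "m \<in> R" using m M by auto
      have "separators (k, h v) (True, h m) \<subseteq> image h ` separators (k, v) (True, m)"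
      proof
        fix Q assume Q: "Q \<in> separators (k, h v) (True, h m)"
        then have QE: "Q \<in> R // E" and s: "side Q (k, h v) \<noteq> side Q (True, h m)"
          by (auto simp: separators_def)
        obtain x where x: "x \<in> R" "Q = E `` {h x}"
        proof -
          obtain y where y: "y \<in> R" "Q = E `` {y}" using QE by (rule quotientE)
          then obtain x where "x \<in> R" "y = h x" using h(1) by (auto simp: bij_betw_def)
          with y show thesis using that by blast
        qed
        have Qx: "Q = h ` (E `` {x})"
        proof
          show "Q \<subseteq> h ` (E `` {x})"
          proof
            fix y assume y: "y \<in> Q"
            then have "y \<in> R" using edge_eq[OF QE] by blast
            then obtain y' where "y' \<in> R" "y = h y'" using h(1) by (auto simp: bij_betw_def)
            then show "y \<in> h ` (E `` {x})" using h(3)[OF x(1), of y'] y x by auto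
          qed
          show "h ` (E `` {x}) \<subseteq> Q"
          proof
            fix y assume "y \<in> h ` (E `` {x})"
            then obtain y' where y': "(x, y') \<in> E" "y = h y'" by blast
            then have "y' \<in> R" using E_sub_L[of True] L_R by blast
            then show "y \<in> Q" using h(3)[OF x(1), of y'] y' x by auto
          qed
        qed
        have "is_cut (E `` {x}) (\<lambda>(i, p). side Q (i, h p))"
        proof -
          have "p \<in> E `` {x} \<longleftrightarrow> h p \<in> Q" if "p \<in> R" for p using h(3)[OF x(1) that] x by auto
          then show ?thesis
            using is_cut_side[OF QE] hR h(2) unfolding is_cut_def by auto
        qed
        then have "E `` {x} \<in> separators (k, v) (True, m)"
          using side_unique[OF edge_in[OF x(1)], of "\<lambda>(i, p). side Q (i, h p)" v m k True] kv mR s edge_in[OF x(1)]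
          by (simp add: separators_def)
        then show "Q \<in> image h ` separators (k, v) (True, m)" using Qx by blast
      qed
      then show ?thesis unfolding d_def by (rule surj_card_le[OF finite_separators[OF kv(2) mR]])
    qed
    have ecch: "d (k, h v) m \<le> ecc c" if "m \<in> M" for m
    proof -
      have "m \<in> h ` M" using that by (simp only: h(4))
      then obtain m' where "m' \<in> M" "m = h m'" by blast
      then show ?thesis using dh[of m'] ecc[of m' "(k, v)"] kv by simp
    qed
    show "(v, h v) \<in> L k"
    proof (rule ccontr)
      assume n: "(v, h v) \<notin> L k"
      have hv: "h v \<in> R" using hR kv by blast
      \<comment> \<open>\<open>?c\<close> is the neighbour of the centre in the direction of its
        image under \<open>h\<close>.\<close>
      obtain q where q: "(v, q) \<in> L k" "E `` {q} \<in> separators (k, v) (k, h v)"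
        using first_separator[OF kv(2) hv, of k k] n by auto
      have qR: "q \<in> R" using q L_R by blast
      let ?Q = "E `` {q}" and ?c = "(\<not> k, q)"
      have QE: "?Q \<in> R // E" using qR by (rule edge_in)
      have sc: "separators ?c m = (if ?Q \<in> separators (k, v) m
        then separators (k, v) m - {?Q} else insert ?Q (separators (k, v) m))" for m
        using separators_cross[OF qR, of k m] separators_L[OF q(1)] by simp
      \<comment> \<open>After the first edge the lobe has the wrong colour, so it still differs from
        \<open>(k, h v)\<close> and a second separating edge exists.\<close>
      have two: "2 \<le> card (separators (k, v) (k, h v))"
      proof -
        obtain r where r: "E `` {r} \<in> separators ?c (k, h v)"
          using first_separator[OF qR hv, of k "\<not> k"] by auto
        then have "{?Q, E `` {r}} \<subseteq> separators (k, v) (k, h v)" "?Q \<noteq> E `` {r}"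
          using q sc[of "(k, h v)"] by auto
        then show ?thesis
          using card_mono[OF finite_separators[OF kv(2) hv, of k k], of "{?Q, E `` {r}}"] by simp
      qed
      have "d ?c m < ecc c" if m: "m \<in> M" for m
      proof -
        have mR: "m \<in> R" using m M by auto
        let ?S = "separators (k, v) (True, m)" and ?T = "separators (k, v) (k, h v)"
        have fin: "finite ?S" "finite ?T" using finite_separators kv(2) mR hv by blast+
        show ?thesis
        proof (cases "?Q \<in> ?S")
          case True
          then have "d ?c m < d (k, v) m" using sc[of "(True, m)"] card_Diff1_less[OF fin(1)]
            by (simp add: d_def)
          then show ?thesis using ecc[OF m, of c] kv by simp
        next
          case False
          \<comment> \<open>Here \<open>m\<close> is not in the direction of \<open>?c\<close>. A
            common edge would put the centre, \<open>m\<close>, \<open>?c\<close> and the image of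
            the centre into the four intersections excluded by \<open>sides_nested\<close>. So the
            distances add up, and \<open>m\<close> would be too far from the image.\<close>
          have disj: "?S \<inter> ?T = {}"
          proof (rule ccontr)
            assume "?S \<inter> ?T \<noteq> {}"
            then obtain Q' where Q': "Q' \<in> ?S" "Q' \<in> ?T" by blast
            have ne: "?Q \<noteq> Q'" using Q' False by auto
            have cs: "side Q' ?c = side Q' (k, v)" "side ?Q ?c \<noteq> side ?Q (k, v)"
              using sc[of "(k, v)"] ne QE Q' by (auto simp: separators_def split: if_splits)
            show False
              by (rule sides_nested[of ?Q Q' "(k, v)" "(True, m)" ?c "(k, h v)"])
                (use QE Q' ne kv mR qR hv cs False q in \<open>auto simp: separators_def\<close>)
          qed
          have "separators (k, h v) (True, m) = ?S \<union> ?T"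
            using disj by (auto simp: separators_def)
          then have "d (k, h v) m = card ?S + card ?T"
            unfolding d_def using disj fin by (simp add: card_Un_disjoint)
          moreover have "d ?c m = Suc (card ?S)" using False fin sc[of "(True, m)"] by (simp add: d_def)
          ultimately show ?thesis using two ecch[OF m] by simp
        qed
      qed
      then have "ecc ?c < ecc c" by (rule ecc_less)
      then show False using c(2)[of ?c] qR by simp
    qed
  qed
qed

end

subsection \<open>Representations by partial bijections\<close>

text \<open>The symmetric inverse monoid. Partial bijections are relations, so that \<open>O\<close>
  composes them from left to right, as suits right actions.\<close>

definition sym_inv :: "'y rel sgrp" where
  "sym_inv = \<lparr>carrier = {r. single_valued r \<and> single_valued (r\<inverse>)}, sg_mult = (O)\<rparr>"

lemma sym_inv_carrier: "r \<in> carrier sym_inv \<longleftrightarrow> single_valued r \<and> single_valued (r\<inverse>)"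
  by (simp add: sym_inv_def)

lemma sym_inv_mult: "r \<cdot>\<^bsub>sym_inv\<^esub> s = r O s"
  by (simp add: sym_inv_def)

lemma sym_inv_regular: "r \<in> carrier sym_inv \<Longrightarrow> r O r\<inverse> O r = r"
  by (auto simp: sym_inv_carrier single_valued_def)

lemma sym_inv_idem: "r \<in> idempotents sym_inv \<Longrightarrow> r \<subseteq> Id"
proof
  fix z assume r: "r \<in> idempotents sym_inv" and z: "z \<in> r"
  obtain x y where xy: "z = (x, y)" by force
  have rr: "r O r = r" "single_valued r" "single_valued (r\<inverse>)"
    using r by (auto simp: idempotents_def sym_inv_carrier sym_inv_mult)
  then obtain w where "(x, w) \<in> r" "(w, y) \<in> r" using z xy by blast
  then have "(y, y) \<in> r" using rr(2) z xy by (metis single_valuedD)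
  then show "z \<in> Id" using rr(3) z xy by (metis IdI converseI single_valuedD)
qed

lemma inverse_sgrp_sym_inv: "inverse_sgrp (sym_inv :: 'y rel sgrp)"
proof (rule inverse_sgrpI)
  show "sgrp (sym_inv :: 'y rel sgrp)"
  proof
    have "{} \<in> carrier sym_inv" by (simp add: sym_inv_carrier)
    then show "carrier (sym_inv :: 'y rel sgrp) \<noteq> {}" by blast
  qed (auto simp: sym_inv_carrier sym_inv_mult converse_relcomp O_assoc intro: single_valued_relcomp)
next
  fix r :: "'y rel" assume r: "r \<in> carrier sym_inv"
  then have r': "r\<inverse> \<in> carrier sym_inv" by (simp add: sym_inv_carrier)
  show "\<exists>b\<in>carrier sym_inv. is_inverse sym_inv r b"
    using sym_inv_regular[OF r] sym_inv_regular[OF r'] r'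
    by (intro bexI[of _ "r\<inverse>"]) (simp_all add: is_inverse_def sym_inv_mult O_assoc)
next
  fix e f :: "'y rel" assume "e \<in> idempotents sym_inv" "f \<in> idempotents sym_inv"
  then have "e \<subseteq> Id" "f \<subseteq> Id" by (auto dest: sym_inv_idem)
  then show "e \<cdot>\<^bsub>sym_inv\<^esub> f = f \<cdot>\<^bsub>sym_inv\<^esub> e" unfolding sym_inv_mult by blast
qed

section \<open>Right multiplication as an action by partial bijections\<close>

context inverse_sgrp
begin

abbreviation si where "si \<equiv> sg_inv S"

text \<open>The domain of \<open>s\<close> in the Wagner-Preston representation, restricted to which
  right multiplication by \<open>s\<close> is injective.\<close>

definition dom_act :: "'a \<Rightarrow> 'a set" where
  "dom_act s = {p \<in> carrier S. p \<cdot> s \<cdot> si s = p}"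

lemma dom_act_inv:
  "\<lbrakk>s \<in> carrier S; p \<in> dom_act s\<rbrakk> \<Longrightarrow> p \<cdot> s \<in> dom_act (si s) \<and> p \<cdot> s \<cdot> si s = p"
  using sg_inv_props(2)[of s] by (simp add: dom_act_def assoc)

lemma dom_actD: "p \<in> dom_act s \<Longrightarrow> p \<in> carrier S \<and> p \<cdot> s \<cdot> si s = p"
  by (simp add: dom_act_def)

text \<open>This makes right multiplication a homomorphism into the partial bijections. That
  \<open>p \<cdot> s\<close> lies in the domain of \<open>t\<close> comes from commuting the
  idempotents \<open>t \<cdot> si t\<close> and \<open>si s \<cdot> s\<close>.\<close>

lemma dom_act_mult:
  assumes s: "s \<in> carrier S" and t: "t \<in> carrier S"
  shows "p \<in> dom_act (s \<cdot> t) \<longleftrightarrow> p \<in> dom_act s \<and> p \<cdot> s \<in> dom_act t"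
proof
  assume p: "p \<in> dom_act (s \<cdot> t)"
  then have pc: "p \<in> carrier S" and e': "p \<cdot> (s \<cdot> t) \<cdot> (si t \<cdot> si s) = p"
    using s t by (simp_all add: dom_act_def sg_inv_mult)
  have "p \<cdot> s \<cdot> t \<cdot> si t \<cdot> si s = p \<cdot> (s \<cdot> t) \<cdot> (si t \<cdot> si s)" using pc s t by (simp add: assoc)
  then have e: "p \<cdot> s \<cdot> t \<cdot> si t \<cdot> si s = p" using e' by simp
  have "p \<cdot> s \<cdot> si s = p \<cdot> s \<cdot> t \<cdot> si t \<cdot> si s \<cdot> s \<cdot> si s" using e by simp
  also have "\<dots> = p \<cdot> s \<cdot> t \<cdot> si t \<cdot> (si s \<cdot> s \<cdot> si s)" using s t pc by (simp add: assoc)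
  also have "\<dots> = p" using e s by (simp add: sg_inv_props)
  finally have 1: "p \<in> dom_act s" using pc by (simp add: dom_act_def)
  have "p \<cdot> s = p \<cdot> s \<cdot> t \<cdot> si t \<cdot> si s \<cdot> s" using e by simp
  also have "\<dots> = p \<cdot> s \<cdot> ((t \<cdot> si t) \<cdot> (si s \<cdot> s))" using s t pc by (simp add: assoc)
  also have "\<dots> = p \<cdot> s \<cdot> ((si s \<cdot> s) \<cdot> (t \<cdot> si t))"
    using idem_commute[OF idem_left[OF t] idem_right[OF s]] by simp
  also have "\<dots> = p \<cdot> (s \<cdot> si s \<cdot> s) \<cdot> t \<cdot> si t" using s t pc by (simp add: assoc)
  finally have "p \<cdot> s \<cdot> t \<cdot> si t = p \<cdot> s" using s by (simp add: sg_inv_props)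
  then show "p \<in> dom_act s \<and> p \<cdot> s \<in> dom_act t" using 1 pc s by (simp add: dom_act_def)
next
  assume "p \<in> dom_act s \<and> p \<cdot> s \<in> dom_act t"
  then show "p \<in> dom_act (s \<cdot> t)"
    using s t by (simp add: dom_act_def sg_inv_mult assoc[symmetric])
qed

lemma dom_act_left: "\<lbrakk>p \<in> dom_act s; s \<in> carrier S; h \<in> carrier S\<rbrakk> \<Longrightarrow> h \<cdot> p \<in> dom_act s"
  by (simp add: dom_act_def assoc)

lemma mult_left_idem: "p \<in> carrier S \<Longrightarrow> p \<cdot> si p \<cdot> p = p"
  by (rule sg_inv_props)

lemma dom_act_range:
  assumes "p \<in> dom_act s" "s \<in> carrier S"
  shows "p \<cdot> s \<cdot> si (p \<cdot> s) = p \<cdot> si p"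
proof -
  have p: "p \<in> carrier S" "p \<cdot> s \<cdot> si s = p" using assms(1) dom_actD by auto
  have "p \<cdot> s \<cdot> si (p \<cdot> s) = p \<cdot> s \<cdot> si s \<cdot> si p"
    unfolding sg_inv_mult[OF p(1) assms(2)] using p(1) assms(2) by (simp add: assoc)
  then show ?thesis using p by simp
qed

text \<open>Together with \<open>dom_act_range\<close>: \<open>s\<close> is defined at
  \<open>p\<close> exactly if \<open>p \<cdot> s\<close> stays in the \<R>-class of
  \<open>p\<close>, which is labelled by the idempotent \<open>p \<cdot> si p\<close>.\<close>

lemma dom_act_if_range:
  assumes p: "p \<in> carrier S" "s \<in> carrier S" and eq: "p \<cdot> s \<cdot> si (p \<cdot> s) = p \<cdot> si p"
  shows "p \<in> dom_act s"
proof -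
  have "p = p \<cdot> s \<cdot> si (p \<cdot> s) \<cdot> p" using p mult_left_idem eq by simp
  also have "\<dots> = p \<cdot> ((s \<cdot> si s) \<cdot> (si p \<cdot> p))" using p by (simp add: sg_inv_mult assoc)
  also have "\<dots> = p \<cdot> ((si p \<cdot> p) \<cdot> (s \<cdot> si s))"
    using idem_commute[OF idem_left[OF p(2)] idem_right[OF p(1)]] by simp
  also have "\<dots> = p \<cdot> si p \<cdot> p \<cdot> s \<cdot> si s" using p by (simp add: assoc)
  finally show ?thesis using p mult_left_idem by (simp add: dom_act_def)
qed

lemma fixed_dom_act:
  assumes p: "p \<in> carrier S" "s \<in> carrier S" and eq: "p \<cdot> s = p"
  shows "p \<in> dom_act s" "p \<cdot> si s = p"
proof -
  show "p \<in> dom_act s" using p eq by (intro dom_act_if_range) simp_all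
  then show "p \<cdot> si s = p" using eq by (simp add: dom_act_def)
qed

lemma green_H_idem_inverse_iff:
  assumes e: "e \<in> idempotents S"
  shows "(e, a) \<in> green_H S \<longleftrightarrow> a \<in> carrier S \<and> a \<cdot> si a = e \<and> si a \<cdot> a = e" (is "?L \<longleftrightarrow> ?R")
proof
  have eS: "e \<in> carrier S" "e \<cdot> e = e" using idemD[OF e] by auto
  assume ?L
  then obtain x y where a: "a \<in> carrier S" "e \<cdot> a = a" "a \<cdot> e = a" "x \<in> carrier S" "x \<cdot> a = e"
    "y \<in> carrier S" "a \<cdot> y = e"
    by (auto simp: green_H_idem_iff[OF e])
  have "a \<cdot> si a \<cdot> e = a \<cdot> si a \<cdot> (a \<cdot> y)" using a(7) by simp
  also have "\<dots> = (a \<cdot> si a \<cdot> a) \<cdot> y" using a(1,6) by (simp add: assoc)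
  finally have "a \<cdot> si a \<cdot> e = e" using a mult_left_idem by simp
  moreover have "e \<cdot> (a \<cdot> si a) = a \<cdot> si a" using a eS by (simp add: assoc[symmetric])
  ultimately have 1: "a \<cdot> si a = e" using idem_commute[OF e idem_left[OF a(1)]] by simp
  have "e \<cdot> (si a \<cdot> a) = x \<cdot> a \<cdot> (si a \<cdot> a)" using a(5) by simp
  also have "\<dots> = x \<cdot> (a \<cdot> si a \<cdot> a)" using a(1,4) by (simp add: assoc)
  finally have "e \<cdot> (si a \<cdot> a) = e" using a mult_left_idem by simp
  moreover have "si a \<cdot> a \<cdot> e = si a \<cdot> a" using a eS by (simp add: assoc)
  ultimately have "si a \<cdot> a = e" using idem_commute[OF e idem_right[OF a(1)]] by simp
  with 1 a show ?R by simp
next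
  assume a: ?R
  then have "e \<cdot> a = a" "a \<cdot> e = a" using mult_left_idem[of a] assoc[of a "si a" a] by auto
  then show ?L using a by (auto simp: green_H_idem_iff[OF e])
qed

text \<open>The intermediate element is \<open>a\<close> itself, \<L>-related to the first
  idempotent and \<R>-related to the second.\<close>

lemma green_D_inverse:
  assumes a: "a \<in> carrier S"
  shows "(si a \<cdot> a, a \<cdot> si a) \<in> green_D S"
proof -
  let ?e = "si a \<cdot> a" and ?g = "a \<cdot> si a"
  have 1: "a \<cdot> ?e = a" "?g \<cdot> a = a" using sg_inv_props(2)[OF a] a by (simp_all add: assoc)
  have "x \<cdot> ?e \<in> insert a ((\<lambda>x. x \<cdot> a) ` carrier S)" if "x \<in> carrier S" for x
    using that a by (intro insertI2 image_eqI[of _ _ "x \<cdot> si a"]) (simp_all add: assoc)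
  moreover have "x \<cdot> a \<in> insert ?e ((\<lambda>x. x \<cdot> ?e) ` carrier S)" if "x \<in> carrier S" for x
    using that a 1 by (intro insertI2 image_eqI[of _ _ "x \<cdot> a"]) (simp_all add: assoc)
  moreover have "?e \<in> (\<lambda>x. x \<cdot> a) ` carrier S" using a by blast
  moreover have "a \<in> (\<lambda>x. x \<cdot> ?e) ` carrier S" using a 1 by (intro image_eqI[of _ _ a]) simp_all
  ultimately have L: "(?e, a) \<in> green_L S" using a unfolding green_L_def by blast
  have "?g \<cdot> x \<in> insert a ((\<lambda>x. a \<cdot> x) ` carrier S)" if "x \<in> carrier S" for x
    using that a by (intro insertI2 image_eqI[of _ _ "si a \<cdot> x"]) (simp_all add: assoc)
  moreover have "a \<cdot> x \<in> insert ?g ((\<lambda>x. ?g \<cdot> x) ` carrier S)" if "x \<in> carrier S" for x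
    using that a 1 by (intro insertI2 image_eqI[of _ _ "a \<cdot> x"]) (simp_all add: assoc[symmetric])
  moreover have "?g \<in> (\<lambda>x. a \<cdot> x) ` carrier S" using a by blast
  moreover have "a \<in> (\<lambda>x. ?g \<cdot> x) ` carrier S" using a 1 by (intro image_eqI[of _ _ a]) simp_all
  ultimately have R: "(a, ?g) \<in> green_R S" using a unfolding green_R_def by blast
  show ?thesis using L R by (auto simp: green_D_def)
qed

text \<open>Idempotents commute, so multiplying the elements of a finite set one after another
  yields an element below all of them.\<close>

lemma least_idempotent:
  assumes fin: "finite F" and ne: "F \<noteq> {}" and F: "F \<subseteq> idempotents S"
    and mult: "\<And>a b. \<lbrakk>a \<in> F; b \<in> F\<rbrakk> \<Longrightarrow> a \<cdot> b \<in> F"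
  shows "\<exists>g\<in>F. \<forall>f\<in>F. g \<cdot> f = g"
proof -
  have "\<exists>g\<in>F. \<forall>f\<in>G. g \<cdot> f = g" if "finite G" "G \<subseteq> F" for G
    using that
  proof (induction G rule: finite_induct)
    case (insert f G)
    then obtain g where g: "g \<in> F" "\<And>m. m \<in> G \<Longrightarrow> g \<cdot> m = g" by blast
    have fF: "f \<in> F" using insert by simp
    have c: "g \<in> carrier S" "f \<in> carrier S" "f \<cdot> f = f" using g fF F idemD by auto
    have "g \<cdot> f \<cdot> m = g \<cdot> f" if "m \<in> insert f G" for m
    proof (cases "m = f")
      case False
      then have m: "m \<in> G" "m \<in> F" "m \<in> carrier S" using that insert F idemD by auto
      have "f \<cdot> m = m \<cdot> f" using fF m(2) F by (intro idem_commute) auto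
      then have "g \<cdot> f \<cdot> m = g \<cdot> (m \<cdot> f)" using c m by (simp add: assoc)
      then show ?thesis using c m g(2)[OF m(1)] by (simp add: assoc[symmetric])
    qed (use c in \<open>simp add: assoc\<close>)
    then show ?case using mult[OF g(1) fF] by blast
  qed (use ne in auto)
  from this[OF fin] show ?thesis by simp
qed

lemma max_subgroup_simps:
  assumes "g \<in> idempotents S"
  shows "carrier (max_subgroup S g) = {t \<in> carrier S. t \<cdot> si t = g \<and> si t \<cdot> t = g}"
    and "x \<otimes>\<^bsub>max_subgroup S g\<^esub> y = x \<cdot> y" and "\<one>\<^bsub>max_subgroup S g\<^esub> = g"
  using green_H_idem_inverse_iff[OF assms] by (auto simp: max_subgroup_def)

lemma max_subgroup_inv:
  assumes g: "g \<in> idempotents S" and t: "t \<in> carrier (max_subgroup S g)"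
  shows "inv\<^bsub>max_subgroup S g\<^esub> t = si t"
  using t group.inv_equality[OF group_max_subgroup[OF g], of "si t" t]
  by (auto simp: max_subgroup_simps[OF g])

text \<open>Sets are needed because the orbit to be glued consists of translates of a whole set. The
  empty set is left out of every domain, so it is a point on which nothing acts.\<close>

definition set_act :: "'a \<Rightarrow> (bool \<times> 'a set) rel" where
  "set_act s = {((b, X), (b, (\<lambda>a. a \<cdot> s) ` X)) | b X. X \<noteq> {} \<and> X \<subseteq> dom_act s}"

lemma set_act_iff:
  "((b, X), (c, Y)) \<in> set_act s \<longleftrightarrow> c = b \<and> X \<noteq> {} \<and> X \<subseteq> dom_act s \<and> Y = (\<lambda>a. a \<cdot> s) ` X"
  by (auto simp: set_act_def)

lemma image_act_inv:
  assumes "s \<in> carrier S" "X \<subseteq> dom_act s"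
  shows "(\<lambda>a. a \<cdot> si s) ` (\<lambda>a. a \<cdot> s) ` X = X" "(\<lambda>a. a \<cdot> s) ` X \<subseteq> dom_act (si s)"
proof -
  have "a \<cdot> s \<cdot> si s = a \<and> a \<cdot> s \<in> dom_act (si s)" if "a \<in> X" for a
    using dom_act_inv assms that by blast
  then show "(\<lambda>a. a \<cdot> si s) ` (\<lambda>a. a \<cdot> s) ` X = X" "(\<lambda>a. a \<cdot> s) ` X \<subseteq> dom_act (si s)"
    by (auto simp: image_image)
qed

lemma set_act_hom: "set_act \<in> sg_hom S sym_inv"
proof -
  have "set_act s \<in> carrier sym_inv" if s: "s \<in> carrier S" for s
  proof -
    have "single_valued (set_act s)" by (auto simp: single_valued_def set_act_def)
    moreover have "single_valued ((set_act s)\<inverse>)"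
      unfolding single_valued_def
      by (auto simp: set_act_iff) (metis image_act_inv(1) s)+
    ultimately show ?thesis by (simp add: sym_inv_carrier)
  qed
  moreover have "set_act (s \<cdot> t) = set_act s \<cdot>\<^bsub>sym_inv\<^esub> set_act t"
    if s: "s \<in> carrier S" "t \<in> carrier S" for s t
  proof -
    have *: "X \<subseteq> dom_act (s \<cdot> t) \<longleftrightarrow> X \<subseteq> dom_act s \<and> (\<lambda>a. a \<cdot> s) ` X \<subseteq> dom_act t" for X
      using dom_act_mult[OF s] by blast
    have "(\<lambda>a. a \<cdot> (s \<cdot> t)) ` X = (\<lambda>a. a \<cdot> t) ` (\<lambda>a. a \<cdot> s) ` X" if "X \<subseteq> dom_act s" for X
      using that s dom_actD by (auto simp: image_image assoc intro!: image_cong)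
    then have "((b, X), (c, Y)) \<in> set_act (s \<cdot> t) \<longleftrightarrow> ((b, X), (c, Y)) \<in> set_act s O set_act t" for b X c Y
      by (auto simp: set_act_iff * relcomp_unfold)
    then show ?thesis unfolding sym_inv_mult by (simp add: set_eq_iff split_paired_All)
  qed
  ultimately show ?thesis by (auto simp: sg_hom_def)
qed

end

text \<open>Points of the given orbit are encoded as singletons tagged \<open>False\<close>, points of the orbit to be
  glued to it as sets tagged \<open>True\<close>.\<close>

definition swap :: "('a \<times> 'a set) set \<Rightarrow> bool \<times> 'a set \<Rightarrow> bool \<times> 'a set" where
  "swap Tr = (\<lambda>(b, X). if b
     then (if \<exists>p. (p, X) \<in> Tr then (False, {THE p. (p, X) \<in> Tr}) else (True, X))
     else (if \<exists>p n. X = {p} \<and> (p, n) \<in> Tr then (True, THE n. \<exists>p. X = {p} \<and> (p, n) \<in> Tr) else (False, X)))"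

lemma swap_simps:
  assumes "single_valued Tr" "single_valued (Tr\<inverse>)"
  shows "(p, n) \<in> Tr \<Longrightarrow> swap Tr (False, {p}) = (True, n)"
    "(p, n) \<in> Tr \<Longrightarrow> swap Tr (True, n) = (False, {p})"
    "(\<And>p n. (p, n) \<in> Tr \<Longrightarrow> X \<noteq> {p}) \<Longrightarrow> swap Tr (False, X) = (False, X)"
    "(\<And>p. (p, X) \<notin> Tr) \<Longrightarrow> swap Tr (True, X) = (True, X)"
proof -
  show "swap Tr (False, {p}) = (True, n)" if "(p, n) \<in> Tr"
    using that assms(1) by (auto simp: swap_def intro!: the_equality dest: single_valuedD)
  show "swap Tr (True, n) = (False, {p})" if "(p, n) \<in> Tr"
    using that assms(2) by (auto simp: swap_def intro!: the_equality dest: single_valuedD)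
qed (auto simp: swap_def)

lemma swap_cases:
  obtains p n where "y = (False, {p})" "(p, n) \<in> Tr"
  | p n where "y = (True, n)" "(p, n) \<in> Tr"
  | X where "y = (False, X)" "\<And>p n. (p, n) \<in> Tr \<Longrightarrow> X \<noteq> {p}"
  | X where "y = (True, X)" "\<And>p. (p, X) \<notin> Tr"
  by (cases y; cases "fst y") fastforce+

lemma swap_swap:
  assumes "single_valued Tr" "single_valued (Tr\<inverse>)"
  shows "swap Tr (swap Tr y) = y"
  by (rule swap_cases[of y Tr]) (simp_all add: swap_simps[OF assms])

text \<open>\<open>Tr\<close> is an isomorphism of partial actions of \<open>B\<close>. Since
  \<open>B\<close> is closed under inverses, a point outside \<open>Tr\<close> cannot be moved into
  it: the inverse would move it back out.\<close>

lemma (in inverse_sgrp) swap_equivariant: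
  assumes Tr: "single_valued Tr" "single_valued (Tr\<inverse>)"
    and B: "B \<subseteq> carrier S" "\<And>u. u \<in> B \<Longrightarrow> si u \<in> B"
    and step: "\<And>p n u. \<lbrakk>(p, n) \<in> Tr; u \<in> B\<rbrakk> \<Longrightarrow> p \<in> dom_act u \<longleftrightarrow> n \<noteq> {} \<and> n \<subseteq> dom_act u"
      "\<And>p n u. \<lbrakk>(p, n) \<in> Tr; u \<in> B; p \<in> dom_act u\<rbrakk> \<Longrightarrow> (p \<cdot> u, (\<lambda>a. a \<cdot> u) ` n) \<in> Tr"
    and u: "u \<in> B" and yz: "(y, z) \<in> set_act u"
  shows "(swap Tr y, swap Tr z) \<in> set_act u"
proof -
  note sw = swap_simps[OF Tr]
  have uS: "u \<in> carrier S" using u B by blast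
  show ?thesis
  proof (rule swap_cases[of y Tr])
    fix p n assume y: "y = (False, {p})" and pn: "(p, n) \<in> Tr"
    then have z: "z = (False, {p \<cdot> u})" and d: "p \<in> dom_act u"
      using yz by (auto simp: set_act_def)
    show ?thesis using y z pn sw(1)[OF pn] sw(1)[OF step(2)[OF pn u d]] step(1)[OF pn u] d
      by (simp add: set_act_iff)
  next
    fix p n assume y: "y = (True, n)" and pn: "(p, n) \<in> Tr"
    then have z: "z = (True, (\<lambda>a. a \<cdot> u) ` n)" and d: "n \<noteq> {}" "n \<subseteq> dom_act u"
      using yz by (auto simp: set_act_def)
    then have d': "p \<in> dom_act u" using step(1)[OF pn u] by simp
    show ?thesis using y z pn sw(2)[OF pn] sw(2)[OF step(2)[OF pn u d']] d'
      by (simp add: set_act_iff)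
  next
    fix X assume y: "y = (False, X)" and X: "\<And>p n. (p, n) \<in> Tr \<Longrightarrow> X \<noteq> {p}"
    then have z: "z = (False, (\<lambda>a. a \<cdot> u) ` X)" and d: "X \<noteq> {}" "X \<subseteq> dom_act u"
      using yz by (auto simp: set_act_def)
    note inv = image_act_inv[OF uS d(2)]
    have "(\<lambda>a. a \<cdot> u) ` X \<noteq> {q}" if q: "(q, m) \<in> Tr" for q m
    proof
      assume eq: "(\<lambda>a. a \<cdot> u) ` X = {q}"
      then have "q \<in> dom_act (si u)" "X = {q \<cdot> si u}" using inv by auto
      then show False using step(2)[OF q B(2)[OF u]] X by blast
    qed
    then show ?thesis using y z d X by (simp add: sw(3) set_act_iff)
  next
    fix X assume y: "y = (True, X)" and X: "\<And>p. (p, X) \<notin> Tr"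
    then have z: "z = (True, (\<lambda>a. a \<cdot> u) ` X)" and d: "X \<noteq> {}" "X \<subseteq> dom_act u"
      using yz by (auto simp: set_act_def)
    note inv = image_act_inv[OF uS d(2)]
    have "(q, (\<lambda>a. a \<cdot> u) ` X) \<notin> Tr" for q
    proof
      assume q: "(q, (\<lambda>a. a \<cdot> u) ` X) \<in> Tr"
      then have "q \<in> dom_act (si u)" using step(1)[OF q B(2)[OF u]] d inv by simp
      then show False using step(2)[OF q B(2)[OF u]] X inv by simp
    qed
    then show ?thesis using y z d X by (simp add: sw(4) set_act_iff)
  qed
qed

subsection \<open>Twisting along an edge\<close>

primrec letters_act :: "('c \<Rightarrow> 'y rel) \<Rightarrow> 'c list \<Rightarrow> 'y rel" where
  "letters_act F [] = Id"
| "letters_act F (c # cs) = F c O letters_act F cs"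

lemma letters_act_append: "letters_act F (cs @ ds) = letters_act F cs O letters_act F ds"
  by (induction cs) (simp_all add: O_assoc)

lemma (in sgrp) foldl_closed: "\<lbrakk>p \<in> carrier S; set cs \<subseteq> carrier S\<rbrakk> \<Longrightarrow> foldl (\<cdot>) p cs \<in> carrier S"
  by (induction cs arbitrary: p) auto

lemma (in sgrp) foldl_mult:
  "\<lbrakk>h \<in> carrier S; p \<in> carrier S; set cs \<subseteq> carrier S\<rbrakk> \<Longrightarrow> foldl (\<cdot>) (h \<cdot> p) cs = h \<cdot> foldl (\<cdot>) p cs"
  by (induction cs arbitrary: p) (auto simp: assoc)

lemma (in sgrp) hom_foldl:
  assumes F: "F \<in> sg_hom S sym_inv"
  shows "\<lbrakk>p \<in> carrier S; set cs \<subseteq> carrier S\<rbrakk> \<Longrightarrow> F (foldl (\<cdot>) p cs) = F p O letters_act F cs"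
  by (induction cs arbitrary: p) (auto simp: sg_homD(2)[OF F] sym_inv_mult O_assoc)

text \<open>The property \<open>twist\<close> is stated for a single type of points because a locale cannot quantify
  over types; this type accommodates both the double cover and the gluing.\<close>

locale two_factor = inverse_sgrp S for S :: "('a, 'm) sgrp_scheme" (structure) +
  fixes A :: "bool \<Rightarrow> 'a set" and B :: "'a set" and e :: 'a
  assumes A_sub: "A k \<subseteq> carrier S" and A_mult: "\<lbrakk>a \<in> A k; b \<in> A k\<rbrakk> \<Longrightarrow> a \<cdot> b \<in> A k"
    and A_inv: "a \<in> A k \<Longrightarrow> si a \<in> A k" and finite_A: "finite (A k)"
    and B_sub: "B \<subseteq> A k" and B_mult: "\<lbrakk>a \<in> B; b \<in> B\<rbrakk> \<Longrightarrow> a \<cdot> b \<in> B"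
    and B_inv: "a \<in> B \<Longrightarrow> si a \<in> B"
    and word: "a \<in> carrier S \<Longrightarrow> \<exists>c cs. set (c # cs) \<subseteq> A True \<union> A False \<and> a = foldl (\<cdot>) c cs"
    and twist: "\<lbrakk>\<And>y. \<theta> (\<theta> y) = y; \<And>u y z. \<lbrakk>u \<in> B; (y, z) \<in> set_act u\<rbrakk> \<Longrightarrow> (\<theta> y, \<theta> z) \<in> set_act u\<rbrakk> \<Longrightarrow>
      \<exists>F\<in>sg_hom S sym_inv. (\<forall>c\<in>A True. F c = set_act c) \<and>
        (\<forall>c\<in>A False. F c = {(\<theta> y, \<theta> z) | y z. (y, z) \<in> set_act c})"
    and e: "e \<in> idempotents S"
begin

section \<open>The \<R>-class of \<open>e\<close> as a graph of lobes\<close>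

definition R where "R = {p \<in> carrier S. p \<cdot> si p = e}"
definition H where "H = {p \<in> R. si p \<cdot> p = e}"
text \<open>An identity is adjoined to \<open>X\<close>: points in the domain of no element of \<open>X\<close> are orbits by
  themselves. In particular, two lobes may meet in a point on which \<open>B\<close> does not act.\<close>

definition orb where "orb X = {(p, q). p \<in> R \<and> (p = q \<or> (\<exists>s\<in>X. p \<in> dom_act s \<and> q = p \<cdot> s))}"

abbreviation L where "L k \<equiv> orb (A k)"

lemma A_carrier [simp]: "c \<in> A k \<Longrightarrow> c \<in> carrier S"
  using A_sub by blast

lemma B_carrier [simp]: "c \<in> B \<Longrightarrow> c \<in> carrier S"
  using A_sub B_sub by blast

lemma eS [simp]: "e \<in> carrier S" and ee: "e \<cdot> e = e"
  using e idemD by auto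

lemma si_e: "si e = e"
  using ee by (intro sg_inv_eq) (simp_all add: assoc)

lemma e_R: "e \<in> R"
  by (simp add: R_def si_e ee)

lemma e_H: "e \<in> H"
  by (simp add: H_def e_R si_e ee)

lemma R_carrier [simp]: "p \<in> R \<Longrightarrow> p \<in> carrier S"
  by (simp add: R_def)

lemma R_left: "p \<in> R \<Longrightarrow> e \<cdot> p = p"
  using mult_left_idem[of p] by (simp add: R_def del: R_carrier)

lemma H_R: "h \<in> H \<Longrightarrow> h \<in> R"
  by (simp add: H_def)

lemma H_right: "h \<in> H \<Longrightarrow> h \<cdot> e = h"
  using mult_left_idem[of h] assoc[of h "si h" h] by (auto simp: H_def R_def simp del: R_carrier)

lemma H_inv: "h \<in> H \<Longrightarrow> si h \<in> H"
  by (auto simp: H_def R_def simp del: R_carrier)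

lemma H_cancel: "\<lbrakk>h \<in> H; p \<in> R\<rbrakk> \<Longrightarrow> si h \<cdot> (h \<cdot> p) = p" "\<lbrakk>h \<in> H; p \<in> R\<rbrakk> \<Longrightarrow> h \<cdot> (si h \<cdot> p) = p"
  using R_left[of p] by (auto simp: H_def R_def assoc[symmetric] simp del: R_carrier)

lemma H_mult_R:
  assumes "h \<in> H" "p \<in> R" shows "h \<cdot> p \<in> R"
proof -
  have c: "h \<in> carrier S" "p \<in> carrier S" "p \<cdot> si p = e" "h \<cdot> si h = e"
    using assms by (auto simp: H_def R_def simp del: R_carrier)
  have "h \<cdot> p \<cdot> si (h \<cdot> p) = h \<cdot> (p \<cdot> si p) \<cdot> si h"
    unfolding sg_inv_mult[OF c(1,2)] using c(1,2) by (simp add: assoc)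
  then show ?thesis using c H_right[OF assms(1)] by (simp add: R_def del: R_carrier)
qed

lemma R_act: "\<lbrakk>p \<in> R; s \<in> carrier S; p \<in> dom_act s\<rbrakk> \<Longrightarrow> p \<cdot> s \<in> R"
  using dom_act_range[of p s] by (simp add: R_def del: R_carrier)

lemma orbI: "\<lbrakk>p \<in> R; s \<in> X; p \<in> dom_act s\<rbrakk> \<Longrightarrow> (p, p \<cdot> s) \<in> orb X"
  by (auto simp: orb_def)

lemma orb_refl: "p \<in> R \<Longrightarrow> (p, p) \<in> orb X"
  by (simp add: orb_def)

lemma orb_equiv:
  assumes X: "X \<subseteq> carrier S" "\<And>a b. \<lbrakk>a \<in> X; b \<in> X\<rbrakk> \<Longrightarrow> a \<cdot> b \<in> X" "\<And>a. a \<in> X \<Longrightarrow> si a \<in> X"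
  shows "equiv R (orb X)"
proof (rule equivI)
  show "orb X \<subseteq> R \<times> R" using R_act X(1) by (auto simp: orb_def)
  show "refl_on R (orb X)" by (auto simp: refl_on_def orb_refl)
  show "sym (orb X)"
  proof (rule symI)
    fix p q assume "(p, q) \<in> orb X"
    then consider "p \<in> R" "q = p" | s where "p \<in> R" "s \<in> X" "p \<in> dom_act s" "q = p \<cdot> s"
      by (auto simp: orb_def)
    then show "(q, p) \<in> orb X"
    proof cases
      case 2
      then have "s \<in> carrier S" using X(1) by blast
      then show ?thesis
        using orbI[of q "si s" X] R_act dom_act_inv[of s p] X(3) 2 by auto
    qed (simp add: orb_refl)
  qed
  show "trans (orb X)"
  proof (rule transI)
    fix p q r assume pq: "(p, q) \<in> orb X" and qr: "(q, r) \<in> orb X"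
    show "(p, r) \<in> orb X"
    proof (cases "p = q \<or> q = r")
      case False
      then obtain s t where st: "s \<in> X" "p \<in> dom_act s" "q = p \<cdot> s" "t \<in> X" "q \<in> dom_act t" "r = q \<cdot> t"
        and p: "p \<in> R" using pq qr by (auto simp: orb_def)
      moreover have "s \<in> carrier S" "t \<in> carrier S" using st X by auto
      ultimately show ?thesis
        using orbI[of p "s \<cdot> t" X] X(2) dom_act_mult[of s t p] by (simp add: assoc)
    qed (use pq qr in auto)
  qed
qed

lemma L_equiv: "equiv R (L k)"
  using A_sub A_mult A_inv by (rule orb_equiv)

lemma B_equiv: "equiv R (orb B)"
  using B_mult B_inv by (intro orb_equiv) auto

lemma B_sub_L: "orb B \<subseteq> L k"
  using B_sub[of k] by (auto simp: orb_def)

lemma orb_R: "(p, q) \<in> L k \<Longrightarrow> p \<in> R \<and> q \<in> R"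
  using L_equiv[of k] by (auto simp: equiv_def refl_on_def)

lemma B_subset: "B \<subseteq> carrier S"
  by auto

text \<open>Left multiplication commutes with the right action, so \<open>H\<close> acts on the
  graph of lobes by automorphisms.\<close>

lemma orb_left:
  assumes "h \<in> H" "(p, q) \<in> orb X" "X \<subseteq> carrier S"
  shows "(h \<cdot> p, h \<cdot> q) \<in> orb X"
proof -
  have h: "h \<in> carrier S" using assms by (simp add: H_def)
  have p: "p \<in> R" using assms by (simp add: orb_def)
  show ?thesis
  proof (cases "p = q")
    case False
    then obtain s where s: "s \<in> X" "p \<in> dom_act s" "q = p \<cdot> s" using assms by (auto simp: orb_def)
    moreover from s have "s \<in> carrier S" using assms by blast
    ultimately show ?thesis
      using orbI[OF H_mult_R[OF assms(1) p] s(1)] dom_act_left[OF s(2) _ h] p h by (simp add: assoc)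
  qed (use orb_refl H_mult_R[OF assms(1) p] in simp)
qed

text \<open>Products can only descend in the \<R>-order: if \<open>q \<cdot> c\<close> is in
  \<open>R\<close>, then \<open>e = q \<cdot> (c \<cdot> si c) \<cdot> si q\<close> is below
  \<open>q \<cdot> si q\<close>, which is below \<open>e\<close> because
  \<open>e \<cdot> q = q\<close>.\<close>

lemma R_prefix:
  assumes p: "p \<in> R"
  shows "\<lbrakk>q \<in> carrier S; set es \<subseteq> carrier S; e \<cdot> q = q; foldl (\<cdot>) q es \<in> R\<rbrakk> \<Longrightarrow> q \<in> R"
proof (induction es arbitrary: q)
  case (Cons c es)
  then have c: "c \<in> carrier S" "q \<in> carrier S" by auto
  have "e \<cdot> (q \<cdot> c) = q \<cdot> c" using Cons.prems c by (simp add: assoc[symmetric])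
  then have qc: "q \<cdot> c \<in> R" using Cons.IH[of "q \<cdot> c"] Cons.prems c by simp
  have "e = q \<cdot> (c \<cdot> si c) \<cdot> si q"
    using qc sg_inv_mult[OF c(2,1)] c by (simp add: R_def assoc del: R_carrier)
  then have "q \<cdot> si q \<cdot> e = (q \<cdot> si q \<cdot> q) \<cdot> (c \<cdot> si c) \<cdot> si q" using c by (simp add: assoc)
  also have "\<dots> = e" using mult_left_idem[OF c(2)] qc sg_inv_mult[OF c(2,1)] c by (simp add: R_def assoc del: R_carrier)
  finally have 1: "q \<cdot> si q \<cdot> e = e" .
  have "q \<cdot> si q \<cdot> e = e \<cdot> (q \<cdot> si q)" by (rule idem_commute[OF idem_left[OF c(2)] e])
  also have "\<dots> = q \<cdot> si q" using Cons.prems(3) c by (simp add: assoc[symmetric])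
  finally have "q \<cdot> si q = e" using 1 by simp
  then show ?case using c by (simp add: R_def del: R_carrier)
qed simp

text \<open>The lobes in which the letters of \<open>cs\<close> are read on the walk from
  \<open>p\<close>, with all their points. A letter lying in both factors counts for both
  colours.\<close>

definition visited :: "'a \<Rightarrow> 'a list \<Rightarrow> (bool \<times> 'a) set" where
  "visited p cs = {(k, q). \<exists>ds c es. cs = ds @ c # es \<and> c \<in> A k \<and> (foldl (\<cdot>) p ds, q) \<in> L k}"

text \<open>A walk that starts and ends in \<open>R\<close> never leaves it, by
  \<open>R_prefix\<close>; hence every letter is defined at the point where it is read.\<close>

lemma walk_induct [consumes 3, case_names Nil snoc]:
  assumes p: "p \<in> R" "foldl (\<cdot>) p cs \<in> R" "set cs \<subseteq> A True \<union> A False"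
    and Nil: "Q []"
    and snoc: "\<And>ds c k. \<lbrakk>c \<in> A k; foldl (\<cdot>) p ds \<in> R; foldl (\<cdot>) p ds \<in> dom_act c;
      (k, foldl (\<cdot>) p ds) \<in> visited p cs; Q ds\<rbrakk> \<Longrightarrow> Q (ds @ [c])"
  shows "Q cs"
proof -
  have cs: "set cs \<subseteq> carrier S" using p(3) by auto
  have R: "foldl (\<cdot>) p ds \<in> R" if "cs = ds @ es" for ds es
  proof (rule R_prefix[OF p(1), of _ es])
    show "e \<cdot> foldl (\<cdot>) p ds = foldl (\<cdot>) p ds"
      using foldl_mult[of e p ds] that cs p(1) R_left by simp
  qed (use that cs p in \<open>auto simp: foldl_closed\<close>)
  have "\<forall>es. cs = ds @ es \<longrightarrow> Q ds" for ds
  proof (induction ds rule: rev_induct)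
    case (snoc c ds)
    show ?case
    proof (intro allI impI)
      fix es assume eq: "cs = (ds @ [c]) @ es"
      let ?q = "foldl (\<cdot>) p ds"
      obtain k where k: "c \<in> A k" using eq p(3) by auto
      have q: "?q \<in> R" "?q \<cdot> c \<in> R" using R[of ds "c # es"] R[of "ds @ [c]" es] eq by simp_all
      have "?q \<in> dom_act c" using q k by (intro dom_act_if_range) (auto simp: R_def simp del: R_carrier)
      moreover have "(k, ?q) \<in> visited p cs" using eq k q orb_refl unfolding visited_def by fastforce
      ultimately show "Q (ds @ [c])" using assms(5)[OF k] q snoc eq by simp
    qed
  qed (simp add: Nil)
  then show ?thesis by simp
qed

lemma twist_swap:
  assumes Tr: "single_valued Tr" "single_valued (Tr\<inverse>)"
    and step: "\<And>p n u. \<lbrakk>(p, n) \<in> Tr; u \<in> B\<rbrakk> \<Longrightarrow> p \<in> dom_act u \<longleftrightarrow> n \<noteq> {} \<and> n \<subseteq> dom_act u"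
      "\<And>p n u. \<lbrakk>(p, n) \<in> Tr; u \<in> B; p \<in> dom_act u\<rbrakk> \<Longrightarrow> (p \<cdot> u, (\<lambda>a. a \<cdot> u) ` n) \<in> Tr"
  obtains F where "F \<in> sg_hom S sym_inv" "\<And>c. c \<in> A True \<Longrightarrow> F c = set_act c"
    "\<And>c y z. c \<in> A False \<Longrightarrow> (y, z) \<in> F c \<longleftrightarrow> (swap Tr y, swap Tr z) \<in> set_act c"
proof -
  note sw = swap_swap[OF Tr]
  have eq: "(swap Tr y, swap Tr z) \<in> set_act u" if "u \<in> B" "(y, z) \<in> set_act u" for u y z
    using Tr B_subset B_inv step that by (rule swap_equivariant)
  have "\<exists>F\<in>sg_hom S sym_inv. (\<forall>c\<in>A True. F c = set_act c) \<and>
    (\<forall>c\<in>A False. F c = {(swap Tr y, swap Tr z) | y z. (y, z) \<in> set_act c})"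
    using sw eq by (rule twist)
  then obtain F where F: "F \<in> sg_hom S sym_inv" "\<forall>c\<in>A True. F c = set_act c"
    "\<forall>c\<in>A False. F c = {(swap Tr y, swap Tr z) | y z. (y, z) \<in> set_act c}"
    by (elim bexE conjE) (rule that)
  have "(y, z) \<in> F c \<longleftrightarrow> (swap Tr y, swap Tr z) \<in> set_act c" if "c \<in> A False" for c y z
  proof -
    have "F c = {(swap Tr y, swap Tr z) | y z. (y, z) \<in> set_act c}"
      using F(3) that by (rule bspec)
    then show ?thesis by (simp only: mem_Collect_eq prod.inject) (metis sw)
  qed
  then show thesis using that F(1,2) by blast
qed

text \<open>One word serves both to walk in \<open>R\<close> by right multiplication and to compute
  the image of \<open>a\<close> under any representation.\<close>

lemma walk_word:
  assumes "a \<in> carrier S"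
  obtains cs where "cs \<noteq> []" "set cs \<subseteq> A True \<union> A False" "\<And>p. p \<in> carrier S \<Longrightarrow> foldl (\<cdot>) p cs = p \<cdot> a"
    "\<And>F :: 'a \<Rightarrow> 'y rel. F \<in> sg_hom S sym_inv \<Longrightarrow> F a = letters_act F cs"
proof -
  obtain c cs where c: "set (c # cs) \<subseteq> A True \<union> A False" "a = foldl (\<cdot>) c cs"
    using word[OF assms] by blast
  then have cS: "c \<in> carrier S" "set cs \<subseteq> carrier S" by auto
  show thesis
    by (rule that[of "c # cs"]) (use c(1) cS in \<open>simp_all add: c(2) foldl_mult hom_foldl\<close>)
qed

text \<open>A word for \<open>p\<close>, read from \<open>e\<close>, is a walk from \<open>e\<close>
  to \<open>e \<cdot> p = p\<close>.\<close>

lemma connected_R: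
  assumes p: "p \<in> R" shows "(e, p) \<in> (L True \<union> L False)\<^sup>*"
proof -
  obtain cs where cs: "set cs \<subseteq> A True \<union> A False" "\<And>q. q \<in> carrier S \<Longrightarrow> foldl (\<cdot>) q cs = q \<cdot> p"
    using walk_word[of p] p by (metis R_carrier)
  then have ep: "foldl (\<cdot>) e cs = p" using R_left p by simp
  then have epR: "foldl (\<cdot>) e cs \<in> R" using p by simp
  have "(e, foldl (\<cdot>) e cs) \<in> (L True \<union> L False)\<^sup>*"
    using e_R epR cs(1)
  proof (induction rule: walk_induct)
    case (snoc ds c k)
    then have "(foldl (\<cdot>) e ds, foldl (\<cdot>) e ds \<cdot> c) \<in> L True \<union> L False"
      using orbI by (cases k) auto
    with snoc(5) have "(e, foldl (\<cdot>) e ds \<cdot> c) \<in> (L True \<union> L False)\<^sup>*" by (rule rtrancl_into_rtrancl)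
    then show ?case by simp
  qed simp_all
  then show ?thesis using ep by simp
qed

text \<open>The cut comes from the double cover of \<open>R\<close> whose two sheets are interchanged along \<open>Q\<close>
  by the second factor only: the sheet reached from a lift of \<open>e\<close> along a word for \<open>p\<close> depends on
  \<open>p\<close> only, so the cover has a section.\<close>

lemma cut_exists:
  assumes Q: "Q \<in> R // orb B"
  shows "\<exists>\<sigma> :: bool \<times> 'a \<Rightarrow> bool. (\<forall>k p q. (p, q) \<in> L k \<longrightarrow> \<sigma> (k, p) = \<sigma> (k, q)) \<and>
    (\<forall>p\<in>R. \<sigma> (True, p) \<noteq> \<sigma> (False, p) \<longleftrightarrow> p \<in> Q)"
proof -
  \<comment> \<open>The two lifts of \<open>p\<close> are its singleton with either tag; they are
    exchanged over the edge \<open>Q\<close> only.\<close>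
  define Tr where "Tr = {(p, {p}) | p. p \<in> Q}"
  have QR: "Q \<subseteq> R" using Q Union_quotient[OF B_equiv] by blast
  have Qu: "p \<cdot> u \<in> Q" if "p \<in> Q" "u \<in> B" "p \<in> dom_act u" for p u
    using in_quotient_imp_closed[OF B_equiv Q that(1)] orbI[of p u B] that QR by blast
  have Tr: "single_valued Tr" "single_valued (Tr\<inverse>)" by (auto simp: Tr_def single_valued_def)
  obtain F where F: "F \<in> sg_hom S sym_inv" "\<And>c. c \<in> A True \<Longrightarrow> F c = set_act c"
    "\<And>c y z. c \<in> A False \<Longrightarrow> (y, z) \<in> F c \<longleftrightarrow> (swap Tr y, swap Tr z) \<in> set_act c"
  proof (rule twist_swap[OF Tr])
    show "p \<in> dom_act u \<longleftrightarrow> n \<noteq> {} \<and> n \<subseteq> dom_act u" if "(p, n) \<in> Tr" "u \<in> B" for p n u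
      using that by (auto simp: Tr_def)
    show "(p \<cdot> u, (\<lambda>a. a \<cdot> u) ` n) \<in> Tr" if "(p, n) \<in> Tr" "u \<in> B" "p \<in> dom_act u" for p n u
      using that Qu by (auto simp: Tr_def)
  qed (rule that)
  have sw: "swap Tr (b, {p}) = (b \<noteq> (p \<in> Q), {p})" for b p
  proof (cases "p \<in> Q")
    case True
    then have "(p, {p}) \<in> Tr" by (simp add: Tr_def)
    then show ?thesis using swap_simps(1,2)[OF Tr] True by (cases b) auto
  next
    case False
    then show ?thesis using swap_simps(3,4)[OF Tr, of "{p}"] by (cases b) (auto simp: Tr_def)
  qed
  \<comment> \<open>Conjugation applies the exchange before and after a letter of the second factor,
    so the sheet changes only when exactly one end lies in \<open>Q\<close>.\<close>
  define turn where "turn = (\<lambda>k p q. \<not> k \<and> (p \<in> Q) \<noteq> (q \<in> Q))"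
  have Fc: "((b, {p}), (b \<noteq> turn k p (p \<cdot> c), {p \<cdot> c})) \<in> F c" if "c \<in> A k" "p \<in> dom_act c" for b k p c
    using that by (cases k) (auto simp: F(2,3) sw set_act_iff turn_def)
  \<comment> \<open>The sheet over \<open>p\<close> to which \<open>F p\<close> takes the lift of
    \<open>e\<close>. It exists by walking along a word, and it is unique because \<open>F p\<close>
    is single-valued.\<close>
  define \<sigma> where "\<sigma> = (\<lambda>p. SOME b. ((False, {e}), (b, {p})) \<in> F p)"
  have \<sigma>: "((False, {e}), (\<sigma> p, {p})) \<in> F p" if p: "p \<in> R" for p
  proof -
    obtain cs where cs: "set cs \<subseteq> A True \<union> A False" "\<And>q. q \<in> carrier S \<Longrightarrow> foldl (\<cdot>) q cs = q \<cdot> p"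
      "F p = letters_act F cs"
      using walk_word[of p] p F(1) by (metis R_carrier)
    then have ep: "foldl (\<cdot>) e cs = p" using R_left p by simp
    then have epR: "foldl (\<cdot>) e cs \<in> R" using p by simp
    have "\<exists>b. ((False, {e}), (b, {foldl (\<cdot>) e cs})) \<in> letters_act F cs"
      using e_R epR cs(1)
    proof (induction rule: walk_induct)
      case (snoc ds c k)
      then obtain b where "((False, {e}), (b, {foldl (\<cdot>) e ds})) \<in> letters_act F ds" by blast
      then have "((False, {e}), (b \<noteq> turn k (foldl (\<cdot>) e ds) (foldl (\<cdot>) e ds \<cdot> c), {foldl (\<cdot>) e ds \<cdot> c}))
          \<in> letters_act F (ds @ [c])"
        using Fc[OF snoc(1) snoc(3), of b] by (auto simp: letters_act_append)
      then show ?case by auto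
    qed auto
    then show ?thesis unfolding \<sigma>_def ep cs(3) by (rule someI_ex)
  qed
  have turn: "\<sigma> q = (\<sigma> p \<noteq> turn k p q)" if "(p, q) \<in> L k" for k p q
  proof (cases "p = q")
    case False
    then obtain c where c: "p \<in> R" "c \<in> A k" "p \<in> dom_act c" "q = p \<cdot> c"
      using \<open>(p, q) \<in> L k\<close> by (auto simp: orb_def)
    have q: "q \<in> R" using R_act c by simp
    have Fq: "F q = F p O F c" using c sg_homD(2)[OF F(1), of p c] by (simp add: sym_inv_mult)
    have "((False, {e}), (\<sigma> p \<noteq> turn k p q, {q})) \<in> F q"
      unfolding Fq using \<sigma>[OF c(1)] Fc[OF c(2,3)] c(4) by blast
    moreover have "single_valued (F q)"
      using sg_homD(1)[OF F(1), of q] q by (simp add: sym_inv_carrier)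
    ultimately have "(\<sigma> q, {q}) = (\<sigma> p \<noteq> turn k p q, {q})" using \<sigma>[OF q] by (metis single_valuedD)
    then show ?thesis by simp
  qed (simp add: turn_def)
  \<comment> \<open>Correcting the sheet by membership in \<open>Q\<close> for the second colour
    absorbs \<open>turn\<close>, and makes the two colours differ exactly on
    \<open>Q\<close>.\<close>
  show ?thesis
    by (rule exI[of _ "\<lambda>(k, p). \<sigma> p \<noteq> (\<not> k \<and> p \<in> Q)"]) (auto simp: turn turn_def)
qed

sublocale tree: lobe_tree R L "orb B"
proof
  fix p q assume pq: "p \<in> R" "q \<in> R"
  have "sym ((L True \<union> L False)\<^sup>*)"
    using L_equiv by (intro sym_rtrancl sym_Un) (auto elim: equivE)
  then show "(p, q) \<in> (L True \<union> L False)\<^sup>*"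
    using connected_R pq by (meson rtrancl_trans symD)
qed (use L_equiv B_equiv B_sub_L cut_exists in auto)

text \<open>\<open>fixed_lobe\<close> is applied with \<open>M\<close> equal to \<open>H\<close>, a
  finite set of points that left multiplication by \<open>H\<close> permutes.\<close>

lemma finite_H_fixed_orbit:
  assumes "finite H"
  obtains k r where "r \<in> R" "\<And>h. h \<in> H \<Longrightarrow> (r, h \<cdot> r) \<in> L k"
proof -
  have "H \<noteq> {}" "H \<subseteq> R" using e_H H_R by auto
  then obtain k r where r: "r \<in> R" and *:
    "\<And>h. \<lbrakk>bij_betw h R R; \<And>k p q. (p, q) \<in> L k \<Longrightarrow> (h p, h q) \<in> L k;
       \<And>p q. \<lbrakk>p \<in> R; q \<in> R\<rbrakk> \<Longrightarrow> (h p, h q) \<in> orb B \<longleftrightarrow> (p, q) \<in> orb B; h ` H = H\<rbrakk> \<Longrightarrow> (r, h r) \<in> L k"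
    using tree.fixed_lobe[OF assms] by metis
  have "(r, h \<cdot> r) \<in> L k" if h: "h \<in> H" for h
  proof (rule *)
    note h' = H_inv[OF h]
    show "bij_betw ((\<cdot>) h) R R"
      using H_cancel h H_mult_R[OF h] H_mult_R[OF h'] by (intro bij_betw_byWitness[where f' = "(\<cdot>) (si h)"]) auto
    show "(h \<cdot> p, h \<cdot> q) \<in> L k" if "(p, q) \<in> L k" for k p q
      using orb_left[OF h that A_sub] .
    show "(h \<cdot> p, h \<cdot> q) \<in> orb B \<longleftrightarrow> (p, q) \<in> orb B" if "p \<in> R" "q \<in> R" for p q
      using orb_left[OF h, of p q B] orb_left[OF h', of "h \<cdot> p" "h \<cdot> q" B] B_subset H_cancel(1)[OF h] that by auto
    have HH: "g \<cdot> k \<in> H" if "g \<in> H" "k \<in> H" for g k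
    proof -
      have c: "g \<in> carrier S" "k \<in> carrier S" "si g \<cdot> g = e" using that by (auto simp: H_def)
      have "si (g \<cdot> k) \<cdot> (g \<cdot> k) = si k \<cdot> (si g \<cdot> g) \<cdot> k"
        unfolding sg_inv_mult[OF c(1,2)] using c(1,2) by (simp add: assoc)
      also have "\<dots> = si k \<cdot> (e \<cdot> k)" using c by (simp add: assoc)
      also have "\<dots> = e" using R_left that by (simp add: H_def)
      finally show ?thesis using H_mult_R[OF that(1) H_R[OF that(2)]] by (simp add: H_def)
    qed
    show "(\<cdot>) h ` H = H"
    proof
      show "(\<cdot>) h ` H \<subseteq> H" using HH h by auto
      show "H \<subseteq> (\<cdot>) h ` H"
      proof
        fix k assume k: "k \<in> H"
        then have "k = h \<cdot> (si h \<cdot> k)" using H_cancel(2)[OF h] H_R by simp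
        then show "k \<in> (\<cdot>) h ` H" using HH[OF h' k] by blast
      qed
    qed
  qed
  then show thesis using that r by blast
qed

section \<open>Stabilisers in \<open>B\<close> and the orbit to be glued\<close>

definition fixers :: "'a \<Rightarrow> 'a set" where
  "fixers x = {u \<in> B. x \<cdot> u = x}"

text \<open>These are the fixers in the \<open>\<H>\<close>-class of their least idempotent. If no element of \<open>B\<close>
  fixes \<open>x\<close>, then \<open>core x\<close> is empty, and serves as a point on which nothing acts.\<close>

definition core :: "'a \<Rightarrow> 'a set" where
  "core x = {k \<in> fixers x. \<forall>l\<in>fixers x. k \<in> dom_act l}"

text \<open>Matches the \<open>B\<close>-orbit of \<open>x\<close> with that of
  \<open>core x\<close>. The pair \<open>(x, core x)\<close> is inserted separately for the case
  that no element of \<open>B\<close> is defined at \<open>x\<close>.\<close>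

definition glue :: "'a \<Rightarrow> ('a \<times> 'a set) set" where
  "glue x = insert (x, core x) {(x \<cdot> u, (\<lambda>a. a \<cdot> u) ` core x) | u. u \<in> B \<and> x \<in> dom_act u}"

lemma fixersD: "u \<in> fixers x \<Longrightarrow> u \<in> B \<and> u \<in> carrier S \<and> x \<cdot> u = x"
  by (simp add: fixers_def)

lemma fixers_mult: "\<lbrakk>x \<in> carrier S; u \<in> fixers x; v \<in> fixers x\<rbrakk> \<Longrightarrow> u \<cdot> v \<in> fixers x"
  using assoc[of x u v] by (simp add: fixers_def B_mult)

lemma fixers_inv: "\<lbrakk>x \<in> carrier S; u \<in> fixers x\<rbrakk> \<Longrightarrow> si u \<in> fixers x"
  using fixed_dom_act(2)[of x u] by (simp add: fixers_def B_inv)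

lemma fixers_dom: "\<lbrakk>x \<in> dom_act u; u \<in> B\<rbrakk> \<Longrightarrow> u \<cdot> si u \<in> fixers x"
  using assoc[of x u "si u"] by (auto simp: fixers_def B_mult B_inv dom_act_def)

lemma coreD: "a \<in> core x \<Longrightarrow> a \<in> B \<and> a \<in> carrier S \<and> x \<cdot> a = x"
  by (auto simp: core_def fixers_def)

lemma idem_dom_act: "\<lbrakk>a \<in> carrier S; u \<in> carrier S\<rbrakk> \<Longrightarrow> a \<in> dom_act (u \<cdot> si u) \<longleftrightarrow> a \<in> dom_act u"
  using dom_act_mult[of u "si u" a] dom_act_inv[of u a] by auto

text \<open>The least idempotent among the finitely many fixers lies in the domain of each of
  them.\<close>

lemma core_nonempty:
  assumes x: "x \<in> carrier S" and ne: "fixers x \<noteq> {}"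
  shows "core x \<noteq> {}"
proof -
  define F where "F = (\<lambda>l. l \<cdot> si l) ` fixers x"
  have fin: "finite (fixers x)"
    using finite_A[of True] B_sub[of True] by (auto simp: fixers_def intro: finite_subset)
  have Ff: "F \<subseteq> fixers x" using x by (auto simp: F_def intro: fixers_mult fixers_inv)
  have Fi: "F \<subseteq> idempotents S" using fixersD idem_left by (auto simp: F_def)
  have "a \<cdot> b \<in> F" if "a \<in> F" "b \<in> F" for a b
  proof -
    have ab: "a \<cdot> b \<in> fixers x" "a \<cdot> b \<in> idempotents S"
      using that Ff Fi x by (auto intro: fixers_mult idem_mult)
    then have "si (a \<cdot> b) = a \<cdot> b" using idemD by (intro sg_inv_eq) auto
    then have "a \<cdot> b = a \<cdot> b \<cdot> si (a \<cdot> b)" using ab idemD[of "a \<cdot> b"] by simp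
    then show ?thesis using ab(1) unfolding F_def by blast
  qed
  moreover have "finite F" "F \<noteq> {}" using fin ne by (simp_all add: F_def)
  ultimately obtain g where g: "g \<in> F" "\<And>f. f \<in> F \<Longrightarrow> g \<cdot> f = g"
    using least_idempotent[of F] Fi by blast
  have gS: "g \<in> carrier S" using g Ff fixersD by blast
  have "g \<in> dom_act l" if l: "l \<in> fixers x" for l
  proof -
    have "g \<cdot> (l \<cdot> si l) = g" using g(2) l by (simp add: F_def)
    then show ?thesis using gS l fixersD by (simp add: dom_act_def assoc)
  qed
  then show ?thesis using g Ff by (auto simp: core_def)
qed

lemma core_mult:
  assumes x: "x \<in> carrier S" and a: "a \<in> core x" and u: "u \<in> fixers x"
  shows "a \<cdot> u \<in> core x"
proof -
  have "a \<cdot> u \<in> dom_act l" if l: "l \<in> fixers x" for l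
  proof -
    have "a \<in> dom_act (u \<cdot> l)" using a fixers_mult[OF x u l] by (simp add: core_def)
    then show ?thesis using dom_act_mult[of u l a] u l fixersD by simp
  qed
  then show ?thesis using a u x fixers_mult by (simp add: core_def)
qed

lemma core_image:
  assumes x: "x \<in> carrier S" and u: "u \<in> fixers x"
  shows "(\<lambda>a. a \<cdot> u) ` core x = core x"
proof
  show "(\<lambda>a. a \<cdot> u) ` core x \<subseteq> core x" using core_mult[OF x _ u] by blast
  show "core x \<subseteq> (\<lambda>a. a \<cdot> u) ` core x"
  proof
    fix a assume a: "a \<in> core x"
    have iu: "si u \<in> fixers x" using fixers_inv[OF x u] .
    then have "a \<in> dom_act (si u)" using a by (simp add: core_def)
    then have "a = a \<cdot> si u \<cdot> u" using u fixersD by (simp add: dom_act_def)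
    then show "a \<in> (\<lambda>a. a \<cdot> u) ` core x" using core_mult[OF x a iu] by blast
  qed
qed

text \<open>If \<open>u\<close> is defined at \<open>x\<close>, then \<open>u \<cdot> si u\<close>
  is a fixer, so \<open>u\<close> is defined on the core. Conversely, for \<open>a\<close> in the
  core, \<open>x \<cdot> a = x\<close> transfers \<open>a \<cdot> u \<cdot> si u = a\<close> to
  \<open>x\<close>.\<close>

lemma core_dom:
  assumes x: "x \<in> carrier S" and u: "u \<in> B"
  shows "x \<in> dom_act u \<longleftrightarrow> core x \<noteq> {} \<and> core x \<subseteq> dom_act u"
proof
  assume xu: "x \<in> dom_act u"
  have f: "u \<cdot> si u \<in> fixers x" using fixers_dom[OF xu u] .
  then have "a \<in> dom_act u" if "a \<in> core x" for a
    using that coreD[OF that] u idem_dom_act[of a u] by (simp add: core_def)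
  then show "core x \<noteq> {} \<and> core x \<subseteq> dom_act u" using core_nonempty[OF x] f by blast
next
  assume "core x \<noteq> {} \<and> core x \<subseteq> dom_act u"
  then obtain a where a: "a \<in> core x" "a \<in> dom_act u" by blast
  then have "x \<cdot> u \<cdot> si u = x \<cdot> (a \<cdot> u \<cdot> si u)"
    using coreD[OF a(1)] u x assoc[of x a "u \<cdot> si u"] by (simp add: assoc)
  then show "x \<in> dom_act u" using a x coreD[OF a(1)] by (simp add: dom_act_def)
qed

text \<open>The map \<open>a \<mapsto> x \<cdot> a\<close> sends the core to \<open>x\<close> and
  commutes with \<open>B\<close>; hence a nonempty set determines the point glued to it.\<close>

lemma glue_sound:
  assumes x: "x \<in> carrier S" and pn: "(p, n) \<in> glue x" and a: "a \<in> n"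
  shows "x \<cdot> a = p"
proof -
  consider "a \<in> core x" "p = x" | u b where "u \<in> B" "b \<in> core x" "a = b \<cdot> u" "p = x \<cdot> u"
    using pn a by (auto simp: glue_def)
  then show ?thesis
  proof cases
    case 2
    then show ?thesis using coreD[OF 2(2)] x assoc[of x b u] by simp
  qed (use coreD in blast)
qed

lemma glue_empty: "\<lbrakk>x \<in> carrier S; (p, {}) \<in> glue x\<rbrakk> \<Longrightarrow> p = x"
  using core_dom[of x] by (auto simp: glue_def)

lemma glue_orb: "\<lbrakk>x \<in> R; (p, n) \<in> glue x\<rbrakk> \<Longrightarrow> (x, p) \<in> orb B"
  using orbI[of x _ B] orb_refl[of x B] by (auto simp: glue_def)

lemma glue_inj:
  assumes x: "x \<in> carrier S" shows "single_valued ((glue x)\<inverse>)"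
proof (rule single_valuedI)
  fix n p p' assume a: "(n, p) \<in> (glue x)\<inverse>" "(n, p') \<in> (glue x)\<inverse>"
  show "p = p'"
  proof (cases "n = {}")
    case True then show ?thesis using a glue_empty[OF x] by auto
  next
    case False
    then obtain b where "b \<in> n" by blast
    then have "x \<cdot> b = p" "x \<cdot> b = p'" using a glue_sound[OF x] by blast+
    then show ?thesis by simp
  qed
qed

text \<open>\<open>u \<cdot> si v\<close> is a fixer of \<open>x\<close>, so it permutes the core,
  and following it by \<open>v\<close> has the effect of \<open>u\<close>.\<close>

lemma core_image_eq:
  assumes x: "x \<in> carrier S" and u: "u \<in> B" "x \<in> dom_act u" and v: "v \<in> B" "x \<in> dom_act v"
    and eq: "x \<cdot> u = x \<cdot> v"
  shows "(\<lambda>a. a \<cdot> u) ` core x = (\<lambda>a. a \<cdot> v) ` core x"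
proof -
  have c: "u \<in> carrier S" "v \<in> carrier S" using u v by auto
  have "x \<cdot> (u \<cdot> si v) = x \<cdot> v \<cdot> si v" using eq x c by (simp add: assoc[symmetric])
  then have f: "u \<cdot> si v \<in> fixers x"
    using u v by (simp add: fixers_def B_mult B_inv dom_act_def)
  have "a \<cdot> (u \<cdot> si v) \<cdot> v = a \<cdot> u" if a: "a \<in> core x" for a
  proof -
    have "a \<in> dom_act (u \<cdot> si v)" using a f by (simp add: core_def)
    then have "a \<cdot> u \<in> dom_act (si v)" using dom_act_mult[of u "si v" a] c by simp
    then show ?thesis using c coreD[OF a] by (simp add: dom_act_def assoc)
  qed
  then have "(\<lambda>a. a \<cdot> u) ` core x = (\<lambda>a. a \<cdot> v) ` (\<lambda>a. a \<cdot> (u \<cdot> si v)) ` core x"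
    by (simp add: image_image)
  then show ?thesis by (simp add: core_image[OF x f])
qed

lemma glue_sv:
  assumes x: "x \<in> carrier S" shows "single_valued (glue x)"
proof (rule single_valuedI)
  fix p n n' assume a: "(p, n) \<in> glue x" "(p, n') \<in> glue x"
  have r: "m = core x" if m: "(x, m) \<in> glue x" for m
  proof -
    from m consider "m = core x" | u where "u \<in> B" "x \<cdot> u = x" "m = (\<lambda>a. a \<cdot> u) ` core x"
      unfolding glue_def by force
    then show ?thesis
    proof cases
      case 2
      then show ?thesis using core_image[OF x, of u] by (simp add: fixers_def)
    qed
  qed
  show "n = n'"
  proof (cases "p = x")
    case True
    then show ?thesis using a r by blast
  next
    case False
    then obtain u v where "u \<in> B" "x \<in> dom_act u" "p = x \<cdot> u" "n = (\<lambda>a. a \<cdot> u) ` core x"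
      "v \<in> B" "x \<in> dom_act v" "p = x \<cdot> v" "n' = (\<lambda>a. a \<cdot> v) ` core x"
      using a unfolding glue_def by blast
    then show ?thesis using core_image_eq[OF x, of u v] by simp
  qed
qed

lemma glue_step:
  assumes x: "x \<in> carrier S" and pn: "(p, n) \<in> glue x" and u: "u \<in> B"
  shows "p \<in> dom_act u \<longleftrightarrow> n \<noteq> {} \<and> n \<subseteq> dom_act u"
    and "p \<in> dom_act u \<Longrightarrow> (p \<cdot> u, (\<lambda>a. a \<cdot> u) ` n) \<in> glue x"
proof -
  consider "p = x" "n = core x"
    | v where "v \<in> B" "x \<in> dom_act v" "p = x \<cdot> v" "n = (\<lambda>a. a \<cdot> v) ` core x"
    using pn by (auto simp: glue_def)
  then have "(p \<in> dom_act u \<longleftrightarrow> n \<noteq> {} \<and> n \<subseteq> dom_act u) \<and>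
    (p \<in> dom_act u \<longrightarrow> (p \<cdot> u, (\<lambda>a. a \<cdot> u) ` n) \<in> glue x)"
  proof cases
    case 1
    then show ?thesis using core_dom[OF x u] u by (auto simp: glue_def)
  next
    case (2 v)
    have c: "u \<in> carrier S" "v \<in> carrier S" using u 2 by auto
    have cv: "core x \<noteq> {}" "core x \<subseteq> dom_act v" using core_dom[OF x 2(1)] 2 by auto
    have d: "p \<in> dom_act u \<longleftrightarrow> x \<in> dom_act (v \<cdot> u)" using dom_act_mult[OF c(2,1), of x] 2 by simp
    also have "\<dots> \<longleftrightarrow> core x \<subseteq> dom_act (v \<cdot> u)" using core_dom[OF x B_mult[OF 2(1) u]] cv by simp
    also have "\<dots> \<longleftrightarrow> n \<subseteq> dom_act u" using dom_act_mult[OF c(2,1)] cv 2 by auto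
    finally have 3: "p \<in> dom_act u \<longleftrightarrow> n \<subseteq> dom_act u" .
    have "(p \<cdot> u, (\<lambda>a. a \<cdot> u) ` n) \<in> glue x" if "p \<in> dom_act u"
    proof -
      have "(\<lambda>a. a \<cdot> u) ` n = (\<lambda>a. a \<cdot> (v \<cdot> u)) ` core x"
        using 2(4) c coreD by (simp add: image_image assoc)
      moreover have "p \<cdot> u = x \<cdot> (v \<cdot> u)" using 2 x c by (simp add: assoc)
      ultimately show ?thesis
        using B_mult[OF 2(1) u] d that unfolding glue_def by blast
    qed
    then show ?thesis using 3 cv 2 by auto
  qed
  then show "p \<in> dom_act u \<longleftrightarrow> n \<noteq> {} \<and> n \<subseteq> dom_act u"
    "p \<in> dom_act u \<Longrightarrow> (p \<cdot> u, (\<lambda>a. a \<cdot> u) ` n) \<in> glue x" by auto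
qed

text \<open>A path in this relation is a walk that uses only lobes belonging to
  \<open>T\<close>.\<close>

definition steps_in :: "(bool \<times> 'a) set \<Rightarrow> 'a rel" where
  "steps_in T = {(p, q). \<exists>k. (p, q) \<in> L k \<and> (k, p) \<in> T}"

text \<open>In \<open>R\<close> glued to the orbit of \<open>core x\<close>, the walk from \<open>e1\<close> does not notice the gluing, so \<open>e\<close>
  fixes \<open>e1\<close> there and all of \<open>R\<close> maps to the glued representation (\<open>\<Phi>\<close>). The walk from \<open>e2\<close>
  takes place in the orbit of \<open>core x\<close> (\<open>J\<close>), so \<open>e\<close> fixes a point of that orbit as well.\<close>

lemma gluing:
  assumes x: "x \<in> R" and e1: "e1 \<in> H" and e2: "e2 \<in> H"
    and T: "\<And>k p q. (p, q) \<in> L k \<Longrightarrow> (k, p) \<in> T \<longleftrightarrow> (k, q) \<in> T"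
    and xT: "(True, x) \<in> T" "(False, x) \<notin> T"
    and cs: "cs \<noteq> []" "set cs \<subseteq> A True \<union> A False" "\<And>p. p \<in> carrier S \<Longrightarrow> foldl (\<cdot>) p cs = p \<cdot> e"
      "\<And>F :: 'a \<Rightarrow> (bool \<times> 'a set) rel. F \<in> sg_hom S sym_inv \<Longrightarrow> F e = letters_act F cs"
    and v1: "visited e1 cs \<subseteq> T" and path1: "(e1, x) \<in> (steps_in T)\<^sup>*"
    and v2: "visited e2 cs \<inter> T = {}" and path2: "(x, e2) \<in> (steps_in (- T))\<^sup>*"
  shows "\<exists>v\<in>B. \<exists>a\<in>carrier S. si a \<cdot> a = e \<and> a \<cdot> si a = v \<cdot> si v"
proof -
  have xS: "x \<in> carrier S" using x by simp
  note Tr = glue_sv[OF xS] glue_inj[OF xS]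
  obtain F where F: "F \<in> sg_hom S sym_inv" "\<And>c. c \<in> A True \<Longrightarrow> F c = set_act c"
    "\<And>c y z. c \<in> A False \<Longrightarrow> (y, z) \<in> F c \<longleftrightarrow> (swap (glue x) y, swap (glue x) z) \<in> set_act c"
  proof (rule twist_swap[OF Tr])
    show "p \<in> dom_act u \<longleftrightarrow> n \<noteq> {} \<and> n \<subseteq> dom_act u" if "(p, n) \<in> glue x" "u \<in> B" for p n u
      using glue_step(1)[OF xS that] .
    show "(p \<cdot> u, (\<lambda>a. a \<cdot> u) ` n) \<in> glue x" if "(p, n) \<in> glue x" "u \<in> B" "p \<in> dom_act u" for p n u
      using glue_step(2)[OF xS that] .
  qed (rule that)
  have glT: "(True, p) \<in> T" "(False, p) \<notin> T" if "(p, n) \<in> glue x" for p n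
    using T[of x p] glue_orb[OF x that] B_sub_L xT by blast+
  \<comment> \<open>A glued point has only its lobe of colour \<open>True\<close> in
    \<open>T\<close>, so the twisted letters read inside \<open>T\<close> meet no glued
    point.\<close>
  have step1: "((False, {p}), (False, {p \<cdot> c})) \<in> F c"
    if "(k, p) \<in> T" "c \<in> A k" "p \<in> R" "p \<in> dom_act c" for k p c
  proof (cases k)
    case True
    then show ?thesis using that F(2) by (simp add: set_act_iff)
  next
    case False
    have "(k, p \<cdot> c) \<in> T" using T orbI[OF that(3,2,4)] that(1) by blast
    then have "swap (glue x) (False, {p}) = (False, {p})"
      "swap (glue x) (False, {p \<cdot> c}) = (False, {p \<cdot> c})"
      using that(1) glT(2) False by (auto intro!: swap_simps(3)[OF Tr])
    then show ?thesis using that F(3) False by (simp add: set_act_iff)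
  qed
  have sv: "single_valued (F p)" if "p \<in> carrier S" for p
    using sg_homD(1)[OF F(1) that] by (simp add: sym_inv_carrier)
  define y0 where "y0 = (False, {e1})"
  have ends: "foldl (\<cdot>) h cs = h" if "h \<in> H" for h
    using cs(3)[of h] H_right[OF that] H_R[OF that] by simp
  have endR: "foldl (\<cdot>) h cs \<in> R" if "h \<in> H" for h
    using ends[OF that] H_R[OF that] by simp
  have "(y0, (False, {foldl (\<cdot>) e1 cs})) \<in> letters_act F cs"
    using H_R[OF e1] endR[OF e1] cs(2)
  proof (induction rule: walk_induct)
    case (snoc ds c k)
    then show ?case using step1[of k "foldl (\<cdot>) e1 ds" c] v1 by (auto simp: letters_act_append)
  qed (simp add: y0_def)
  then have y0: "(y0, y0) \<in> F e" using cs(4)[OF F(1)] ends[OF e1] by (simp add: y0_def)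
  \<comment> \<open>The map from \<open>R\<close> to the glued representation that sends
    \<open>e1\<close> to \<open>y0\<close>. It is defined everywhere because \<open>y0\<close> is
    fixed by \<open>e = (si e1 \<cdot> p) \<cdot> si (si e1 \<cdot> p)\<close>.\<close>
  define \<Phi> where "\<Phi> = (\<lambda>p y. (y0, y) \<in> F (si e1 \<cdot> p))"
  have \<Phi>_total: "\<exists>y. \<Phi> p y" if "p \<in> R" for p
  proof -
    have t: "si e1 \<cdot> p \<in> R" using H_mult_R[OF H_inv[OF e1] that] .
    then have "F e = F (si e1 \<cdot> p) O F (si (si e1 \<cdot> p))"
      using sg_homD(2)[OF F(1), of "si e1 \<cdot> p" "si (si e1 \<cdot> p)"] by (simp add: R_def sym_inv_mult del: R_carrier)
    then show ?thesis using y0 by (auto simp: \<Phi>_def)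
  qed
  have \<Phi>_mult: "F (si e1 \<cdot> (p \<cdot> c)) = F (si e1 \<cdot> p) O F c" if "p \<in> R" "c \<in> carrier S" for p c
    using sg_homD(2)[OF F(1), of "si e1 \<cdot> p" c] that H_R[OF e1] by (simp add: sym_inv_mult assoc)
  have \<Phi>_step: "(y, z) \<in> F c" if a: "p \<in> R" "c \<in> carrier S" "\<Phi> p y" "\<Phi> (p \<cdot> c) z" for p c y z
  proof -
    obtain y' where "(y0, y') \<in> F (si e1 \<cdot> p)" "(y', z) \<in> F c"
      using a(4) \<Phi>_mult[OF a(1,2)] by (auto simp: \<Phi>_def)
    then show ?thesis
      using sv[of "si e1 \<cdot> p"] a(1,3) H_R[OF e1] by (auto simp: \<Phi>_def dest: single_valuedD)
  qed
  have "\<Phi> x (False, {x})" using path1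
  proof (induction rule: rtrancl_induct)
    case base
    have "si e1 \<cdot> e1 = e" using e1 by (simp add: H_def)
    then show ?case using y0 by (simp add: \<Phi>_def y0_def)
  next
    case (step p q)
    then obtain k where k: "(p, q) \<in> L k" "(k, p) \<in> T" by (auto simp: steps_in_def)
    show ?case
    proof (cases "p = q")
      case False
      then obtain c where c: "p \<in> R" "c \<in> A k" "p \<in> dom_act c" "q = p \<cdot> c"
        using k(1) by (auto simp: orb_def)
      then show ?thesis
        using step(3) step1[OF k(2) c(2,1,3)] \<Phi>_mult[OF c(1), of c] by (auto simp: \<Phi>_def)
    qed (use step in simp)
  qed
  \<comment> \<open>\<open>n\<close> represents \<open>p\<close> in the glued orbit, seen through
    the exchange. Right multiplication within the domain preserves \<open>a \<cdot> si a\<close>, so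
    this remains the idempotent of an element of \<open>B\<close>.\<close>
  define J where "J = (\<lambda>p n. (\<exists>y. \<Phi> p y \<and> swap (glue x) y = (True, n)) \<and>
    (\<forall>a\<in>n. a \<in> carrier S \<and> x \<cdot> a = p \<and> (\<exists>v\<in>B. a \<cdot> si a = v \<cdot> si v)) \<and> (n = {} \<longrightarrow> p = x))"
  have Jx: "J x (core x)"
    using \<open>\<Phi> x (False, {x})\<close> swap_simps(1)[OF Tr, of x "core x"] coreD
    by (auto simp: J_def glue_def)
  \<comment> \<open>If \<open>n\<close> were glued to a point, that point would be \<open>p\<close>,
    whose lobe of colour \<open>True\<close> would then belong to \<open>T\<close>.\<close>
  have outside: "swap (glue x) (True, n) = (True, n)"
    if "(True, p) \<notin> T" "\<forall>a\<in>n. x \<cdot> a = p" "n = {} \<longrightarrow> p = x" for p n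
  proof (rule swap_simps(4)[OF Tr], rule notI)
    fix p' assume p': "(p', n) \<in> glue x"
    have "p = p'" using glue_sound[OF xS p'] glue_empty[OF xS] p' that(2,3) by (cases "n = {}") auto
    then show False using glT(1)[OF p'] that(1) by simp
  qed
  \<comment> \<open>For the first factor the exchange fixes the points outside \<open>T\<close>; for
    the second, the twist of \<open>F c\<close> cancels the exchange in \<open>J\<close>. In both
    cases the letter acts on \<open>n\<close> by \<open>set_act\<close>.\<close>
  have stepJ: "J (p \<cdot> c) ((\<lambda>a. a \<cdot> c) ` n) \<and> ((True, n), (True, (\<lambda>a. a \<cdot> c) ` n)) \<in> set_act c"
    if J: "J p n" and k: "(k, p) \<notin> T" "c \<in> A k" "p \<in> R" "p \<in> dom_act c" for k p c n
  proof -
    let ?n = "(\<lambda>a. a \<cdot> c) ` n"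
    obtain y where y: "\<Phi> p y" "swap (glue x) y = (True, n)" using J by (auto simp: J_def)
    have cS: "c \<in> carrier S" using k by simp
    have pcR: "p \<cdot> c \<in> R" using R_act k cS by blast
    obtain z where z: "\<Phi> (p \<cdot> c) z" using \<Phi>_total[OF pcR] by blast
    have yz: "(y, z) \<in> F c" using \<Phi>_step[OF k(3) cS y(1) z] .
    have pcT: "(k, p \<cdot> c) \<notin> T" using T orbI[OF k(3,2,4)] k(1) by blast
    have fibre: "\<forall>a\<in>?n. a \<in> carrier S \<and> x \<cdot> a = p \<cdot> c \<and> (\<exists>v\<in>B. a \<cdot> si a = v \<cdot> si v)"
      if "n \<subseteq> dom_act c"
    proof
      fix a' assume "a' \<in> ?n"
      then obtain a where a: "a \<in> n" "a' = a \<cdot> c" by blast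
      then have "a \<in> carrier S" "x \<cdot> a = p" "\<exists>v\<in>B. a \<cdot> si a = v \<cdot> si v" "a \<in> dom_act c"
        using J that by (auto simp: J_def)
      then show "a' \<in> carrier S \<and> x \<cdot> a' = p \<cdot> c \<and> (\<exists>v\<in>B. a' \<cdot> si a' = v \<cdot> si v)"
        using a cS xS dom_act_range[of a c] by (simp add: assoc[symmetric])
    qed
    have "n \<noteq> {} \<and> n \<subseteq> dom_act c \<and> swap (glue x) z = (True, ?n)"
    proof (cases k)
      case True
      have "swap (glue x) (True, n) = (True, n)"
        using outside[of p n] J k True by (auto simp: J_def)
      then have "y = (True, n)" using y swap_swap[OF Tr, of y] by simp
      then have n: "n \<noteq> {}" "n \<subseteq> dom_act c" "z = (True, ?n)"
        using yz F(2) k True by (auto simp: set_act_def)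
      then show ?thesis using outside[of "p \<cdot> c" ?n] fibre pcT True by auto
    next
      case False
      then have "((True, n), swap (glue x) z) \<in> set_act c" using yz F(3) k y by simp
      then show ?thesis by (auto simp: set_act_def)
    qed
    moreover from this z have "\<exists>z. \<Phi> (p \<cdot> c) z \<and> swap (glue x) z = (True, ?n)" by blast
    ultimately show ?thesis using fibre unfolding J_def by (auto simp: set_act_iff)
  qed
  have "\<exists>n. J e2 n" using path2
  proof (induction rule: rtrancl_induct)
    case (step p q)
    then obtain k n where k: "(p, q) \<in> L k" "(k, p) \<notin> T" "J p n" by (auto simp: steps_in_def)
    show ?case
    proof (cases "p = q")
      case False
      then obtain c where "p \<in> R" "c \<in> A k" "p \<in> dom_act c" "q = p \<cdot> c"
        using k(1) by (auto simp: orb_def)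
      then show ?thesis using stepJ[OF k(3,2)] by blast
    qed (use step in simp)
  qed (use Jx in blast)
  then obtain n where n: "J e2 n" by blast
  have "\<exists>m. J (foldl (\<cdot>) e2 cs) m \<and> ((True, n), (True, m)) \<in> letters_act set_act cs"
    using H_R[OF e2] endR[OF e2] cs(2)
  proof (induction rule: walk_induct)
    case (snoc ds c k)
    then obtain m where m: "J (foldl (\<cdot>) e2 ds) m" "((True, n), (True, m)) \<in> letters_act set_act ds" by blast
    have "(k, foldl (\<cdot>) e2 ds) \<notin> T" using snoc v2 by blast
    from stepJ[OF m(1) this snoc(1-3)] show ?case
      using m(2) by (auto simp: letters_act_append)
  qed (use n in simp)
  \<comment> \<open>The untwisted representation \<open>set_act\<close> is evaluated at the same
    word, so \<open>n\<close> is nonempty and lies in the domain of \<open>e\<close>.\<close>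
  then obtain m where "((True, n), (True, m)) \<in> set_act e"
    using cs(4)[OF set_act_hom] by auto
  then obtain a where a: "a \<in> n" "a \<in> dom_act e" by (auto simp: set_act_iff)
  then have aS: "a \<in> carrier S" and xa: "x \<cdot> a = e2" and v: "\<exists>v\<in>B. a \<cdot> si a = v \<cdot> si v"
    using n by (auto simp: J_def)
  have "a \<cdot> e \<cdot> e = a" using a(2) by (simp add: dom_act_def si_e)
  then have ae: "a \<cdot> e = a" using aS ee by (simp add: assoc)
  \<comment> \<open>Since \<open>x \<cdot> a = e2\<close> is in \<open>H\<close>, the idempotent
    \<open>e\<close> is below \<open>si a \<cdot> a\<close>; the converse comes from
    \<open>a \<cdot> e = a\<close>.\<close>
  have "e = si (x \<cdot> a) \<cdot> (x \<cdot> a)" using e2 unfolding xa by (simp add: H_def)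
  also have "\<dots> = si a \<cdot> si x \<cdot> x \<cdot> a"
    unfolding sg_inv_mult[OF xS aS] using xS aS by (simp add: assoc)
  finally have e': "e = si a \<cdot> si x \<cdot> x \<cdot> a" .
  have "e \<cdot> (si a \<cdot> a) = si a \<cdot> si x \<cdot> x \<cdot> a \<cdot> (si a \<cdot> a)" using e' by simp
  also have "\<dots> = si a \<cdot> si x \<cdot> x \<cdot> (a \<cdot> si a \<cdot> a)" using aS xS by (simp add: assoc)
  also have "\<dots> = e" using e' mult_left_idem[OF aS] by simp
  finally have "e \<cdot> (si a \<cdot> a) = e" .
  moreover have "si a \<cdot> a \<cdot> e = si a \<cdot> a" using ae aS by (simp add: assoc)
  ultimately have "si a \<cdot> a = e" using idem_commute[OF e idem_right[OF aS]] by simp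
  then show ?thesis using aS v by blast
qed

section \<open>The finite connected set of lobes met by a word\<close>

lemma finite_visited: "finite (visited p cs)"
proof -
  have "finite (L k `` {q})" for k q
  proof (rule finite_subset)
    show "L k `` {q} \<subseteq> insert q ((\<cdot>) q ` A k)" by (auto simp: orb_def)
  qed (simp add: finite_A)
  moreover have "visited p cs \<subseteq> (\<Union>i\<in>{..<length cs}. \<Union>k\<in>UNIV. Pair k ` (L k `` {foldl (\<cdot>) p (take i cs)}))"
    (is "_ \<subseteq> ?U")
  proof
    fix z assume "z \<in> visited p cs"
    then obtain k q ds c es where *: "z = (k, q)" "cs = ds @ c # es" "(foldl (\<cdot>) p ds, q) \<in> L k"
      by (auto simp: visited_def)
    then have "length ds < length cs" "take (length ds) cs = ds" by simp_all
    then have "z \<in> Pair k ` (L k `` {foldl (\<cdot>) p (take (length ds) cs)})" using * by simp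
    then show "z \<in> ?U" using \<open>length ds < length cs\<close> by blast
  qed
  ultimately show ?thesis by (auto intro: finite_subset)
qed

lemma visited_closed:
  assumes "(p, q) \<in> L k" shows "(k, p) \<in> visited r cs \<longleftrightarrow> (k, q) \<in> visited r cs"
proof -
  have "(z, p) \<in> L k \<longleftrightarrow> (z, q) \<in> L k" for z
    using assms L_equiv[of k] by (meson equivE symD transD)
  then show ?thesis by (simp add: visited_def)
qed

lemma steps_in_sym:
  assumes T: "\<And>k p q. (p, q) \<in> L k \<Longrightarrow> (k, p) \<in> T \<longleftrightarrow> (k, q) \<in> T"
    and pq: "(p, q) \<in> (steps_in T)\<^sup>*"
  shows "(q, p) \<in> (steps_in T)\<^sup>*"
proof -
  have "sym (steps_in T)"
  proof (rule symI)
    fix a b assume "(a, b) \<in> steps_in T"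
    then obtain k where k: "(a, b) \<in> L k" "(k, a) \<in> T" by (auto simp: steps_in_def)
    moreover have "(b, a) \<in> L k" using k L_equiv[of k] by (meson equivE symD)
    ultimately show "(b, a) \<in> steps_in T" using T[OF k(1)] by (auto simp: steps_in_def)
  qed
  then show ?thesis using pq by (meson sym_rtrancl symD)
qed

lemma visited_connected:
  assumes p: "p \<in> R" "foldl (\<cdot>) p cs \<in> R" "set cs \<subseteq> A True \<union> A False"
    and x: "(k, x) \<in> visited p cs"
  shows "(p, x) \<in> (steps_in (visited p cs))\<^sup>*"
proof -
  define V where "V = steps_in (visited p cs)"
  have "\<forall>ds es. cs = ds @ es \<longrightarrow> (p, foldl (\<cdot>) p ds) \<in> V\<^sup>*"
    using p
  proof (induction rule: walk_induct)
    case (snoc ds c k)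
    note IH = snoc(5)
    show ?case
    proof (intro allI impI)
      fix ds' es' assume eq: "ds @ [c] = ds' @ es'"
      show "(p, foldl (\<cdot>) p ds') \<in> V\<^sup>*"
      proof (cases es' rule: rev_cases)
        case Nil
        have "(p, foldl (\<cdot>) p ds) \<in> V\<^sup>*" using IH by simp
        moreover have "(foldl (\<cdot>) p ds, foldl (\<cdot>) p ds \<cdot> c) \<in> V"
          using snoc(1-4) orbI unfolding V_def steps_in_def by blast
        ultimately have "(p, foldl (\<cdot>) p ds \<cdot> c) \<in> V\<^sup>*" by (rule rtrancl_into_rtrancl)
        moreover have "ds' = ds @ [c]" using Nil eq by simp
        ultimately show ?thesis by simp
      next
        case (snoc es'' c')
        then have "ds = ds' @ es''" using eq by simp
        then show ?thesis using IH by blast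
      qed
    qed
  qed simp
  moreover obtain ds c es where *: "cs = ds @ c # es" "c \<in> A k" "(foldl (\<cdot>) p ds, x) \<in> L k"
    using x by (auto simp: visited_def)
  ultimately have "(p, foldl (\<cdot>) p ds) \<in> V\<^sup>*" by blast
  moreover have "(foldl (\<cdot>) p ds, x) \<in> V"
    using * visited_closed[OF *(3)] x unfolding V_def steps_in_def by blast
  ultimately show ?thesis unfolding V_def by (rule rtrancl_into_rtrancl)
qed

text \<open>For infinite \<open>H\<close>, a suitable translate of the lobes met by a word for
  \<open>e\<close> is disjoint from them; the gluing takes place at a point where a path between the
  two leaves the first set.\<close>

lemma finite_H_or_D_related:
  "finite H \<or> (\<exists>v\<in>B. \<exists>a\<in>carrier S. si a \<cdot> a = e \<and> a \<cdot> si a = v \<cdot> si v)"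
proof (cases "finite H")
  case False
  obtain cs where cs: "cs \<noteq> []" "set cs \<subseteq> A True \<union> A False" "\<And>p. p \<in> carrier S \<Longrightarrow> foldl (\<cdot>) p cs = p \<cdot> e"
    "\<And>F :: 'a \<Rightarrow> (bool \<times> 'a set) rel. F \<in> sg_hom S sym_inv \<Longrightarrow> F e = letters_act F cs"
    by (rule walk_word[OF eS]) (rule that)
  define T where "T = visited e cs"
  have closed: "(k, p) \<in> visited r cs \<longleftrightarrow> (k, q) \<in> visited r cs" if "(p, q) \<in> L k" for r k p q
    using visited_closed[OF that] .
  have ends: "foldl (\<cdot>) h cs \<in> R" if "h \<in> H" for h
    using cs(3)[of h] H_right[OF that] H_R[OF that] by simp
  \<comment> \<open>If the walks from \<open>e\<close> and \<open>h\<close> meet the same lobe at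
    \<open>q\<close>, then \<open>si h \<cdot> q\<close> is also visited from \<open>e\<close>, and
    \<open>h = q \<cdot> si (si h \<cdot> q)\<close>. This excludes only finitely many
    \<open>h\<close>.\<close>
  have "finite ((\<lambda>((k, q), (j, q')). q \<cdot> si q') ` (T \<times> T))"
    unfolding T_def using finite_visited by blast
  then obtain h where h: "h \<in> H" "h \<notin> (\<lambda>((k, q), (j, q')). q \<cdot> si q') ` (T \<times> T)"
    using False by (meson finite_subset subsetI)
  have disj: "T \<inter> visited h cs = {}"
  proof (rule ccontr)
    assume "T \<inter> visited h cs \<noteq> {}"
    then obtain k q where q: "(k, q) \<in> T" "(k, q) \<in> visited h cs" by auto
    then obtain ds c es where *: "cs = ds @ c # es" "c \<in> A k" "(foldl (\<cdot>) h ds, q) \<in> L k"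
      by (auto simp: visited_def)
    have hS: "h \<in> carrier S" and qR: "q \<in> R" using h H_R orb_R[OF *(3)] by auto
    have dsS: "set ds \<subseteq> carrier S" using * cs(2) by auto
    let ?q = "si h \<cdot> q"
    have "si h \<cdot> foldl (\<cdot>) h ds = foldl (\<cdot>) (si h \<cdot> h) ds"
      using foldl_mult[of "si h" h ds] hS dsS by simp
    then have "(foldl (\<cdot>) e ds, ?q) \<in> L k"
      using orb_left[OF H_inv[OF h(1)] *(3) A_sub] h(1) by (simp add: H_def)
    then have q': "(k, ?q) \<in> T" using * unfolding T_def visited_def by blast
    have "q \<cdot> si ?q = q \<cdot> si q \<cdot> h"
      using sg_inv_mult[of "si h" q] hS qR by (simp add: assoc)
    also have "\<dots> = h" using qR R_left[OF H_R[OF h(1)]] by (simp add: R_def del: R_carrier)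
    finally have "h = (\<lambda>((k, q), (j, q')). q \<cdot> si q') ((k, q), (k, ?q))" by simp
    then show False using h(2) q(1) q' by blast
  qed
  obtain c0 cs' where c0: "cs = c0 # cs'" using cs(1) by (cases cs) auto
  then obtain k0 where k0: "c0 \<in> A k0" using cs(2) by auto
  have start: "(k0, p) \<in> visited p cs" if "p \<in> R" for p
    unfolding visited_def using c0 k0 orb_refl[OF that] by (force intro: exI[of _ "[]"])
  \<comment> \<open>If no such edge existed, being outside \<open>T\<close> and joined to
    \<open>h\<close> outside \<open>T\<close> would propagate to every lobe, including the first
    lobe visited from \<open>e\<close>.\<close>
  have "\<exists>k x. x \<in> R \<and> (k, x) \<in> T \<and> (\<not> k, x) \<notin> T \<and> (x, h) \<in> (steps_in (- T))\<^sup>*"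
  proof (rule ccontr)
    assume no: "\<not> ?thesis"
    define Q where "Q = (\<lambda>(k, q). (k, q) \<notin> T \<and> (q, h) \<in> (steps_in (- T))\<^sup>*)"
    have "Q (k0, e)"
    proof (rule tree.connected_induct[where P = Q, OF _ H_R[OF h(1)] e_R])
      show "Q (k0, h)" using start[OF H_R[OF h(1)]] disj by (auto simp: Q_def)
    next
      fix k p q assume *: "Q (k, p)" "(p, q) \<in> L k"
      have qp: "(q, p) \<in> L k" using *(2) L_equiv[of k] by (meson equivE symD)
      have "(k, q) \<notin> T" using * closed[OF *(2)] by (auto simp: Q_def T_def)
      then show "Q (k, q)"
        using * qp by (auto simp: Q_def steps_in_def intro: converse_rtrancl_into_rtrancl)
    next
      fix k p assume "p \<in> R" "Q (k, p)"
      moreover have "\<not> (p \<in> R \<and> (\<not> k, p) \<in> T \<and> (\<not> \<not> k, p) \<notin> T \<and> (p, h) \<in> (steps_in (- T))\<^sup>*)"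
        using no by blast
      ultimately show "Q (\<not> k, p)" by (auto simp: Q_def)
    qed
    then show False using start[OF e_R] by (simp add: Q_def T_def)
  qed
  then obtain k x where x: "x \<in> R" "(k, x) \<in> T" "(\<not> k, x) \<notin> T" "(x, h) \<in> (steps_in (- T))\<^sup>*"
    by blast
  have ex: "(e, x) \<in> (steps_in T)\<^sup>*"
    using visited_connected[OF e_R ends[OF e_H] cs(2)] x(2) unfolding T_def by blast
  have cl: "(j, p) \<in> T \<longleftrightarrow> (j, q) \<in> T" if "(p, q) \<in> L j" for j p q
    using closed[OF that] by (simp add: T_def)
  show ?thesis
  proof (cases k)
    case True
    show ?thesis
    proof (rule disjI2, rule gluing[OF x(1) e_H h(1) cl _ _ cs _ ex _ x(4)])
      show "visited e cs \<subseteq> T" by (simp add: T_def)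
    qed (use x(2,3) disj True in auto)
  next
    \<comment> \<open>\<open>gluing\<close> expects the lobe of colour \<open>True\<close> inside
      the given set, so \<open>e\<close> and \<open>h\<close> change roles and \<open>T\<close> is
      replaced by its complement.\<close>
    case False
    have "(h, x) \<in> (steps_in (- T))\<^sup>*" using steps_in_sym[OF _ x(4)] cl by blast
    moreover have "(x, e) \<in> (steps_in (- (- T)))\<^sup>*" using steps_in_sym[OF _ ex] cl by simp
    ultimately show ?thesis
    proof (intro disjI2 gluing[OF x(1) h(1) e_H _ _ _ cs, of "- T"])
      show "visited e cs \<inter> - T = {}" by (simp add: T_def)
    qed (use x(2,3) disj False cl in auto)
  qed
qed simp

end

subsection \<open>Maximal subgroups of the amalgamated free product\<close>

lemma max_subgroup_epi_from_orbit:
  fixes S :: "('s, 'm) sgrp_scheme" and P :: "('p, 'n) sgrp_scheme"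
  assumes S: "inverse_sgrp S" and P: "inverse_sgrp P" and \<iota>: "\<iota> \<in> sg_hom S P"
    and fin: "finite (carrier S)" and e: "e \<in> idempotents P"
    and r: "r \<in> carrier P" "r \<cdot>\<^bsub>P\<^esub> sg_inv P r = e"
    and orbit: "\<And>h. h \<in> carrier (max_subgroup P e) \<Longrightarrow>
      \<exists>s\<in>carrier S. r \<in> inverse_sgrp.dom_act P (\<iota> s) \<and> h \<cdot>\<^bsub>P\<^esub> r = r \<cdot>\<^bsub>P\<^esub> \<iota> s"
  shows "\<exists>g\<in>idempotents S. \<exists>K \<phi>. subgroup K (max_subgroup S g) \<and>
    \<phi> \<in> epi ((max_subgroup S g)\<lparr>carrier := K\<rparr>) (max_subgroup P e)"
proof -
  interpret S: inverse_sgrp S by fact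
  interpret P: inverse_sgrp P by fact
  let ?G = "max_subgroup P e"
  note \<iota>S = sg_homD(1)[OF \<iota>] and \<iota>m = sg_homD(2)[OF \<iota>] and \<iota>i = sg_hom_inv[OF S P \<iota>]
  have eP: "e \<in> carrier P" "e \<cdot>\<^bsub>P\<^esub> e = e" using P.idemD[OF e] by auto
  have er: "e \<cdot>\<^bsub>P\<^esub> r = r" using P.mult_left_idem[OF r(1)] r(2) by simp
  interpret G: group ?G by (rule P.group_max_subgroup[OF e])
  have G: "h \<in> carrier P \<and> h \<cdot>\<^bsub>P\<^esub> P.si h = e \<and> P.si h \<cdot>\<^bsub>P\<^esub> h = e \<and> h \<cdot>\<^bsub>P\<^esub> e = h"
    if "h \<in> carrier ?G" for h
    using that P.mult_left_idem[of h] P.assoc[of h "P.si h" h]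
    by (auto simp: P.max_subgroup_simps[OF e])
  \<comment> \<open>If \<open>s\<close> is defined at \<open>r\<close>, then
    \<open>s \<cdot> si s\<close> belongs to this set; its least element is the \<open>g\<close> to
    be found.\<close>
  define F where "F = {f \<in> idempotents S. r \<cdot>\<^bsub>P\<^esub> \<iota> f = r}"
  have "F \<noteq> {}"
  proof -
    obtain s where "s \<in> carrier S" "r \<in> P.dom_act (\<iota> s)"
      using orbit[OF G.one_closed] by blast
    then have "s \<cdot>\<^bsub>S\<^esub> S.si s \<in> F"
      using S.idem_left r by (simp add: F_def \<iota>m \<iota>i \<iota>S P.dom_act_def P.assoc)
    then show ?thesis by blast
  qed
  moreover have "a \<cdot>\<^bsub>S\<^esub> b \<in> F" if "a \<in> F" "b \<in> F" for a b
  proof -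
    have "r \<cdot>\<^bsub>P\<^esub> \<iota> (a \<cdot>\<^bsub>S\<^esub> b) = (r \<cdot>\<^bsub>P\<^esub> \<iota> a) \<cdot>\<^bsub>P\<^esub> \<iota> b"
      using that r(1) S.idemD[of a] S.idemD[of b] P.assoc[of r "\<iota> a" "\<iota> b"] by (simp add: F_def \<iota>m \<iota>S)
    then show ?thesis using that S.idem_mult by (simp add: F_def)
  qed
  moreover have "finite F" "F \<subseteq> idempotents S"
    using fin by (auto simp: F_def idempotents_def)
  ultimately obtain g where gF: "g \<in> F" and least: "\<And>f. f \<in> F \<Longrightarrow> g \<cdot>\<^bsub>S\<^esub> f = g"
    using S.least_idempotent[of F] by blast
  have g: "g \<in> idempotents S" "g \<in> carrier S" "g \<cdot>\<^bsub>S\<^esub> g = g" and rg: "r \<cdot>\<^bsub>P\<^esub> \<iota> g = r"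
    using gF S.idemD by (auto simp: F_def)
  let ?M = "max_subgroup S g"
  interpret M: group ?M by (rule S.group_max_subgroup[OF g(1)])
  note Ms = S.max_subgroup_simps[OF g(1)]
  define K where "K = {t \<in> carrier ?M. \<exists>h\<in>carrier ?G. h \<cdot>\<^bsub>P\<^esub> r = r \<cdot>\<^bsub>P\<^esub> \<iota> t}"
  define \<phi> where "\<phi> = (\<lambda>t. r \<cdot>\<^bsub>P\<^esub> \<iota> t \<cdot>\<^bsub>P\<^esub> P.si r)"
  have \<phi>: "\<phi> t = h" if "h \<in> carrier ?G" "h \<cdot>\<^bsub>P\<^esub> r = r \<cdot>\<^bsub>P\<^esub> \<iota> t" for t h
    using G[OF that(1)] r by (simp add: \<phi>_def P.assoc flip: that(2))
  have KS: "t \<in> carrier S" if "t \<in> K" for t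
    using that by (simp add: K_def Ms)
  have mult: "(h \<cdot>\<^bsub>P\<^esub> k) \<cdot>\<^bsub>P\<^esub> r = r \<cdot>\<^bsub>P\<^esub> \<iota> (s \<cdot>\<^bsub>S\<^esub> t)"
    if "h \<in> carrier P" "k \<in> carrier P" "h \<cdot>\<^bsub>P\<^esub> r = r \<cdot>\<^bsub>P\<^esub> \<iota> s" "k \<cdot>\<^bsub>P\<^esub> r = r \<cdot>\<^bsub>P\<^esub> \<iota> t"
      "s \<in> carrier S" "t \<in> carrier S" for h k s t
  proof -
    have "(h \<cdot>\<^bsub>P\<^esub> k) \<cdot>\<^bsub>P\<^esub> r = h \<cdot>\<^bsub>P\<^esub> (r \<cdot>\<^bsub>P\<^esub> \<iota> t)" using that r \<iota>S by (simp add: P.assoc)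
    also have "\<dots> = r \<cdot>\<^bsub>P\<^esub> \<iota> s \<cdot>\<^bsub>P\<^esub> \<iota> t"
      using that r \<iota>S P.assoc[of h r "\<iota> t"] by simp
    finally show ?thesis using that r \<iota>S by (simp add: \<iota>m P.assoc)
  qed
  have inv: "P.si h \<cdot>\<^bsub>P\<^esub> r = r \<cdot>\<^bsub>P\<^esub> \<iota> (S.si t)"
    if h: "h \<in> carrier ?G" and t: "t \<in> carrier S" and ht: "h \<cdot>\<^bsub>P\<^esub> r = r \<cdot>\<^bsub>P\<^esub> \<iota> t"
      and rt: "r \<cdot>\<^bsub>P\<^esub> \<iota> (t \<cdot>\<^bsub>S\<^esub> S.si t) = r" for h t
  proof -
    have "P.si h \<cdot>\<^bsub>P\<^esub> r = P.si h \<cdot>\<^bsub>P\<^esub> (r \<cdot>\<^bsub>P\<^esub> \<iota> t \<cdot>\<^bsub>P\<^esub> \<iota> (S.si t))"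
      using rt t r \<iota>S by (simp add: \<iota>m P.assoc)
    also have "\<dots> = P.si h \<cdot>\<^bsub>P\<^esub> (h \<cdot>\<^bsub>P\<^esub> r \<cdot>\<^bsub>P\<^esub> \<iota> (S.si t))" by (simp add: ht)
    also have "\<dots> = (P.si h \<cdot>\<^bsub>P\<^esub> h) \<cdot>\<^bsub>P\<^esub> r \<cdot>\<^bsub>P\<^esub> \<iota> (S.si t)"
      using conjunct1[OF G[OF h]] \<iota>S[OF S.sg_inv_closed[OF t]] r(1) by (simp add: P.assoc)
    finally show ?thesis using G[OF h] er by simp
  qed
  have sub: "subgroup K ?M"
  proof (rule M.subgroupI)
    show "K \<subseteq> carrier ?M" by (auto simp: K_def)
    have "e \<cdot>\<^bsub>P\<^esub> r = r \<cdot>\<^bsub>P\<^esub> \<iota> g" using er rg by simp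
    then have "g \<in> K" using M.one_closed G.one_closed unfolding K_def
      by (auto simp: Ms(3) P.max_subgroup_simps(3)[OF e])
    then show "K \<noteq> {}" by blast
  next
    fix t assume t: "t \<in> K"
    then obtain h where h: "h \<in> carrier ?G" "h \<cdot>\<^bsub>P\<^esub> r = r \<cdot>\<^bsub>P\<^esub> \<iota> t" by (auto simp: K_def)
    have tM: "t \<in> carrier ?M" using t by (simp add: K_def)
    have "P.si h \<in> carrier ?G"
      using G.inv_closed[OF h(1)] P.max_subgroup_inv[OF e h(1)] by simp
    moreover have "P.si h \<cdot>\<^bsub>P\<^esub> r = r \<cdot>\<^bsub>P\<^esub> \<iota> (S.si t)"
      using inv[OF h(1) KS[OF t] h(2)] tM rg by (simp add: Ms)
    ultimately show "inv\<^bsub>?M\<^esub> t \<in> K"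
      using M.inv_closed[OF tM] S.max_subgroup_inv[OF g(1) tM] by (auto simp: K_def)
  next
    fix s t assume st: "s \<in> K" "t \<in> K"
    then obtain h k where h: "h \<in> carrier ?G" "h \<cdot>\<^bsub>P\<^esub> r = r \<cdot>\<^bsub>P\<^esub> \<iota> s"
      "k \<in> carrier ?G" "k \<cdot>\<^bsub>P\<^esub> r = r \<cdot>\<^bsub>P\<^esub> \<iota> t" by (auto simp: K_def)
    have "h \<cdot>\<^bsub>P\<^esub> k \<in> carrier ?G"
      using G.m_closed[OF h(1,3)] by (simp add: P.max_subgroup_simps(2)[OF e])
    moreover have "s \<cdot>\<^bsub>S\<^esub> t \<in> carrier ?M"
      using st M.m_closed[of s t] by (simp add: K_def Ms(2))
    ultimately show "s \<otimes>\<^bsub>?M\<^esub> t \<in> K"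
      using mult[of h k s t] h G KS st unfolding K_def Ms(2) by blast
  qed
  have hom: "\<phi> \<in> hom (?M\<lparr>carrier := K\<rparr>) ?G"
  proof (rule homI)
    fix t assume "t \<in> carrier (?M\<lparr>carrier := K\<rparr>)"
    then show "\<phi> t \<in> carrier ?G" using \<phi> by (auto simp: K_def)
  next
    fix s t assume "s \<in> carrier (?M\<lparr>carrier := K\<rparr>)" "t \<in> carrier (?M\<lparr>carrier := K\<rparr>)"
    then have st: "s \<in> K" "t \<in> K" by auto
    then obtain h k where h: "h \<in> carrier ?G" "h \<cdot>\<^bsub>P\<^esub> r = r \<cdot>\<^bsub>P\<^esub> \<iota> s"
      "k \<in> carrier ?G" "k \<cdot>\<^bsub>P\<^esub> r = r \<cdot>\<^bsub>P\<^esub> \<iota> t" by (auto simp: K_def)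
    have "h \<cdot>\<^bsub>P\<^esub> k \<in> carrier ?G"
      using G.m_closed[OF h(1,3)] by (simp add: P.max_subgroup_simps(2)[OF e])
    then have "\<phi> (s \<cdot>\<^bsub>S\<^esub> t) = h \<cdot>\<^bsub>P\<^esub> k"
      using mult[of h k s t] h G KS st by (intro \<phi>) auto
    then show "\<phi> (s \<otimes>\<^bsub>?M\<lparr>carrier := K\<rparr>\<^esub> t) = \<phi> s \<otimes>\<^bsub>?G\<^esub> \<phi> t"
      using \<phi>[OF h(1,2)] \<phi>[OF h(3,4)] by (simp add: P.max_subgroup_simps(2)[OF e] Ms(2))
  qed
  have "h \<in> \<phi> ` K" if h: "h \<in> carrier ?G" for h
  proof -
    obtain s where s: "s \<in> carrier S" "h \<cdot>\<^bsub>P\<^esub> r = r \<cdot>\<^bsub>P\<^esub> \<iota> s" using orbit[OF h] by blast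
    \<comment> \<open>As \<open>g\<close> fixes \<open>r\<close>, compressing \<open>s\<close> by
      \<open>g\<close> keeps its effect on \<open>r\<close>; minimality of \<open>g\<close> then
      forces the result into the \<H>-class of \<open>g\<close>.\<close>
    define t where "t = g \<cdot>\<^bsub>S\<^esub> s \<cdot>\<^bsub>S\<^esub> g"
    have t: "t \<in> carrier S" using g s by (simp add: t_def)
    have "r \<cdot>\<^bsub>P\<^esub> \<iota> t = (r \<cdot>\<^bsub>P\<^esub> \<iota> g) \<cdot>\<^bsub>P\<^esub> \<iota> s \<cdot>\<^bsub>P\<^esub> \<iota> g"
      unfolding t_def using g s r \<iota>S by (simp add: \<iota>m P.assoc)
    also have "\<dots> = h \<cdot>\<^bsub>P\<^esub> (r \<cdot>\<^bsub>P\<^esub> \<iota> g)" 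
      using rg P.assoc[of h r "\<iota> g"] G[OF h] r(1) \<iota>S[OF g(2)] by (simp add: s(2)[symmetric])
    finally have ht: "h \<cdot>\<^bsub>P\<^esub> r = r \<cdot>\<^bsub>P\<^esub> \<iota> t" using rg by simp
    \<comment> \<open>\<open>x \<cdot> si x\<close> fixes \<open>r\<close>, so it is above
      \<open>g\<close>, while \<open>g \<cdot> x = x\<close> puts it below. This is used for
      \<open>t\<close> and for its inverse.\<close>
    have idem: "x \<cdot>\<^bsub>S\<^esub> S.si x = g"
      if x: "x \<in> carrier S" "g \<cdot>\<^bsub>S\<^esub> x = x" and kx: "k \<in> carrier ?G" "k \<cdot>\<^bsub>P\<^esub> r = r \<cdot>\<^bsub>P\<^esub> \<iota> x" for x k
    proof -
      have "r \<cdot>\<^bsub>P\<^esub> \<iota> x \<cdot>\<^bsub>P\<^esub> P.si (r \<cdot>\<^bsub>P\<^esub> \<iota> x) = r \<cdot>\<^bsub>P\<^esub> P.si r"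
      proof -
        have "k \<cdot>\<^bsub>P\<^esub> r \<cdot>\<^bsub>P\<^esub> P.si (k \<cdot>\<^bsub>P\<^esub> r) = k \<cdot>\<^bsub>P\<^esub> (r \<cdot>\<^bsub>P\<^esub> P.si r) \<cdot>\<^bsub>P\<^esub> P.si k"
          using P.sg_inv_mult[of k r] G[OF kx(1)] r(1) by (simp add: P.assoc)
        then show ?thesis using r(2) G[OF kx(1)] kx(2) by simp
      qed
      then have "r \<in> P.dom_act (\<iota> x)" using r x \<iota>S by (intro P.dom_act_if_range) auto
      then have "x \<cdot>\<^bsub>S\<^esub> S.si x \<in> F"
        using S.idem_left x r \<iota>S by (simp add: F_def \<iota>m \<iota>i P.dom_act_def P.assoc)
      then have "g \<cdot>\<^bsub>S\<^esub> (x \<cdot>\<^bsub>S\<^esub> S.si x) = g" by (rule least)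
      then show ?thesis using x g by (simp add: S.assoc[symmetric])
    qed
    have gt: "g \<cdot>\<^bsub>S\<^esub> t = t" "t \<cdot>\<^bsub>S\<^esub> g = t" using g s by (simp_all add: t_def S.assoc[symmetric], simp add: S.assoc)
    have 1: "t \<cdot>\<^bsub>S\<^esub> S.si t = g" using idem[OF t gt(1) h ht] .
    have sig: "S.si g = g" using g by (intro S.sg_inv_eq) (simp_all add: S.assoc)
    have "g \<cdot>\<^bsub>S\<^esub> S.si t = S.si t" using S.sg_inv_mult[OF t g(2)] gt(2) sig by simp
    moreover have "P.si h \<in> carrier ?G"
      using G.inv_closed[OF h] P.max_subgroup_inv[OF e h] by simp
    moreover have "P.si h \<cdot>\<^bsub>P\<^esub> r = r \<cdot>\<^bsub>P\<^esub> \<iota> (S.si t)"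
      using inv[OF h t ht] 1 rg by simp
    ultimately have 2: "S.si t \<cdot>\<^bsub>S\<^esub> t = g" using idem[of "S.si t" "P.si h"] t by simp
    have "t \<in> K" using 1 2 t h ht by (auto simp: K_def Ms(1))
    then show ?thesis using \<phi>[OF h ht] by blast
  qed
  then have "\<phi> \<in> epi (?M\<lparr>carrier := K\<rparr>) ?G"
    using hom by (auto simp: epi_def hom_def)
  then show ?thesis using g(1) sub by blast
qed

section \<open>The amalgamated free product as an instance of \<open>two_factor\<close>\<close>

context inverse_amalgam
begin

abbreviation "in1 \<equiv> afp_in1 S1 S2 U \<omega>1 \<omega>2"
abbreviation "in2 \<equiv> afp_in2 S1 S2 U \<omega>1 \<omega>2"

lemma foldl_letters:
  "\<lbrakk>v \<in> W; set xs \<subseteq> carrier S1 <+> carrier S2\<rbrakk> \<Longrightarrow>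
    foldl (sg_mult P) (cl v) (map (\<lambda>x. cl [x]) xs) = cl (v @ xs)"
proof (induction xs arbitrary: v)
  case (Cons x xs)
  then have x: "[x] \<in> W" by (auto simp: afp_words_def)
  have "foldl (sg_mult P) (cl (v @ [x])) (map (\<lambda>x. cl [x]) xs) = cl ((v @ [x]) @ xs)"
    using Cons x by (intro Cons.IH) auto
  then show ?case using P_mult[OF Cons.prems(1) x] by simp
qed simp

lemma conjugate_hom:
  assumes "\<And>y. \<theta> (\<theta> y) = y" and f: "f \<in> sg_hom S sym_inv"
  shows "(\<lambda>s. {(\<theta> y, \<theta> z) | y z. (y, z) \<in> f s}) \<in> sg_hom S sym_inv"
proof -
  have *: "{(\<theta> y, \<theta> z) | y z. (y, z) \<in> r} = {(y, z). (\<theta> y, \<theta> z) \<in> r}" for r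
  proof (rule subset_antisym; rule subsetI)
    fix x assume "x \<in> {(\<theta> y, \<theta> z) | y z. (y, z) \<in> r}"
    then show "x \<in> {(y, z). (\<theta> y, \<theta> z) \<in> r}" by (auto simp: assms(1))
  next
    fix x assume "x \<in> {(y, z). (\<theta> y, \<theta> z) \<in> r}"
    then obtain y z where "x = (\<theta> (\<theta> y), \<theta> (\<theta> z))" "(\<theta> y, \<theta> z) \<in> r" using assms(1) by auto
    then show "x \<in> {(\<theta> y, \<theta> z) | y z. (y, z) \<in> r}" by blast
  qed
  have inj: "\<theta> y = \<theta> z \<Longrightarrow> y = z" for y z using assms(1) by metis
  have "{(y, z). (\<theta> y, \<theta> z) \<in> r} \<in> carrier sym_inv" if "r \<in> carrier sym_inv" for r
    using that by (auto simp: sym_inv_carrier single_valued_def intro: inj)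
  moreover have "{(y, z). (\<theta> y, \<theta> z) \<in> r O s} = {(y, z). (\<theta> y, \<theta> z) \<in> r} O {(y, z). (\<theta> y, \<theta> z) \<in> s}" for r s
    using assms(1) by (auto simp: relcomp_unfold) metis
  ultimately show ?thesis
    using sg_homD[OF f] unfolding * by (auto simp: sg_hom_def sym_inv_mult)
qed

lemma image_hom_closed:
  assumes S: "inverse_sgrp S" and T: "inverse_sgrp T" and f: "f \<in> sg_hom S T"
  shows "f ` carrier S \<subseteq> carrier T"
    and "\<lbrakk>a \<in> f ` carrier S; b \<in> f ` carrier S\<rbrakk> \<Longrightarrow> a \<cdot>\<^bsub>T\<^esub> b \<in> f ` carrier S"
    and "a \<in> f ` carrier S \<Longrightarrow> sg_inv T a \<in> f ` carrier S"
proof -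
  interpret S: inverse_sgrp S by fact
  show "f ` carrier S \<subseteq> carrier T" using sg_homD(1)[OF f] by blast
  show "a \<cdot>\<^bsub>T\<^esub> b \<in> f ` carrier S" if ab: "a \<in> f ` carrier S" "b \<in> f ` carrier S"
  proof -
    obtain x y where "x \<in> carrier S" "a = f x" "y \<in> carrier S" "b = f y" using ab by blast
    then show ?thesis using sg_homD(2)[OF f, of x y] by (auto intro!: image_eqI[of _ _ "x \<cdot>\<^bsub>S\<^esub> y"])
  qed
  show "sg_inv T a \<in> f ` carrier S" if "a \<in> f ` carrier S"
    using that sg_hom_inv[OF S T f] by (auto intro!: image_eqI[of _ _ "sg_inv S _"])
qed

text \<open>The condition \<open>twist\<close> is the universal property applied to
  \<open>set_act\<close> on the first factor and its conjugate on the second, which agree on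
  \<open>U\<close> because \<open>\<theta>\<close> commutes with \<open>B\<close>.\<close>

lemma two_factor_afp:
  assumes fin: "finite (carrier S1)" "finite (carrier S2)" and e: "e \<in> idempotents P"
  shows "two_factor P (\<lambda>k. if k then in1 ` carrier S1 else in2 ` carrier S2)
    ((\<lambda>u. in1 (\<omega>1 u)) ` carrier U) e"
proof -
  interpret P: inverse_sgrp P by (rule inverse_sgrp_afp)
  let ?A = "\<lambda>k. if k then in1 ` carrier S1 else in2 ` carrier S2"
  let ?B = "(\<lambda>u. in1 (\<omega>1 u)) ` carrier U"
  note c1 = image_hom_closed[OF S1.inverse_sgrp_axioms inverse_sgrp_afp afp_cocone(1)]
  note c2 = image_hom_closed[OF S2.inverse_sgrp_axioms inverse_sgrp_afp afp_cocone(2)]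
  have inU: "(\<lambda>u. in1 (\<omega>1 u)) \<in> sg_hom U P"
    using sg_homD[OF hom1] sg_homD[OF afp_cocone(1)] by (auto simp: sg_hom_def)
  note cU = image_hom_closed[OF U.inverse_sgrp_axioms inverse_sgrp_afp inU]
  show ?thesis
  proof
    fix k
    show "?A k \<subseteq> carrier P" using c1(1) c2(1) by simp
    show "a \<cdot>\<^bsub>P\<^esub> b \<in> ?A k" if "a \<in> ?A k" "b \<in> ?A k" for a b
      using c1(2) c2(2) that by (cases k) simp_all
    show "sg_inv P a \<in> ?A k" if "a \<in> ?A k" for a
      using c1(3) c2(3) that by (cases k) simp_all
    show "finite (?A k)" using fin by simp
    show "?B \<subseteq> ?A k"
      using sg_homD(1)[OF hom1] sg_homD(1)[OF hom2] by (cases k) (force, force simp: afp_cocone(3))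
  next
    fix a b assume "a \<in> ?B" "b \<in> ?B" then show "a \<cdot>\<^bsub>P\<^esub> b \<in> ?B" by (rule cU(2))
  next
    fix a assume "a \<in> ?B" then show "sg_inv P a \<in> ?B" by (rule cU(3))
  next
    fix a assume "a \<in> carrier P"
    then obtain w where w: "w \<in> W" "a = cl w" by (auto simp: P_carrier)
    then obtain x xs where xs: "w = x # xs" by (cases w) (auto simp: afp_words_def)
    have l: "cl [z] \<in> ?A True \<union> ?A False" if "z \<in> carrier S1 <+> carrier S2" for z
      using that by (auto simp: afp_in1_def afp_in2_def)
    have "set (x # xs) \<subseteq> carrier S1 <+> carrier S2" using w xs by (simp add: afp_words_def)
    then have sub: "(\<lambda>x. cl [x]) ` set (x # xs) \<subseteq> ?A True \<union> ?A False" using l by blast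
    have "a = foldl (sg_mult P) (cl [x]) (map (\<lambda>x. cl [x]) xs)"
      using foldl_letters[of "[x]" xs] w xs by (auto simp: afp_words_def)
    moreover have "set (cl [x] # map (\<lambda>x. cl [x]) xs) \<subseteq> ?A True \<union> ?A False" using sub by simp
    ultimately show "\<exists>c cs. set (c # cs) \<subseteq> ?A True \<union> ?A False \<and> a = foldl (sg_mult P) c cs" by blast
  next
    fix \<theta> :: "bool \<times> ('a + 'b) list set set \<Rightarrow> bool \<times> ('a + 'b) list set set"
    assume \<theta>: "\<And>y. \<theta> (\<theta> y) = y"
      "\<And>u y z. \<lbrakk>u \<in> ?B; (y, z) \<in> P.set_act u\<rbrakk> \<Longrightarrow> (\<theta> y, \<theta> z) \<in> P.set_act u"
    let ?c = "\<lambda>r. {(\<theta> y, \<theta> z) | y z. (y, z) \<in> r}"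
    have f1: "(\<lambda>a. P.set_act (in1 a)) \<in> sg_hom S1 sym_inv"
      and f: "(\<lambda>b. P.set_act (in2 b)) \<in> sg_hom S2 sym_inv"
      using sg_homD[OF afp_cocone(1)] sg_homD[OF afp_cocone(2)] sg_homD[OF P.set_act_hom]
      by (auto simp: sg_hom_def)
    have f2: "(\<lambda>b. ?c (P.set_act (in2 b))) \<in> sg_hom S2 sym_inv"
      using conjugate_hom[OF \<theta>(1) f] .
    have agree: "P.set_act (in1 (\<omega>1 u)) = ?c (P.set_act (in2 (\<omega>2 u)))" if u: "u \<in> carrier U" for u
    proof -
      have "?c (P.set_act (in1 (\<omega>1 u))) \<subseteq> P.set_act (in1 (\<omega>1 u))"
        using \<theta>(2)[of "in1 (\<omega>1 u)"] u by auto
      \<comment> \<open>An involution that maps a relation into itself maps it onto itself.\<close>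
      moreover have "P.set_act (in1 (\<omega>1 u)) \<subseteq> ?c (P.set_act (in1 (\<omega>1 u)))"
      proof clarify
        fix y1 y2 z1 z2 assume "((y1, y2), (z1, z2)) \<in> P.set_act (in1 (\<omega>1 u))"
        then have "(\<theta> (y1, y2), \<theta> (z1, z2)) \<in> P.set_act (in1 (\<omega>1 u))" using \<theta>(2) u by blast
        then show "\<exists>y z. ((y1, y2), (z1, z2)) = (\<theta> y, \<theta> z) \<and> (y, z) \<in> P.set_act (in1 (\<omega>1 u))"
          using \<theta>(1) by metis
      qed
      ultimately show ?thesis using afp_cocone(3)[OF u] by simp
    qed
    obtain F where F: "F \<in> sg_hom P sym_inv" "\<forall>a\<in>carrier S1. F (in1 a) = P.set_act (in1 a)"
      "\<forall>b\<in>carrier S2. F (in2 b) = ?c (P.set_act (in2 b))"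
      by (rule afp_universal[OF inverse_sgrp_sym_inv f1 f2 agree, THEN bexE])
        (assumption, elim conjE, rule that)
    show "\<exists>F\<in>sg_hom P sym_inv. (\<forall>c\<in>?A True. F c = P.set_act c) \<and> (\<forall>c\<in>?A False. F c = ?c (P.set_act c))"
    proof (intro bexI[OF _ F(1)] conjI ballI)
      fix c assume "c \<in> ?A True"
      then show "F c = P.set_act c" using F(2) by auto
    next
      fix c assume "c \<in> ?A False"
      then obtain b where "b \<in> carrier S2" "c = in2 b" by auto
      then show "F c = ?c (P.set_act c)" using bspec[OF F(3)] by simp
    qed
  next
    show "e \<in> idempotents P" by fact
  qed
qed

end

theorem theorem7:
  fixes S1 :: "'a sgrp" and S2 :: "'b sgrp" and U :: "'u sgrp"
    and \<omega>1 :: "'u \<Rightarrow> 'a" and \<omega>2 :: "'u \<Rightarrow> 'b"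
    and e :: "('a + 'b) list set"
  assumes amalgam: "inverse_amalgam S1 S2 U \<omega>1 \<omega>2"
    and finite: "finite (carrier S1)" "finite (carrier S2)"
    and e: "e \<in> idempotents (amalg_free_product S1 S2 U \<omega>1 \<omega>2)"
    and not_D1: "\<forall>f\<in>idempotents S1.
      (e, afp_in1 S1 S2 U \<omega>1 \<omega>2 f) \<notin> green_D (amalg_free_product S1 S2 U \<omega>1 \<omega>2)"
    and not_D2: "\<forall>f\<in>idempotents S2.
      (e, afp_in2 S1 S2 U \<omega>1 \<omega>2 f) \<notin> green_D (amalg_free_product S1 S2 U \<omega>1 \<omega>2)"
  shows "(\<exists>g\<in>idempotents S1. \<exists>K \<phi>. subgroup K (max_subgroup S1 g) \<and>
            \<phi> \<in> epi ((max_subgroup S1 g)\<lparr>carrier := K\<rparr>)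
                    (max_subgroup (amalg_free_product S1 S2 U \<omega>1 \<omega>2) e)) \<or>
         (\<exists>g\<in>idempotents S2. \<exists>K \<phi>. subgroup K (max_subgroup S2 g) \<and>
            \<phi> \<in> epi ((max_subgroup S2 g)\<lparr>carrier := K\<rparr>)
                    (max_subgroup (amalg_free_product S1 S2 U \<omega>1 \<omega>2) e))"
proof -
  interpret inverse_amalgam S1 S2 U \<omega>1 \<omega>2 by (rule amalgam)
  interpret two_factor P "\<lambda>k. if k then in1 ` carrier S1 else in2 ` carrier S2"
    "(\<lambda>u. in1 (\<omega>1 u)) ` carrier U" e
    using finite e by (rule two_factor_afp)
  \<comment> \<open>Such a \<open>v\<close> would come from \<open>S1\<close>, and its idempotent
    would be \<D>-related to \<open>e\<close>, contrary to \<open>not_D1\<close>.\<close>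
  have "\<not> (\<exists>v\<in>(\<lambda>u. in1 (\<omega>1 u)) ` carrier U. \<exists>a\<in>carrier P. si a \<cdot>\<^bsub>P\<^esub> a = e \<and> a \<cdot>\<^bsub>P\<^esub> si a = v \<cdot>\<^bsub>P\<^esub> si v)"
  proof
    assume "\<exists>v\<in>(\<lambda>u. in1 (\<omega>1 u)) ` carrier U. \<exists>a\<in>carrier P. si a \<cdot>\<^bsub>P\<^esub> a = e \<and> a \<cdot>\<^bsub>P\<^esub> si a = v \<cdot>\<^bsub>P\<^esub> si v"
    then obtain u a where u: "u \<in> carrier U" and a: "a \<in> carrier P" "si a \<cdot>\<^bsub>P\<^esub> a = e"
      "a \<cdot>\<^bsub>P\<^esub> si a = in1 (\<omega>1 u) \<cdot>\<^bsub>P\<^esub> si (in1 (\<omega>1 u))" by blast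
    have s: "\<omega>1 u \<in> carrier S1" using sg_homD(1)[OF hom1 u] .
    have "in1 (\<omega>1 u) \<cdot>\<^bsub>P\<^esub> si (in1 (\<omega>1 u)) = in1 (\<omega>1 u \<cdot>\<^bsub>S1\<^esub> sg_inv S1 (\<omega>1 u))"
      using s sg_homD(2)[OF afp_cocone(1)]
        sg_hom_inv[OF S1.inverse_sgrp_axioms inverse_sgrp_afp afp_cocone(1) s] by simp
    then have "(e, in1 (\<omega>1 u \<cdot>\<^bsub>S1\<^esub> sg_inv S1 (\<omega>1 u))) \<in> green_D P"
      using green_D_inverse[OF a(1)] a(2,3) by simp
    then show False using not_D1 S1.idem_left[OF s] by blast
  qed
  then have "finite H" using finite_H_or_D_related by blast
  then obtain k r where r: "r \<in> R" and fixed: "\<And>h. h \<in> H \<Longrightarrow>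
      (r, h \<cdot>\<^bsub>P\<^esub> r) \<in> orb (if k then in1 ` carrier S1 else in2 ` carrier S2)"
    by (rule finite_H_fixed_orbit) (rule that)
  have H: "carrier (max_subgroup P e) = H"
    by (auto simp: max_subgroup_simps[OF e] H_def R_def simp del: R_carrier)
  have rP: "r \<in> carrier P" "r \<cdot>\<^bsub>P\<^esub> si r = e" using r by (simp_all add: R_def del: R_carrier)
  define X where "X = (if k then in1 ` carrier S1 else in2 ` carrier S2)"
  show ?thesis
  proof (cases "\<exists>s\<in>X. r \<in> dom_act s")
    case True
    then obtain s where s: "s \<in> X" "r \<in> dom_act s" by blast
    have sP: "s \<in> carrier P" "si s \<in> X" and XX: "\<And>a b. \<lbrakk>a \<in> X; b \<in> X\<rbrakk> \<Longrightarrow> a \<cdot>\<^bsub>P\<^esub> b \<in> X"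
      using s(1) A_sub[of k] A_inv[of _ k] A_mult[of _ k] by (auto simp: X_def)
    have "\<exists>t\<in>X. r \<in> dom_act t \<and> h \<cdot>\<^bsub>P\<^esub> r = r \<cdot>\<^bsub>P\<^esub> t" if "h \<in> carrier (max_subgroup P e)" for h
    proof -
      have "(r, h \<cdot>\<^bsub>P\<^esub> r) \<in> orb X" using fixed that H by (simp add: X_def)
      \<comment> \<open>A reflexive pair of \<open>orb\<close> carries no letter; if
        \<open>h\<close> fixes \<open>r\<close>, the idempotent \<open>s \<cdot> si s\<close> has
        the same effect.\<close>
      moreover have "r \<in> dom_act (s \<cdot>\<^bsub>P\<^esub> si s)" "r \<cdot>\<^bsub>P\<^esub> (s \<cdot>\<^bsub>P\<^esub> si s) = r"
        using s(2) sP(1) rP(1) idem_dom_act[of r s] assoc[of r s "si s"] by (simp_all add: dom_act_def)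
      ultimately show ?thesis using XX[OF s(1) sP(2)] by (auto simp: orb_def)
    qed
    note orbit = this
    show ?thesis
    proof (cases k)
      case True
      show ?thesis
        by (rule disjI1, rule max_subgroup_epi_from_orbit[OF S1.inverse_sgrp_axioms
              inverse_sgrp_afp afp_cocone(1) finite(1) e rP])
          (use orbit True in \<open>auto simp: X_def\<close>)
    next
      case False
      show ?thesis
        by (rule disjI2, rule max_subgroup_epi_from_orbit[OF S2.inverse_sgrp_axioms
              inverse_sgrp_afp afp_cocone(2) finite(2) e rP])
          (use orbit False in \<open>auto simp: X_def\<close>)
    qed
  next
    \<comment> \<open>No element of the factor is defined at \<open>r\<close>, so its lobe is a
      single point; fixing it makes \<open>H\<close> trivial, and any maximal subgroup of
      \<open>S1\<close> maps onto it.\<close>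
    case False
    have "h = e" if "h \<in> H" for h
    proof -
      have "h \<cdot>\<^bsub>P\<^esub> r = r" using fixed[OF that] False by (auto simp: orb_def X_def)
      then have "h \<cdot>\<^bsub>P\<^esub> (r \<cdot>\<^bsub>P\<^esub> si r) = e" using rP H_R[OF that] assoc[of h r "si r"] by simp
      then show ?thesis using rP H_right[OF that] by simp
    qed
    then have He: "H = {e}" using e_H by blast
    obtain s where "s \<in> carrier S1" using S1.nonempty by blast
    then have g: "s \<cdot>\<^bsub>S1\<^esub> sg_inv S1 s \<in> idempotents S1" by (rule S1.idem_left)
    let ?M = "max_subgroup S1 (s \<cdot>\<^bsub>S1\<^esub> sg_inv S1 s)"
    interpret M: group ?M by (rule S1.group_max_subgroup[OF g])
    have "subgroup (carrier ?M) ?M" by (rule M.subgroup_self)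
    moreover have "(\<lambda>_. e) \<in> epi (?M\<lparr>carrier := carrier ?M\<rparr>) (max_subgroup P e)"
      using M.one_closed He ee by (auto simp: epi_def hom_def H max_subgroup_simps(2)[OF e])
    ultimately show ?thesis using g by blast
  qed
qed

end
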